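(* Consider an additive orthogonal regression code with coefficient sets $\mathcal{B}_1,\dots,\mathcal{B}_L\subset\mathbb{R}^N$ and constants $c_1,\dots,c_L>0$, with either distance-based or correlation-based greedy encoding, where the design matrix $A\in\mathbb{R}^{n\times N}$ has i.i.d. $\mathcal{N}(0,1)$ entries and is independent of the source vector $x\in\mathbb{R}^n$ (which can be deterministic or arbitrarily distributed). Then, for each stage $l\in\{1,\dots,L\}$ there exists a $1$-Lipschitz function $\mu_l:\mathbb{R}_+\to\mathbb{R}_+$ such that: 1. The residual $r_l=x-A\beta_l$ at each stage satisfies $\mathbb{E}[\|r_l\|\mid x]=\mu_l(\|x\|)$ for all $x\in\mathbb{R}^n$. 2. The centered norm $\|r_l\|-\mu_l(\|x\|)$ is sub-Gaussian with variance proxy $\sum_{k=1}^l c_k^2$. In particular, for all $t\ge 0$, $$\mathbb{P}\Big(\big|\|r_l\|-\mu_l(\|x\|)\big|\ge t\Big)\le 2\exp\left\{-\frac{t^2}{2\sum_{k=1}^l c_k^2}\right\}.$$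
   Context: $\|\cdot\|$ is the Euclidean norm and $\mathbb{R}_+=[0,\infty)$. Additive orthogonal regression code: finite sets $\mathcal{B}_1,\dots,\mathcal{B}_L\subset\mathbb{R}^N$ that are mutually orthogonal ($\langle b,b'\rangle=0$ for $b\in\mathcal{B}_l$, $b'\in\mathcal{B}_{l'}$, $l\ne l'$), with $\|b\|=c_l$ for every $b\in\mathcal{B}_l$, where $c_l>0$ is a constant. The codebook is $\{A\beta:\beta\in\mathcal{B}_1+\cdots+\mathcal{B}_L\}\subset\mathbb{R}^n$, where $\mathcal{B}_1+\cdots+\mathcal{B}_L=\{\sum_{l=1}^L\beta_l:\beta_l\in\mathcal{B}_l\}$. Greedy encoding of a source vector $x\in\mathbb{R}^n$: set $\beta_0=0$, $r_0=x$, and for $l=1,\dots,L$ determine $b_l\in\mathcal{B}_l$, then set $\beta_l=\beta_{l-1}+b_l$ and $r_l=x-A\beta_l$. The choice of $b_l$ is - distance-based: $b_l=\operatorname{arg\,min}_{b\in\mathcal{B}_l}\|r_{l-1}-Ab\|$; - correlation-based: $b_l=\operatorname{arg\,max}_{b\in\mathcal{B}_l}\langle r_{l-1},Ab\rangle$. A zero-mean random variable $X$ is sub-Gaussian with variance proxy $\nu\ge0$ if $\log\mathbb{E}[e^{\lambda X}]\le\lambda^2\nu/2$ for all $\lambda\in\mathbb{R}$.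
   Formalization: For correlation-based encoding with zero residual (in effect x = 0) all b tie, and the claim fails for a fixed tie break; there the tie is broken by maximizing ⟨u, Ab⟩ for an arbitrary fixed nonzero u. Other ties are resolved by an arbitrary choice function of the tied set. *)

theory Defs
  imports "HOL-Probability.Probability"
begin

text \<open>Coefficient sets are indexed from 1. Non-emptiness is what makes the greedy
  choice of an element of \<open>B l\<close> possible.\<close>

definition additive_orthogonal_code ::
    "nat \<Rightarrow> (nat \<Rightarrow> (real^'N) set) \<Rightarrow> (nat \<Rightarrow> real) \<Rightarrow> bool" where
  "additive_orthogonal_code L B c \<longleftrightarrow>
     (\<forall>l\<in>{1..L}. finite (B l) \<and> B l \<noteq> {} \<and> 0 < c l \<and> (\<forall>b\<in>B l. norm b = c l)) \<and>
     (\<forall>l\<in>{1..L}. \<forall>l'\<in>{1..L}. l \<noteq> l' \<longrightarrow> (\<forall>b\<in>B l. \<forall>b'\<in>B l'. b \<bullet> b' = 0))"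

datatype greedy_rule = Distance_Based | Correlation_Based

text \<open>The admissible choices in a stage with coefficient set \<open>S\<close> and current residual \<open>r\<close>.
  For zero residual all correlations vanish and every element of \<open>S\<close> is a maximiser of the
  correlation. This happens with positive probability if the source vector may vanish, and then
  the law of the next residual depends on how the tie is broken: if a fixed element of \<open>S\<close> is
  taken, the mean of the next residual norm is in general discontinuous at the zero source vector.
  The tie is therefore broken as if the residual had pointed in a fixed
  direction \<open>u\<close>, which is the limit of the rule for residuals \<open>\<epsilon> u\<close> with \<open>\<epsilon>\<close>
  decreasing to 0 (up to ties). The direction plays no role for non-zero residuals.\<close>

fun greedy_choices ::
    "greedy_rule \<Rightarrow> real^'n \<Rightarrow> real^'N^'n \<Rightarrow> (real^'N) set \<Rightarrow> real^'n \<Rightarrow> (real^'N) set" where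
  "greedy_choices Distance_Based u A S r =
     {b. is_arg_min (\<lambda>b. norm (r - A *v b)) (\<lambda>b. b \<in> S) b}"
| "greedy_choices Correlation_Based u A S r =
     (let C = {b. is_arg_max (\<lambda>b. r \<bullet> (A *v b)) (\<lambda>b. b \<in> S) b}
      in if r = 0 then {b. is_arg_max (\<lambda>b. u \<bullet> (A *v b)) (\<lambda>b. b \<in> C) b} else C)"

lemma greedy_choices_Correlation_Based_subset:
  "greedy_choices Correlation_Based u A S r \<subseteq>
     {b. is_arg_max (\<lambda>b. r \<bullet> (A *v b)) (\<lambda>b. b \<in> S) b}"
  by (auto simp: is_arg_max_def Let_def)

text \<open>Remaining ties in stage \<open>l\<close> are resolved by an arbitrary choice function \<open>\<tau> l\<close>
  applied to the set of tied elements.\<close>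

definition tie_breaking ::
    "nat \<Rightarrow> (nat \<Rightarrow> (real^'N) set) \<Rightarrow> (nat \<Rightarrow> (real^'N) set \<Rightarrow> real^'N) \<Rightarrow> bool" where
  "tie_breaking L B \<tau> \<longleftrightarrow> (\<forall>l\<in>{1..L}. \<forall>C. C \<subseteq> B l \<and> C \<noteq> {} \<longrightarrow> \<tau> l C \<in> C)"

fun greedy_coefficient ::
    "greedy_rule \<Rightarrow> real^'n \<Rightarrow> (nat \<Rightarrow> (real^'N) set \<Rightarrow> real^'N) \<Rightarrow> (nat \<Rightarrow> (real^'N) set) \<Rightarrow>
     real^'N^'n \<Rightarrow> real^'n \<Rightarrow> nat \<Rightarrow> real^'N" where
  "greedy_coefficient rule u \<tau> B A x 0 = 0"
| "greedy_coefficient rule u \<tau> B A x (Suc l) =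
     (let \<beta> = greedy_coefficient rule u \<tau> B A x l
      in \<beta> + \<tau> (Suc l) (greedy_choices rule u A (B (Suc l)) (x - A *v \<beta>)))"

definition greedy_residual ::
    "greedy_rule \<Rightarrow> real^'n \<Rightarrow> (nat \<Rightarrow> (real^'N) set \<Rightarrow> real^'N) \<Rightarrow> (nat \<Rightarrow> (real^'N) set) \<Rightarrow>
     real^'N^'n \<Rightarrow> real^'n \<Rightarrow> nat \<Rightarrow> real^'n" where
  "greedy_residual rule u \<tau> B A x l = x - A *v greedy_coefficient rule u \<tau> B A x l"

definition (in prob_space) std_gaussian_matrix :: "('a \<Rightarrow> real^'N^'n) \<Rightarrow> bool" where
  "std_gaussian_matrix A \<longleftrightarrow>
     indep_vars (\<lambda>_. borel) (\<lambda>(i, j) \<omega>. A \<omega> $ i $ j) UNIV \<and>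
     (\<forall>i j. distributed M lborel (\<lambda>\<omega>. A \<omega> $ i $ j) std_normal_density)"

definition (in prob_space) sub_gaussian :: "real \<Rightarrow> ('a \<Rightarrow> real) \<Rightarrow> bool" where
  "sub_gaussian \<nu> X \<longleftrightarrow>
     0 \<le> \<nu> \<and> integrable M X \<and> expectation X = 0 \<and>
     (\<forall>s. integrable M (\<lambda>\<omega>. exp (s * X \<omega>)) \<and>
          ln (expectation (\<lambda>\<omega>. exp (s * X \<omega>))) \<le> s\<^sup>2 * \<nu> / 2)"

end

theory Submission
  imports Defs
begin

text \<open>For a fixed residual \<open>r\<close>, rotational invariance shows that the norm of the next residual has the
  law of \<open>F \<parallel>r\<parallel> G\<close>, where \<open>G\<close> is a standard Gaussian matrix and \<open>F\<close> is 1-Lipschitz in the first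
  and \<open>c l\<close>-Lipschitz in the second argument; for the distance rule \<open>F\<close> is the minimum of
  \<open>\<parallel>s e - G b\<parallel>\<close>, for the correlation rule only the law, not the norm itself, is of this form.
  Since the coefficient sets are orthogonal, each stage sees a fresh Gaussian matrix. So if \<open>h\<close> is
  1-Lipschitz, the conditional mean of \<open>h \<parallel>r\<^sub>l\<parallel>\<close> given \<open>r\<^sub>l\<^sub>-\<^sub>1\<close> is a 1-Lipschitz function of the norm of
  \<open>r\<^sub>l\<^sub>-\<^sub>1\<close>, and the deviation from it is sub-Gaussian with variance proxy \<open>(c l)\<^sup>2\<close>
  by Gaussian concentration. Iterating gives a sum of squares, as for martingale differences.

  The sharp constant in the concentration inequality comes from a random walk: write a Gaussian
  vector as a sum of \<open>m\<close> independent ones of variance \<open>1/m\<close>. A function smoothed by a Gaussian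
  convolution is affine up to second order, uniformly, so that each step contributes a factor
  \<open>1 + c\<^sup>2/(2m) + O(m\<^sup>-\<^sup>3\<^sup>/\<^sup>2)\<close> to the exponential moment. Let \<open>m\<close> tend to infinity, then the
  smoothing parameter to 0.\<close>

section \<open>Gaussian measures on Euclidean spaces\<close>

text \<open>Two obstacles shape the proof. The correlation rule selects by one coordinate of the
  images \<open>G *v b\<close>; when the selection changes, the other coordinates jump, so the
  residual norm is not Lipschitz in the matrix and concentration does not apply to it. Since the
  conclusions concern laws only, each stage may be traded for a Lipschitz function with the same
  law. Second, \<open>norm x\<close> need not be integrable. Exponential bounds are therefore proved
  for a fixed source vector, with a proxy that does not depend on it, and only the centred norm is
  integrated over the law of \<open>x\<close>.

  The direction \<open>u\<close> prescribed for zero residuals makes the law of a stage equal to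
  that of \<open>F 0\<close> there, the continuous extension of \<open>F s\<close>. So the zero
  residual is no exception, and the mean is 1-Lipschitz up to the boundary point 0.

  The walk avoids differentiating under an integral: it needs Taylor bounds of \<open>exp\<close>
  and one first-order estimate for smoothed functions. The exponent 3/2 matters because
  \<open>m\<close> errors of that order still sum to one that vanishes, of order 1/sqrt(m).\<close>

lemma borel_measurable_linear:
  fixes T :: "'a::euclidean_space \<Rightarrow> 'b::euclidean_space"
  shows "linear T \<Longrightarrow> T \<in> borel_measurable borel"
  by (simp add: borel_measurable_continuous_onI linear_continuous_on linear_conv_bounded_linear)

text \<open>Translation invariant measures that are finite on balls are multiples of \<open>lborel\<close>: integrating
  \<open>f (x + y) * g y\<close> in both orders relates \<open>\<integral>f\<close> under the two measures. The unit
  ball, invariant under \<open>T\<close>, fixes the factor.\<close>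

lemma distr_lborel_orthogonal_transformation:
  fixes T :: "'a::euclidean_space \<Rightarrow> 'a"
  assumes T: "orthogonal_transformation T"
  shows "distr lborel borel T = lborel"
proof -
  have lin: "linear T" and nrm: "norm (T x) = norm x" for x
    using T by (auto simp: orthogonal_transformation)
  have T_meas[measurable]: "T \<in> borel_measurable borel"
    by (rule borel_measurable_linear[OF lin])
  define \<nu> where "\<nu> = distr lborel borel T"
  have sets_\<nu>[measurable_cong]: "sets \<nu> = sets borel" by (simp add: \<nu>_def)
  have T_shift: "T (x + inv T a) = T x + a" for x a
    using T orthogonal_transformation_surj[OF T]
    by (simp add: linear_add[OF lin] surj_f_inv_f)
  have shift: "(\<integral>\<^sup>+x. f (x + a) \<partial>\<nu>) = (\<integral>\<^sup>+x. f x \<partial>\<nu>)"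
    if [measurable]: "f \<in> borel_measurable borel" for f :: "'a \<Rightarrow> ennreal" and a
  proof -
    have "(\<integral>\<^sup>+x. f x \<partial>\<nu>) = (\<integral>\<^sup>+x. f (T x) \<partial>lborel)"
      unfolding \<nu>_def by (simp add: nn_integral_distr)
    also have "\<dots> = (\<integral>\<^sup>+x. f (T x) \<partial>distr lborel borel ((+) (inv T a)))"
      by (simp add: lborel_distr_plus)
    also have "\<dots> = (\<integral>\<^sup>+x. f (T (x + inv T a)) \<partial>lborel)"
      by (simp add: nn_integral_distr add.commute)
    also have "\<dots> = (\<integral>\<^sup>+x. f (x + a) \<partial>\<nu>)"
      unfolding \<nu>_def T_shift by (simp add: nn_integral_distr)
    finally show ?thesis by simp
  qed
  have shift_l: "(\<integral>\<^sup>+x. f (x + a) \<partial>lborel) = (\<integral>\<^sup>+x. f x \<partial>lborel)"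
    if [measurable]: "f \<in> borel_measurable borel" for f :: "'a \<Rightarrow> ennreal" and a
    by (subst (2) lborel_distr_plus[of a, symmetric]) (simp add: nn_integral_distr add.commute)
  have ball: "emeasure \<nu> (ball 0 r) = emeasure lborel (ball (0::'a) r)" for r
  proof -
    have "T -` ball 0 r = ball 0 r" by (auto simp: nrm)
    thus ?thesis unfolding \<nu>_def by (subst emeasure_distr) auto
  qed
  interpret N: sigma_finite_measure \<nu>
  proof (rule sigma_finite_measure.intro, intro exI conjI)
    show "countable (range (\<lambda>n::nat. ball (0::'a) (real n)))" by simp
    show "range (\<lambda>n::nat. ball (0::'a) (real n)) \<subseteq> sets \<nu>" by (auto simp: sets_\<nu>)
    show "\<Union> (range (\<lambda>n::nat. ball (0::'a) (real n))) = space \<nu>"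
      using reals_Archimedean2 by (auto simp: \<nu>_def)
    show "\<forall>a\<in>range (\<lambda>n::nat. ball (0::'a) (real n)). emeasure \<nu> a \<noteq> \<infinity>"
      using ball emeasure_lborel_ball_finite[of "0::'a"] by (auto simp: less_top)
  qed
  interpret P: pair_sigma_finite \<nu> lborel ..
  define g :: "'a \<Rightarrow> ennreal" where "g = indicator (ball 0 1)"
  have g_meas[measurable]: "g \<in> borel_measurable borel" unfolding g_def by (rule borel_measurable_indicator) simp
  \<comment> \<open>Evenness lets \<open>g (y - x)\<close> be read as a translate of
    \<open>g\<close> in the variable \<open>x\<close>, to which \<open>shift\<close>
    applies.\<close>
  have g_sym: "g (- x) = g x" for x by (simp add: g_def indicator_def)
  have b0: "emeasure lborel (ball (0::'a) 1) \<noteq> 0"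
    using content_ball_pos[of 1 "0::'a"] by (auto simp: measure_def)
  have b1: "emeasure lborel (ball (0::'a) 1) \<noteq> \<infinity>"
    using emeasure_lborel_ball_finite[of "0::'a" 1] by simp
  have gn: "(\<integral>\<^sup>+x. g x \<partial>\<nu>) = emeasure lborel (ball (0::'a) 1)"
    and gl: "(\<integral>\<^sup>+x. g x \<partial>lborel) = emeasure lborel (ball (0::'a) 1)"
    by (simp_all add: g_def ball sets_\<nu>)
  have "emeasure \<nu> S = emeasure lborel S" if S: "S \<in> sets borel" for S
  proof -
    have [measurable]: "S \<in> sets borel" by fact
    define f :: "'a \<Rightarrow> ennreal" where "f = indicator S"
    have [measurable]: "f \<in> borel_measurable borel" by (simp add: f_def)
    have "(\<integral>\<^sup>+x. f x \<partial>\<nu>) * (\<integral>\<^sup>+y. g y \<partial>lborel) = (\<integral>\<^sup>+y. (\<integral>\<^sup>+x. f x \<partial>\<nu>) * g y \<partial>lborel)"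
      by (subst nn_integral_cmult) auto
    also have "\<dots> = (\<integral>\<^sup>+y. (\<integral>\<^sup>+x. f (x + y) \<partial>\<nu>) * g y \<partial>lborel)"
      by (simp add: shift)
    also have "\<dots> = (\<integral>\<^sup>+y. (\<integral>\<^sup>+x. f (x + y) * g y \<partial>\<nu>) \<partial>lborel)"
      by (intro nn_integral_cong nn_integral_multc[symmetric]) auto
    also have "\<dots> = (\<integral>\<^sup>+x. (\<integral>\<^sup>+y. f (x + y) * g y \<partial>lborel) \<partial>\<nu>)"
      by (rule P.Fubini') simp
    also have "\<dots> = (\<integral>\<^sup>+x. (\<integral>\<^sup>+y. f y * g (y - x) \<partial>lborel) \<partial>\<nu>)"
    proof (rule nn_integral_cong)
      fix x :: 'a
      have "(\<integral>\<^sup>+y. f y * g (y - x) \<partial>lborel) = (\<integral>\<^sup>+y. f (y + x) * g ((y + x) - x) \<partial>lborel)"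
        by (rule shift_l[symmetric]) simp
      thus "(\<integral>\<^sup>+y. f (x + y) * g y \<partial>lborel) = (\<integral>\<^sup>+y. f y * g (y - x) \<partial>lborel)"
        by (simp add: add.commute)
    qed
    also have "\<dots> = (\<integral>\<^sup>+y. (\<integral>\<^sup>+x. f y * g (y - x) \<partial>\<nu>) \<partial>lborel)"
      by (rule P.Fubini'[symmetric]) simp
    also have "\<dots> = (\<integral>\<^sup>+y. f y * (\<integral>\<^sup>+x. g x \<partial>\<nu>) \<partial>lborel)"
    proof (rule nn_integral_cong)
      fix y :: 'a
      have "g (y - x) = g (x + - y)" for x using g_sym[of "x + - y"] by simp
      hence "(\<integral>\<^sup>+x. f y * g (y - x) \<partial>\<nu>) = f y * (\<integral>\<^sup>+x. g (x + - y) \<partial>\<nu>)"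
        by (simp only:) (rule nn_integral_cmult, simp)
      thus "(\<integral>\<^sup>+x. f y * g (y - x) \<partial>\<nu>) = f y * (\<integral>\<^sup>+x. g x \<partial>\<nu>)"
        using shift[of g "-y"] by simp
    qed
    also have "\<dots> = (\<integral>\<^sup>+y. f y \<partial>lborel) * (\<integral>\<^sup>+x. g x \<partial>\<nu>)"
      by (subst nn_integral_multc) auto
    finally have "emeasure \<nu> S * emeasure lborel (ball (0::'a) 1)
        = emeasure lborel S * emeasure lborel (ball (0::'a) 1)"
      unfolding gn gl f_def using S by (simp add: sets_\<nu>)
    thus ?thesis using b0 b1 by (simp add: mult.commute[of _ "emeasure lborel (ball 0 1)"] ennreal_mult_cancel_left)
  qed
  hence "\<nu> = lborel" by (intro measure_eqI) (auto simp: sets_\<nu>)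
  thus ?thesis by (simp add: \<nu>_def)
qed

text \<open>Written through the norm so that invariance under orthogonal maps is immediate. The link
  to independent coordinates is \<open>gaussian_density_prod\<close>.\<close>

definition gaussian_density :: "'a::euclidean_space \<Rightarrow> real" where
  "gaussian_density x = (1 / sqrt (2 * pi)) ^ DIM('a) * exp (- (norm x)\<^sup>2 / 2)"

definition std_gaussian :: "'a::euclidean_space measure" where
  "std_gaussian = density lborel (\<lambda>x. ennreal (gaussian_density x))"

lemma gaussian_density_nonneg[simp]: "0 \<le> gaussian_density x"
  by (simp add: gaussian_density_def)

lemma gaussian_density_measurable[measurable]: "gaussian_density \<in> borel_measurable borel"
  unfolding gaussian_density_def by measurable

lemma gaussian_density_prod:
  "gaussian_density (x::'a::euclidean_space) = (\<Prod>b\<in>Basis. std_normal_density (x \<bullet> b))"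
proof -
  have "(norm x)\<^sup>2 = (\<Sum>b\<in>Basis. (x \<bullet> b)\<^sup>2)"
    unfolding power2_norm_eq_inner by (subst euclidean_inner) (simp add: power2_eq_square)
  thus ?thesis
    by (simp add: gaussian_density_def std_normal_density_def prod.distrib exp_sum[symmetric]
        sum_negf sum_divide_distrib power_divide prod_dividef)
qed

lemma space_std_gaussian[simp]: "space std_gaussian = UNIV"
  and sets_std_gaussian[simp, measurable_cong]: "sets std_gaussian = sets borel"
  by (simp_all add: std_gaussian_def)

lemma measurable_std_gaussian[simp]: "measurable std_gaussian N = measurable borel N"
  by (rule measurable_cong_sets) auto

lemma nn_integral_std_gaussian:
  "f \<in> borel_measurable borel \<Longrightarrow>
    (\<integral>\<^sup>+x. f x \<partial>std_gaussian) = (\<integral>\<^sup>+x. ennreal (gaussian_density x) * f x \<partial>lborel)"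
  unfolding std_gaussian_def by (subst nn_integral_density) auto

text \<open>Serves two purposes: with every \<open>S b\<close> the whole line it gives total mass 1,
  and with open intervals it identifies the law of the design matrix in
  \<open>distr_std_gaussian_matrix\<close>.\<close>

lemma emeasure_std_gaussian_box:
  fixes S :: "'a::euclidean_space \<Rightarrow> real set"
  assumes [measurable]: "\<And>b. b \<in> Basis \<Longrightarrow> S b \<in> sets borel"
  shows "emeasure std_gaussian {x. \<forall>b\<in>Basis. x \<bullet> b \<in> S b} =
    (\<Prod>b\<in>Basis. emeasure (density lborel std_normal_density) (S b))"
proof -
  have [measurable]: "{x::'a. \<forall>b\<in>Basis. x \<bullet> b \<in> S b} \<in> sets borel"
  proof -
    have "{x::'a. \<forall>b\<in>Basis. x \<bullet> b \<in> S b} = (\<Inter>b\<in>Basis. (\<lambda>x. x \<bullet> b) -` S b \<inter> space borel)" by auto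
    also have "\<dots> \<in> sets borel"
      by (intro sets.finite_INT measurable_sets[OF _ assms]) (auto intro!: borel_measurable_continuous_onI continuous_intros)
    finally show ?thesis .
  qed
  have "emeasure std_gaussian {x. \<forall>b\<in>Basis. x \<bullet> b \<in> S b} =
    (\<integral>\<^sup>+x. (\<Prod>b\<in>Basis. ennreal (std_normal_density (x \<bullet> b)) * indicator (S b) (x \<bullet> b)) \<partial>(lborel :: 'a measure))"
    unfolding std_gaussian_def
    by (subst emeasure_density)
      (auto simp: gaussian_density_prod prod.distrib prod_ennreal[symmetric] indicator_def
        intro!: nn_integral_cong)
  also have "\<dots> = (\<Prod>b\<in>Basis. \<integral>\<^sup>+t. ennreal (std_normal_density t) * indicator (S b) t \<partial>lborel)"
    by (rule nn_integral_lborel_prod) auto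
  also have "\<dots> = (\<Prod>b\<in>Basis. emeasure (density lborel std_normal_density) (S b))"
    by (intro prod.cong refl) (simp add: emeasure_density)
  finally show ?thesis .
qed

lemma prob_space_std_gaussian: "prob_space (std_gaussian :: 'a::euclidean_space measure)"
proof
  have "prob_space (density lborel std_normal_density)" by (rule prob_space_normal_density) simp
  hence "emeasure (density lborel std_normal_density) UNIV = 1"
    using prob_space.emeasure_space_1 by fastforce
  thus "emeasure (std_gaussian :: 'a measure) (space std_gaussian) = 1"
    using emeasure_std_gaussian_box[of "\<lambda>_::'a. UNIV"] by simp
qed

interpretation std_gaussian: prob_space std_gaussian
  by (rule prob_space_std_gaussian)

lemma distr_std_gaussian_orthogonal:
  fixes T :: "'a::euclidean_space \<Rightarrow> 'a"
  assumes T: "orthogonal_transformation T"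
  shows "distr std_gaussian borel T = std_gaussian"
proof -
  have nrm: "norm (T x) = norm x" for x
    using T by (auto simp: orthogonal_transformation)
  have [measurable]: "T \<in> borel_measurable borel"
    using T by (intro borel_measurable_linear orthogonal_transformation_linear)
  have "std_gaussian = density (distr lborel borel T) (\<lambda>x. ennreal (gaussian_density x))"
    by (simp add: std_gaussian_def distr_lborel_orthogonal_transformation[OF T])
  also have "\<dots> = distr (density lborel (\<lambda>x. ennreal (gaussian_density (T x)))) borel T"
    by (rule density_distr) auto
  also have "\<dots> = distr std_gaussian borel T"
    by (simp add: std_gaussian_def gaussian_density_def nrm)
  finally show ?thesis by simp
qed

text \<open>Squared norms add on a product space, so the densities multiply. Two independent
  Gaussians can thus be rotated as one vector, the source of
  \<open>distr_std_gaussian_rotate\<close> and of the fresh matrix in every stage.\<close>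

lemma std_gaussian_pair:
  "(std_gaussian :: 'a::euclidean_space measure) \<Otimes>\<^sub>M (std_gaussian :: 'b::euclidean_space measure) = std_gaussian"
proof -
  have "(std_gaussian :: 'a measure) \<Otimes>\<^sub>M (std_gaussian :: 'b measure) =
    density (lborel \<Otimes>\<^sub>M lborel) (\<lambda>(x, y). ennreal (gaussian_density x) * ennreal (gaussian_density y))"
    unfolding std_gaussian_def
    by (rule pair_measure_density) (auto intro: prob_space_std_gaussian[unfolded std_gaussian_def, THEN prob_space_imp_sigma_finite] sigma_finite_lborel)
  also have "\<dots> = std_gaussian"
    unfolding std_gaussian_def lborel_prod[symmetric]
    by (intro arg_cong2[of _ _ _ _ density] refl ext)
      (auto simp: gaussian_density_def norm_Pair power_add exp_add[symmetric] add_divide_distrib ennreal_mult'[symmetric] algebra_simps)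
  finally show ?thesis .
qed

text \<open>The Cameron-Martin formula, by completing the square in the exponent. With
  \<open>f\<close> constant 1 it also yields the moment generating function.\<close>

lemma nn_integral_std_gaussian_translate:
  fixes f :: "'a::euclidean_space \<Rightarrow> ennreal"
  assumes [measurable]: "f \<in> borel_measurable borel"
  shows "(\<integral>\<^sup>+x. f (x + w) \<partial>std_gaussian) =
    (\<integral>\<^sup>+x. ennreal (exp (w \<bullet> x - (norm w)\<^sup>2 / 2)) * f x \<partial>std_gaussian)"
proof -
  have dens: "gaussian_density (x - w) = gaussian_density x * exp (w \<bullet> x - (norm w)\<^sup>2 / 2)" for x
    unfolding gaussian_density_def
    by (simp add: exp_add[symmetric] power2_norm_eq_inner inner_diff_left inner_diff_right inner_commute field_simps)
  have "(\<integral>\<^sup>+x. f (x + w) \<partial>std_gaussian) = (\<integral>\<^sup>+x. ennreal (gaussian_density ((w + x) - w)) * f (w + x) \<partial>lborel)"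
    by (simp add: nn_integral_std_gaussian add.commute)
  also have "\<dots> = (\<integral>\<^sup>+x. ennreal (gaussian_density (x - w)) * f x \<partial>distr lborel borel ((+) w))"
    by (subst nn_integral_distr) auto
  also have "\<dots> = (\<integral>\<^sup>+x. ennreal (gaussian_density x) * (ennreal (exp (w \<bullet> x - (norm w)\<^sup>2 / 2)) * f x) \<partial>lborel)"
    by (simp add: lborel_distr_plus dens ennreal_mult mult.assoc)
  also have "\<dots> = (\<integral>\<^sup>+x. ennreal (exp (w \<bullet> x - (norm w)\<^sup>2 / 2)) * f x \<partial>std_gaussian)"
    by (subst nn_integral_std_gaussian) auto
  finally show ?thesis .
qed

lemma distr_std_gaussian_fst:
  "distr (std_gaussian :: ('a::euclidean_space \<times> 'b::euclidean_space) measure) borel fst = std_gaussian"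
proof -
  have "distr (std_gaussian :: ('a \<times> 'b) measure) borel fst =
      distr ((std_gaussian :: 'a measure) \<Otimes>\<^sub>M (std_gaussian :: 'b measure)) std_gaussian fst"
    unfolding std_gaussian_pair by (rule distr_cong) auto
  also have "\<dots> = std_gaussian"
    by (rule prob_space.distr_pair_fst[OF prob_space_std_gaussian])
  finally show ?thesis .
qed

lemma distr_std_gaussian_rotate:
  fixes a b :: real
  assumes "a\<^sup>2 + b\<^sup>2 = 1"
  shows "distr (std_gaussian \<Otimes>\<^sub>M std_gaussian) borel (\<lambda>(x, y). a *\<^sub>R x + b *\<^sub>R (y::'a::euclidean_space)) = std_gaussian"
proof -
  \<comment> \<open>The second component completes the combination to a rotation of the product
    space; the law sought is that of its first component.\<close>
  define T :: "'a \<times> 'a \<Rightarrow> 'a \<times> 'a" where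
    "T = (\<lambda>z. (a *\<^sub>R fst z + b *\<^sub>R snd z, - b *\<^sub>R fst z + a *\<^sub>R snd z))"
  have "linear T" unfolding T_def
    by (intro linearI) (auto simp: algebra_simps)
  moreover have "norm (T z) = norm z" for z
  proof -
    have "T z \<bullet> T z = (a\<^sup>2 + b\<^sup>2) * (z \<bullet> z)"
      by (simp add: T_def inner_prod_def inner_commute algebra_simps power2_eq_square)
    thus ?thesis using assms by (simp add: norm_eq_sqrt_inner)
  qed
  ultimately have T: "orthogonal_transformation T" by (simp add: orthogonal_transformation)
  have [measurable]: "T \<in> borel_measurable borel"
    using T by (intro borel_measurable_linear orthogonal_transformation_linear)
  have "distr (std_gaussian \<Otimes>\<^sub>M std_gaussian) borel (\<lambda>(x, y). a *\<^sub>R x + b *\<^sub>R y)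
      = distr std_gaussian borel (fst \<circ> T)"
    unfolding std_gaussian_pair by (intro distr_cong) (auto simp: T_def)
  also have "\<dots> = distr (distr std_gaussian borel T) borel fst"
    by (rule distr_distr[symmetric]) (auto intro!: borel_measurable_continuous_onI continuous_intros)
  also have "\<dots> = std_gaussian"
    by (simp add: distr_std_gaussian_orthogonal[OF T] distr_std_gaussian_fst)
  finally show ?thesis .
qed

section \<open>Exponential integrability and smoothing\<close>

lemma measure_std_gaussian_UNIV[simp]: "measure std_gaussian UNIV = 1" "emeasure std_gaussian UNIV = 1"
  using std_gaussian.prob_space std_gaussian.emeasure_space_1 by simp_all

lemma distr_std_gaussian_translate:
  "distr std_gaussian borel (\<lambda>x. x + w) =
    density std_gaussian (\<lambda>x. ennreal (exp (w \<bullet> x - (norm w)\<^sup>2 / 2)))"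
proof (rule measure_eqI)
  fix S assume "S \<in> sets (distr std_gaussian borel (\<lambda>x. x + w))"
  hence [measurable]: "S \<in> sets borel" by simp
  have "emeasure (distr std_gaussian borel (\<lambda>x. x + w)) S = (\<integral>\<^sup>+x. indicator S x \<partial>distr std_gaussian borel (\<lambda>x. x + w))"
    by simp
  also have "\<dots> = (\<integral>\<^sup>+x. indicator S (x + w) \<partial>std_gaussian)"
    by (rule nn_integral_distr) auto
  also have "\<dots> = emeasure (density std_gaussian (\<lambda>x. ennreal (exp (w \<bullet> x - (norm w)\<^sup>2 / 2)))) S"
    by (subst nn_integral_std_gaussian_translate) (auto simp: emeasure_density)
  finally show "emeasure (distr std_gaussian borel (\<lambda>x. x + w)) S =
    emeasure (density std_gaussian (\<lambda>x. ennreal (exp (w \<bullet> x - (norm w)\<^sup>2 / 2)))) S" .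
qed simp

lemma nn_integral_std_gaussian_exp_inner:
  "(\<integral>\<^sup>+x. ennreal (exp (w \<bullet> x)) \<partial>std_gaussian) = ennreal (exp ((norm w)\<^sup>2 / 2))"
proof -
  have "(\<integral>\<^sup>+x. ennreal (exp (w \<bullet> x)) \<partial>std_gaussian) =
    (\<integral>\<^sup>+x. ennreal (exp ((norm w)\<^sup>2 / 2)) * (ennreal (exp (w \<bullet> x - (norm w)\<^sup>2 / 2)) * 1) \<partial>std_gaussian)"
    by (intro nn_integral_cong) (simp add: ennreal_mult'[symmetric] exp_add[symmetric])
  also have "\<dots> = ennreal (exp ((norm w)\<^sup>2 / 2)) * (\<integral>\<^sup>+x. 1 \<partial>std_gaussian)"
    using nn_integral_std_gaussian_translate[of "\<lambda>_. 1" w] by (subst nn_integral_cmult) auto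
  finally show ?thesis by simp
qed

lemma integrable_std_gaussian_exp_inner: "integrable std_gaussian (\<lambda>x. exp (w \<bullet> x))"
  and integral_std_gaussian_exp_inner:
    "(\<integral>x. exp (w \<bullet> x) \<partial>std_gaussian) = exp ((norm w)\<^sup>2 / 2)"
  using nn_integral_std_gaussian_exp_inner[of w]
  by (auto intro!: integrableI_nonneg simp: integral_eq_nn_integral)

lemma integrable_std_gaussian_exp_norm:
  "integrable std_gaussian (\<lambda>x::'a::euclidean_space. exp (a * norm x))"
proof -
  \<comment> \<open>The root comes from comparing the norm with the largest coordinate in absolute
    value. That coordinate is dominated by exponentials of linear forms, whose integrals are
    known.\<close>
  define r where "r = \<bar>a\<bar> * sqrt DIM('a)"
  have "exp (a * norm x) \<le> (\<Sum>b\<in>Basis. exp ((r *\<^sub>R b) \<bullet> x) + exp ((- r *\<^sub>R b) \<bullet> x))" for x :: 'a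
  proof -
    have "infnorm x \<in> (\<lambda>i. \<bar>x \<bullet> i\<bar>) ` Basis"
      unfolding infnorm_Max by (intro Max_in) auto
    then obtain b where b: "b \<in> Basis" "infnorm x = \<bar>x \<bullet> b\<bar>" by auto
    have "a * norm x \<le> \<bar>a\<bar> * norm x" by (simp add: mult_right_mono)
    also have "\<dots> \<le> r * \<bar>x \<bullet> b\<bar>"
      using norm_le_infnorm[of x] b(2) by (simp add: r_def mult_left_mono mult.assoc)
    finally have "exp (a * norm x) \<le> exp (r * \<bar>x \<bullet> b\<bar>)" by simp
    also have "\<dots> \<le> exp ((r *\<^sub>R b) \<bullet> x) + exp ((- r *\<^sub>R b) \<bullet> x)"
      by (cases "x \<bullet> b \<ge> 0") (auto simp: inner_commute)
    also have "\<dots> \<le> (\<Sum>b\<in>Basis. exp ((r *\<^sub>R b) \<bullet> x) + exp ((- r *\<^sub>R b) \<bullet> x))"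
      by (rule member_le_sum[OF b(1)]) (auto intro: add_nonneg_nonneg)
    finally show ?thesis .
  qed
  hence "\<bar>exp (a * norm x)\<bar> \<le> \<bar>\<Sum>b\<in>Basis. exp ((r *\<^sub>R b) \<bullet> x) + exp ((- r *\<^sub>R b) \<bullet> x)\<bar>" for x :: 'a
    by (metis abs_exp_cancel abs_ge_self order_trans)
  moreover have "integrable std_gaussian
      (\<lambda>x::'a. \<Sum>b\<in>Basis. exp ((r *\<^sub>R b) \<bullet> x) + exp ((- r *\<^sub>R b) \<bullet> x))"
    by (intro Bochner_Integration.integrable_sum Bochner_Integration.integrable_add
        integrable_std_gaussian_exp_inner)
  ultimately show ?thesis
    by (elim Bochner_Integration.integrable_bound)
      (auto intro!: AE_I2 simp del: abs_exp_cancel)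
qed

lemma integrable_std_gaussian_growth:
  fixes f :: "'a::euclidean_space \<Rightarrow> 'b::{banach, second_countable_topology}"
  assumes "f \<in> borel_measurable borel" "\<And>x. norm (f x) \<le> C * exp (a * norm x)"
  shows "integrable std_gaussian f"
proof (rule Bochner_Integration.integrable_bound)
  show "integrable std_gaussian (\<lambda>x::'a. C * exp (a * norm x))"
    by (intro integrable_mult_right integrable_std_gaussian_exp_norm)
  show "AE x in std_gaussian. norm (f x) \<le> norm (C * exp (a * norm x))"
    using assms(2) by (intro AE_I2) (metis abs_ge_self order_trans real_norm_def)
qed (use assms(1) in simp)

lemma lipschitz_on_borel_measurable:
  fixes f :: "'a::metric_space \<Rightarrow> real"
  shows "C-lipschitz_on UNIV f \<Longrightarrow> f \<in> borel_measurable borel"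
  by (intro borel_measurable_continuous_onI lipschitz_on_continuous_on)

lemma lipschitz_on_abs_le:
  fixes f :: "'a::real_normed_vector \<Rightarrow> real"
  assumes "c-lipschitz_on UNIV f"
  shows "\<bar>f (s + v) - f s\<bar> \<le> c * norm v"
  using lipschitz_onD[OF assms, of "s + v" s] by (simp add: dist_norm)

lemma norm_le_exp: "norm x \<le> exp (norm x)" "norm x + 1 \<le> exp (norm x)"
  using exp_ge_add_one_self[of "norm x"] by linarith+

lemma integrable_std_gaussian_lipschitz:
  fixes f :: "'a::euclidean_space \<Rightarrow> real"
  assumes f: "c-lipschitz_on UNIV f"
  shows "integrable std_gaussian f" "integrable std_gaussian (\<lambda>x. exp (f x))"
proof -
  have [measurable]: "f \<in> borel_measurable borel"
    by (rule lipschitz_on_borel_measurable[OF f])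
  have c: "0 \<le> c" using f by (rule lipschitz_on_nonneg)
  have le: "\<bar>f x - f 0\<bar> \<le> c * norm x" for x using lipschitz_on_abs_le[OF f, of 0 x] by simp
  show "integrable std_gaussian f"
  proof (rule integrable_std_gaussian_growth[where C = "\<bar>f 0\<bar> + c" and a = 1])
    fix x
    have "\<bar>f x\<bar> \<le> \<bar>f 0\<bar> * 1 + c * norm x" using le[of x] by linarith
    also have "\<dots> \<le> \<bar>f 0\<bar> * exp (norm x) + c * exp (norm x)"
      using c by (intro add_mono mult_left_mono norm_le_exp) auto
    finally show "norm (f x) \<le> (\<bar>f 0\<bar> + c) * exp (1 * norm x)" by (simp add: algebra_simps)
  qed simp
  show "integrable std_gaussian (\<lambda>x. exp (f x))"
  proof (rule integrable_std_gaussian_growth[where C = "exp (f 0)" and a = c])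
    fix x
    have "f x \<le> f 0 + c * norm x" using le[of x] by linarith
    thus "norm (exp (f x)) \<le> exp (f 0) * exp (c * norm x)" by (simp add: exp_add[symmetric])
  qed simp
qed

section \<open>Taylor bounds and the second moment\<close>

lemma exp_second_order: "\<bar>exp y - 1 - y\<bar> \<le> y\<^sup>2 / 2 * exp \<bar>y\<bar>" for y :: real
proof -
  obtain t where t: "\<bar>t\<bar> \<le> \<bar>y\<bar>" "exp y = (\<Sum>m<2. y ^ m / fact m) + exp t / fact 2 * y ^ 2"
    using Maclaurin_exp_le[of y 2] by blast
  hence "exp y - 1 - y = exp t * (y\<^sup>2 / 2)" by (simp add: numeral_2_eq_2 field_simps)
  also have "\<bar>\<dots>\<bar> \<le> exp \<bar>y\<bar> * (y\<^sup>2 / 2)"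
    using t(1) by (simp add: abs_mult mult_right_mono)
  finally show ?thesis by (simp add: mult.commute)
qed

lemma exp_third_order: "exp y \<le> 1 + y + y\<^sup>2 / 2 + \<bar>y\<bar> ^ 3 * exp \<bar>y\<bar>" for y :: real
proof -
  obtain t where t: "\<bar>t\<bar> \<le> \<bar>y\<bar>" "exp y = (\<Sum>m<3. y ^ m / fact m) + exp t / fact 3 * y ^ 3"
    using Maclaurin_exp_le[of y 3] by blast
  have "exp t / fact 3 * y ^ 3 \<le> exp t * \<bar>y\<bar> ^ 3"
  proof -
    have "exp t / fact 3 * y ^ 3 \<le> exp t / fact 3 * \<bar>y\<bar> ^ 3"
      by (intro mult_left_mono) (auto simp flip: power_abs)
    also have "\<dots> \<le> exp t * \<bar>y\<bar> ^ 3"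
      by (intro mult_right_mono) (auto simp: fact_numeral)
    finally show ?thesis .
  qed
  also have "\<dots> \<le> exp \<bar>y\<bar> * \<bar>y\<bar> ^ 3" using t(1) by (intro mult_right_mono) auto
  finally show ?thesis using t(2) by (simp add: numeral_3_eq_3 mult.commute power2_eq_square fact_numeral)
qed

text \<open>The right-hand side is 2 (cosh y - 1). In the two expansions the odd terms cancel, and
  stopping at order four leaves remainders with an even power of \<open>y\<close>, hence nonnegative
  ones.\<close>

lemma cosh_second_order: "y\<^sup>2 \<le> exp y + exp (- y) - 2" for y :: real
proof -
  obtain t where t: "exp y = (\<Sum>m<4. y ^ m / fact m) + exp t / fact 4 * y ^ 4"
    using Maclaurin_exp_le[of y 4] by blast
  obtain t' where t': "exp (- y) = (\<Sum>m<4. (- y) ^ m / fact m) + exp t' / fact 4 * (- y) ^ 4"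
    using Maclaurin_exp_le[of "- y" 4] by blast
  have "exp t / fact 4 * y ^ 4 \<ge> 0" "exp t' / fact 4 * (- y) ^ 4 \<ge> 0" by auto
  thus ?thesis unfolding t t' by (simp add: eval_nat_numeral)
qed

lemma integrable_std_gaussian_inner_sq: "integrable std_gaussian (\<lambda>x. (g \<bullet> x)\<^sup>2)"
proof (rule Bochner_Integration.integrable_bound)
  show "integrable std_gaussian (\<lambda>x. exp (g \<bullet> x) + exp ((- g) \<bullet> x))"
    by (intro Bochner_Integration.integrable_add integrable_std_gaussian_exp_inner)
  have "(g \<bullet> x)\<^sup>2 \<le> exp (g \<bullet> x) + exp ((- g) \<bullet> x)" for x
    using cosh_second_order[of "g \<bullet> x"] by simp
  thus "AE x in std_gaussian. norm ((g \<bullet> x)\<^sup>2) \<le> norm (exp (g \<bullet> x) + exp ((- g) \<bullet> x))"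
    by (intro AE_I2) (simp add: add_nonneg_nonneg)
qed simp

text \<open>The second moment is read off the moment generating function for small arguments.\<close>

lemma integral_std_gaussian_inner_sq_le: "(\<integral>x. (g \<bullet> x)\<^sup>2 \<partial>std_gaussian) \<le> (norm g)\<^sup>2"
proof (rule tendsto_lowerbound)
  show "((\<lambda>t. 2 * (exp (t\<^sup>2 * (norm g)\<^sup>2 / 2) - 1) / t\<^sup>2) \<longlongrightarrow> (norm g)\<^sup>2) (at_right 0)"
    by (cases "g = 0") (simp, real_asymp)
  show "\<forall>\<^sub>F t in at_right 0. (\<integral>x. (g \<bullet> x)\<^sup>2 \<partial>std_gaussian) \<le> 2 * (exp (t\<^sup>2 * (norm g)\<^sup>2 / 2) - 1) / t\<^sup>2"
  proof (rule eventually_mono[OF eventually_at_right_less])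
    fix t :: real assume t: "0 < t"
    have "t\<^sup>2 * (\<integral>x. (g \<bullet> x)\<^sup>2 \<partial>std_gaussian) = (\<integral>x. ((t *\<^sub>R g) \<bullet> x)\<^sup>2 \<partial>std_gaussian)"
      by (simp add: power_mult_distrib)
    also have "\<dots> \<le> (\<integral>x. exp ((t *\<^sub>R g) \<bullet> x) + exp ((- (t *\<^sub>R g)) \<bullet> x) - 2 \<partial>std_gaussian)"
    proof (rule integral_mono)
      show "integrable std_gaussian (\<lambda>x. ((t *\<^sub>R g) \<bullet> x)\<^sup>2)"
        by (rule integrable_std_gaussian_inner_sq)
      show "integrable std_gaussian (\<lambda>x. exp ((t *\<^sub>R g) \<bullet> x) + exp ((- (t *\<^sub>R g)) \<bullet> x) - 2)"
        by (intro Bochner_Integration.integrable_add Bochner_Integration.integrable_diff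
            integrable_std_gaussian_exp_inner) simp
      show "((t *\<^sub>R g) \<bullet> x)\<^sup>2 \<le> exp ((t *\<^sub>R g) \<bullet> x) + exp ((- (t *\<^sub>R g)) \<bullet> x) - 2" for x
        using cosh_second_order[of "(t *\<^sub>R g) \<bullet> x"] by simp
    qed
    also have "\<dots> = 2 * (exp ((norm (t *\<^sub>R g))\<^sup>2 / 2) - 1)"
      using integral_std_gaussian_exp_inner[of "t *\<^sub>R g"] integral_std_gaussian_exp_inner[of "- (t *\<^sub>R g)"]
        integrable_std_gaussian_exp_inner[of "t *\<^sub>R g"] integrable_std_gaussian_exp_inner[of "- (t *\<^sub>R g)"]
        std_gaussian.prob_space
      by (simp add: Bochner_Integration.integral_add Bochner_Integration.integral_diff)
    finally show "(\<integral>x. (g \<bullet> x)\<^sup>2 \<partial>std_gaussian) \<le> 2 * (exp (t\<^sup>2 * (norm g)\<^sup>2 / 2) - 1) / t\<^sup>2"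
      using t by (simp add: field_simps power_mult_distrib)
  qed
qed simp

section \<open>Gaussian smoothing: the heat semigroup, parametrised by standard deviation\<close>

definition smoothing :: "real \<Rightarrow> ('a::euclidean_space \<Rightarrow> real) \<Rightarrow> 'a \<Rightarrow> real" where
  "smoothing \<delta> f s = (\<integral>x. f (s + \<delta> *\<^sub>R x) \<partial>std_gaussian)"

lemma lipschitz_on_affine:
  fixes f :: "'a::real_normed_vector \<Rightarrow> real"
  assumes f: "c-lipschitz_on UNIV f"
  shows "(c * \<bar>\<delta>\<bar>)-lipschitz_on UNIV (\<lambda>x. f (s + \<delta> *\<^sub>R x))"
proof (rule lipschitz_onI)
  fix x y
  have "dist (f (s + \<delta> *\<^sub>R x)) (f (s + \<delta> *\<^sub>R y)) \<le> c * dist (s + \<delta> *\<^sub>R x) (s + \<delta> *\<^sub>R y)"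
    by (rule lipschitz_onD[OF f]) auto
  also have "\<dots> = c * \<bar>\<delta>\<bar> * dist x y"
    by (simp add: dist_norm scaleR_diff_right[symmetric])
  finally show "dist (f (s + \<delta> *\<^sub>R x)) (f (s + \<delta> *\<^sub>R y)) \<le> c * \<bar>\<delta>\<bar> * dist x y" .
qed (use lipschitz_on_nonneg[OF f] in simp)

lemma integrable_std_gaussian_affine:
  fixes f :: "'a::euclidean_space \<Rightarrow> real"
  assumes "c-lipschitz_on UNIV f"
  shows "integrable std_gaussian (\<lambda>x. f (s + \<delta> *\<^sub>R x))"
    and "integrable std_gaussian (\<lambda>x. exp (f (s + \<delta> *\<^sub>R x)))"
  using integrable_std_gaussian_lipschitz[OF lipschitz_on_affine[OF assms]] by auto

lemma lipschitz_on_smoothing: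
  fixes f :: "'a::euclidean_space \<Rightarrow> real"
  assumes f: "c-lipschitz_on UNIV f"
  shows "c-lipschitz_on UNIV (smoothing \<delta> f)"
proof (rule lipschitz_onI)
  fix s t
  note [simp] = integrable_std_gaussian_affine[OF f]
  have "\<bar>smoothing \<delta> f s - smoothing \<delta> f t\<bar>
      = \<bar>\<integral>x. f (s + \<delta> *\<^sub>R x) - f (t + \<delta> *\<^sub>R x) \<partial>std_gaussian\<bar>"
    by (simp add: smoothing_def Bochner_Integration.integral_diff)
  also have "\<dots> \<le> (\<integral>x. \<bar>f (s + \<delta> *\<^sub>R x) - f (t + \<delta> *\<^sub>R x)\<bar> \<partial>std_gaussian)"
    by (rule integral_abs_bound)
  also have "\<dots> \<le> (\<integral>x. c * dist s t \<partial>(std_gaussian :: 'a measure))"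
  proof (rule integral_mono)
    show "\<bar>f (s + \<delta> *\<^sub>R x) - f (t + \<delta> *\<^sub>R x)\<bar> \<le> c * dist s t" for x
      using lipschitz_onD[OF f, of "s + \<delta> *\<^sub>R x" "t + \<delta> *\<^sub>R x"] by (simp add: dist_norm)
  qed auto
  also have "\<dots> = c * dist s t" by simp
  finally show "dist (smoothing \<delta> f s) (smoothing \<delta> f t) \<le> c * dist s t" by (simp add: dist_real_def)
qed (use lipschitz_on_nonneg[OF f] in simp)

text \<open>Independent Gaussians with standard deviations \<open>a\<close> and \<open>b\<close> add
  up to one with standard deviation \<open>r\<close>. This gives the semigroup law
  \<open>smoothing_smoothing\<close> and splits the last step off the walk.\<close>

lemma integral_std_gaussian_rotate:
  fixes F :: "'a::euclidean_space \<Rightarrow> real"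
  assumes r: "r\<^sup>2 = a\<^sup>2 + b\<^sup>2" and "0 < r"
    and [measurable]: "F \<in> borel_measurable borel"
    and int: "integrable std_gaussian (\<lambda>x. F (s + r *\<^sub>R x))"
  shows "(\<integral>x. F (s + r *\<^sub>R x) \<partial>std_gaussian) =
    (\<integral>x. (\<integral>y. F (s + a *\<^sub>R x + b *\<^sub>R y) \<partial>std_gaussian) \<partial>std_gaussian)"
    and "integrable std_gaussian (\<lambda>x. (\<integral>y. F (s + a *\<^sub>R x + b *\<^sub>R y) \<partial>std_gaussian))"
proof -
  interpret pair_sigma_finite "std_gaussian :: 'a measure" "std_gaussian :: 'a measure" ..
  let ?T = "\<lambda>(x, y). (a / r) *\<^sub>R x + (b / r) *\<^sub>R (y :: 'a)"
  have "(a / r)\<^sup>2 + (b / r)\<^sup>2 = 1"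
    using r \<open>0 < r\<close> by (simp add: power_divide add_divide_distrib[symmetric] r[symmetric])
  note D = distr_std_gaussian_rotate[OF this, where 'a='a]
  have [measurable]: "?T \<in> borel_measurable (std_gaussian \<Otimes>\<^sub>M std_gaussian)"
    by measurable
  have eq: "F (s + r *\<^sub>R ?T z) = F (s + a *\<^sub>R fst z + b *\<^sub>R snd z)" for z
    using \<open>0 < r\<close> by (simp add: case_prod_unfold scaleR_add_right add.assoc)
  have I: "integrable (std_gaussian \<Otimes>\<^sub>M std_gaussian) (\<lambda>z. F (s + a *\<^sub>R fst z + b *\<^sub>R snd z))"
    unfolding eq[symmetric] using int by (subst (asm) D[symmetric]) (subst (asm) integrable_distr_eq; simp)
  show "integrable std_gaussian (\<lambda>x. (\<integral>y. F (s + a *\<^sub>R x + b *\<^sub>R y) \<partial>std_gaussian))"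
    using integrable_fst'[OF I] by simp
  have "(\<integral>x. F (s + r *\<^sub>R x) \<partial>std_gaussian) = (\<integral>z. F (s + r *\<^sub>R ?T z) \<partial>(std_gaussian \<Otimes>\<^sub>M std_gaussian))"
    by (subst D[symmetric]) (rule integral_distr; simp)
  also have "\<dots> = (\<integral>x. (\<integral>y. F (s + a *\<^sub>R x + b *\<^sub>R y) \<partial>std_gaussian) \<partial>std_gaussian)"
    unfolding eq using integral_fst'[OF I] by simp
  finally show "(\<integral>x. F (s + r *\<^sub>R x) \<partial>std_gaussian) =
    (\<integral>x. (\<integral>y. F (s + a *\<^sub>R x + b *\<^sub>R y) \<partial>std_gaussian) \<partial>std_gaussian)" .
qed

text \<open>In the walk, the mean after a step is
  \<open>smoothing \<sigma> (smoothing \<delta> f)\<close>. Commuting presents it as the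
  \<delta>-smoothing of another Lipschitz function, so the same uniform estimate applies to the next
  step.\<close>

lemma smoothing_commute:
  fixes f :: "'a::euclidean_space \<Rightarrow> real"
  assumes f: "c-lipschitz_on UNIV f"
  shows "smoothing a (smoothing b f) = smoothing b (smoothing a f)"
proof
  fix s
  interpret pair_sigma_finite "std_gaussian :: 'a measure" "std_gaussian :: 'a measure" ..
  have "((c * (\<bar>a\<bar> + \<bar>b\<bar>)))-lipschitz_on UNIV (\<lambda>z::'a \<times> 'a. f (s + a *\<^sub>R fst z + b *\<^sub>R snd z))"
  proof (rule lipschitz_onI)
    fix z z' :: "'a \<times> 'a"
    have c: "0 \<le> c" using f by (rule lipschitz_on_nonneg)
    have "dist (f (s + a *\<^sub>R fst z + b *\<^sub>R snd z)) (f (s + a *\<^sub>R fst z' + b *\<^sub>R snd z')) \<le>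
      c * dist (s + a *\<^sub>R fst z + b *\<^sub>R snd z) (s + a *\<^sub>R fst z' + b *\<^sub>R snd z')"
      by (rule lipschitz_onD[OF f]) auto
    also have "\<dots> \<le> c * ((\<bar>a\<bar> + \<bar>b\<bar>) * dist z z')"
    proof (rule mult_left_mono[OF _ c])
      have "dist (s + a *\<^sub>R fst z + b *\<^sub>R snd z) (s + a *\<^sub>R fst z' + b *\<^sub>R snd z')
         = norm (a *\<^sub>R fst (z - z') + b *\<^sub>R snd (z - z'))"
        by (simp add: dist_norm algebra_simps)
      also have "\<dots> \<le> \<bar>a\<bar> * norm (fst (z - z')) + \<bar>b\<bar> * norm (snd (z - z'))"
        by (metis norm_scaleR norm_triangle_ineq)
      also have "\<dots> \<le> \<bar>a\<bar> * norm (z - z') + \<bar>b\<bar> * norm (z - z')"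
        using norm_fst_le[of "fst (z - z')" "snd (z - z')"] norm_snd_le[of "snd (z - z')" "fst (z - z')"]
        unfolding prod.collapse by (intro add_mono mult_left_mono) auto
      finally show "dist (s + a *\<^sub>R fst z + b *\<^sub>R snd z) (s + a *\<^sub>R fst z' + b *\<^sub>R snd z')
        \<le> (\<bar>a\<bar> + \<bar>b\<bar>) * dist z z'" by (simp add: dist_norm algebra_simps)
    qed
    finally show "dist (f (s + a *\<^sub>R fst z + b *\<^sub>R snd z)) (f (s + a *\<^sub>R fst z' + b *\<^sub>R snd z')) \<le>
      c * (\<bar>a\<bar> + \<bar>b\<bar>) * dist z z'" by (simp add: mult.assoc)
  qed (use lipschitz_on_nonneg[OF f] in simp)
  from integrable_std_gaussian_lipschitz(1)[OF this]
  have "integrable (std_gaussian \<Otimes>\<^sub>M std_gaussian) (\<lambda>(x, y). f (s + a *\<^sub>R x + b *\<^sub>R y))"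
    by (simp add: std_gaussian_pair case_prod_unfold)
  from Fubini_integral[OF this] show "smoothing a (smoothing b f) s = smoothing b (smoothing a f) s"
    by (simp add: smoothing_def add_ac)
qed

lemma smoothing_translate:
  fixes f :: "'a::euclidean_space \<Rightarrow> real"
  assumes f: "c-lipschitz_on UNIV f"
  shows "smoothing \<delta> f (s + \<delta> *\<^sub>R w) =
    (\<integral>x. exp (w \<bullet> x - (norm w)\<^sup>2 / 2) * f (s + \<delta> *\<^sub>R x) \<partial>std_gaussian)"
    and "integrable std_gaussian (\<lambda>x. exp (w \<bullet> x - (norm w)\<^sup>2 / 2) * f (s + \<delta> *\<^sub>R x))"
proof -
  have [measurable]: "f \<in> borel_measurable borel"
    by (rule lipschitz_on_borel_measurable[OF f])
  have eq: "f ((s + \<delta> *\<^sub>R w) + \<delta> *\<^sub>R x) = f (s + \<delta> *\<^sub>R (x + w))" for x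
    by (simp add: algebra_simps)
  have "smoothing \<delta> f (s + \<delta> *\<^sub>R w) = (\<integral>x. f (s + \<delta> *\<^sub>R x) \<partial>distr std_gaussian borel (\<lambda>x. x + w))"
    unfolding smoothing_def eq by (rule integral_distr[symmetric]) auto
  also have "\<dots> = (\<integral>x. exp (w \<bullet> x - (norm w)\<^sup>2 / 2) * f (s + \<delta> *\<^sub>R x) \<partial>std_gaussian)"
    unfolding distr_std_gaussian_translate by (subst integral_density) auto
  finally show "smoothing \<delta> f (s + \<delta> *\<^sub>R w) =
    (\<integral>x. exp (w \<bullet> x - (norm w)\<^sup>2 / 2) * f (s + \<delta> *\<^sub>R x) \<partial>std_gaussian)" .
  have "integrable std_gaussian (\<lambda>x. f (s + \<delta> *\<^sub>R (x + w)))"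
    unfolding eq[symmetric] by (rule integrable_std_gaussian_affine[OF f])
  hence "integrable (distr std_gaussian borel (\<lambda>x. x + w)) (\<lambda>x. f (s + \<delta> *\<^sub>R x))"
    by (subst integrable_distr_eq) auto
  thus "integrable std_gaussian (\<lambda>x. exp (w \<bullet> x - (norm w)\<^sup>2 / 2) * f (s + \<delta> *\<^sub>R x))"
    unfolding distr_std_gaussian_translate by (subst (asm) integrable_density) auto
qed

text \<open>The second-order remainder in \<open>w\<close> of the Cameron-Martin weight. What counts
  is the factor \<open>(norm w)\<^sup>2\<close> and a growth in \<open>x\<close> that the Gaussian
  integrates; the exponent combines \<open>(n + 1)\<^sup>2 \<le> exp (2 * n)\<close> with
  \<open>exp \<bar>y\<bar> \<le> exp (n + 1)\<close>.\<close>

lemma exp_bracket_bound: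
  fixes w x :: "'a::real_inner"
  assumes w: "norm w \<le> 1"
  shows "\<bar>exp (w \<bullet> x - (norm w)\<^sup>2 / 2) - 1 - w \<bullet> x\<bar> \<le> (norm w)\<^sup>2 * exp (3 * norm x + 1)"
proof -
  define n y where "n = norm x" and "y = w \<bullet> x - (norm w)\<^sup>2 / 2"
  have w2: "(norm w)\<^sup>2 \<le> norm w" using w by (simp add: power2_eq_square mult_left_le_one_le)
  have "\<bar>w \<bullet> x\<bar> \<le> norm w * n" by (simp add: n_def Cauchy_Schwarz_ineq2)
  moreover have "\<bar>y\<bar> \<le> \<bar>w \<bullet> x\<bar> + (norm w)\<^sup>2"
    unfolding y_def using zero_le_power2[of "norm w"] by arith
  ultimately have y: "\<bar>y\<bar> \<le> norm w * (n + 1)" using w2 by (simp add: algebra_simps)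
  have n0: "0 \<le> n" by (simp add: n_def)
  have "norm w * (n + 1) \<le> 1 * (n + 1)" using w n0 by (intro mult_right_mono) auto
  hence y': "\<bar>y\<bar> \<le> n + 1" using y by simp
  have n1: "(n + 1)\<^sup>2 \<le> exp (2 * n)"
    using power_mono[OF norm_le_exp(2)[of x], of 2] by (simp add: n_def exp_double)
  have "\<bar>exp y - 1 - w \<bullet> x\<bar> \<le> \<bar>exp y - 1 - y\<bar> + (norm w)\<^sup>2 / 2"
    using zero_le_power2[of "norm w"] y_def by arith
  also have "\<dots> \<le> y\<^sup>2 / 2 * exp \<bar>y\<bar> + (norm w)\<^sup>2 / 2" using exp_second_order[of y] by simp
  also have "\<dots> \<le> (norm w * (n + 1))\<^sup>2 / 2 * exp (n + 1) + (norm w)\<^sup>2 / 2"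
    using y y' power_mono[OF y, of 2] by (intro add_mono mult_mono divide_right_mono) auto
  also have "\<dots> \<le> (norm w)\<^sup>2 * exp (2 * n) / 2 * exp (n + 1) + (norm w)\<^sup>2 / 2 * exp (3 * n + 1)"
    using n1 n0 by (intro add_mono mult_right_mono divide_right_mono) (auto simp: power_mult_distrib mult_left_mono mult_le_cancel_left1)
  also have "\<dots> = (norm w)\<^sup>2 * exp (3 * n + 1)" by (simp add: exp_add[symmetric] mult.assoc)
  finally show ?thesis by (simp add: y_def n_def)
qed

text \<open>By the Cameron-Martin formula \<open>smoothing_translate\<close> the shift by \<open>v\<close> moves from \<open>f\<close> into an
  exponential weight, which is smooth in \<open>v\<close>. The constant \<open>K\<close> depends neither on \<open>f\<close> nor on \<open>s\<close>;
  this uniformity is what lets the errors of all steps of the walk below be summed.\<close>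

lemma smoothing_first_order:
  fixes c \<delta> :: real
  assumes "0 \<le> c" and \<delta>: "0 < \<delta>"
  obtains K where "0 \<le> K"
    "\<And>f s. c-lipschitz_on UNIV f \<Longrightarrow> \<exists>g. norm g \<le> c \<and>
       (\<forall>v::'a::euclidean_space. \<bar>smoothing \<delta> f (s + v) - smoothing \<delta> f s - g \<bullet> v\<bar> \<le> K * (norm v)\<^sup>2)"
proof -
  \<comment> \<open>In the exponent, 3 comes from \<open>exp_bracket_bound\<close> and 1 from the
    growth of the increment \<open>F\<close>.\<close>
  define D where "D = (\<integral>x. exp (4 * norm (x::'a) + 1) \<partial>std_gaussian)"
  have D_int: "integrable std_gaussian (\<lambda>x::'a. exp (4 * norm x + 1))"
    using integrable_std_gaussian_exp_norm[of 4, where 'a='a] by (simp add: exp_add)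
  have D0: "0 \<le> D" unfolding D_def by (rule integral_nonneg_AE) simp
  \<comment> \<open>\<open>D\<close> serves shifts of length at most \<delta>; 2 serves longer ones,
    for which the Lipschitz bound alone suffices.\<close>
  define K where "K = c / \<delta> * (D + 2)"
  have K0: "0 \<le> K" using assms D0 by (simp add: K_def)
  have "\<exists>g. norm g \<le> c \<and> (\<forall>v. \<bar>smoothing \<delta> f (s + v) - smoothing \<delta> f s - g \<bullet> v\<bar> \<le> K * (norm v)\<^sup>2)"
    if f: "c-lipschitz_on UNIV f" for f and s :: 'a
  proof -
    have [measurable]: "f \<in> borel_measurable borel"
      by (rule lipschitz_on_borel_measurable[OF f])
    \<comment> \<open>Subtracting \<open>f s\<close> leaves a quantity bounded through
      \<open>c\<close> alone, hence a constant independent of \<open>f\<close> and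
      \<open>s\<close>.\<close>
    define F where "F x = f (s + \<delta> *\<^sub>R x) - f s" for x
    have [measurable]: "F \<in> borel_measurable borel" unfolding F_def by measurable
    have F: "\<bar>F x\<bar> \<le> c * \<delta> * norm x" for x
      using lipschitz_on_abs_le[OF f, of s "\<delta> *\<^sub>R x"] \<delta> by (simp add: F_def)
    have F': "\<bar>F x\<bar> \<le> c * \<delta> * exp (norm x)" for x
      using F[of x] norm_le_exp(1)[of x] assms
      by (intro order_trans[OF F] mult_left_mono norm_le_exp) auto
    have Fx_int: "integrable std_gaussian (\<lambda>x. F x *\<^sub>R x)"
    proof (rule integrable_std_gaussian_growth[where C = "c * \<delta>" and a = 2])
      fix x
      have "norm (F x *\<^sub>R x) \<le> (c * \<delta> * exp (norm x)) * exp (norm x)"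
        unfolding norm_scaleR using assms by (intro mult_mono F' norm_le_exp) auto
      thus "norm (F x *\<^sub>R x) \<le> c * \<delta> * exp (2 * norm x)" by (simp add: exp_double power2_eq_square)
    qed simp
    \<comment> \<open>The gradient of the smoothed function at \<open>s\<close>, with the derivative
      taken on the Cameron-Martin weight instead of \<open>f\<close>.\<close>
    define g where "g = (1 / \<delta>) *\<^sub>R (\<integral>x. F x *\<^sub>R x \<partial>std_gaussian)"
    have small: "\<bar>smoothing \<delta> f (s + v) - smoothing \<delta> f s - g \<bullet> v\<bar> \<le> c / \<delta> * D * (norm v)\<^sup>2"
      if v: "norm v \<le> \<delta>" for v
    proof -
      define w where "w = (1 / \<delta>) *\<^sub>R v"
      have vw: "v = \<delta> *\<^sub>R w" using \<delta> by (simp add: w_def)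
      have w: "norm w \<le> 1" using v \<delta> by (simp add: w_def)
      let ?e = "\<lambda>x. exp (w \<bullet> x - (norm w)\<^sup>2 / 2)"
      have e_int: "integrable std_gaussian ?e" "(\<integral>x. ?e x \<partial>std_gaussian) = 1"
        using integrable_std_gaussian_exp_inner[of w] integral_std_gaussian_exp_inner[of w]
        by (simp_all add: exp_diff)
      note st = smoothing_translate[OF f, where \<delta> = \<delta> and s = s and w = w]
      have gv: "g \<bullet> v = (\<integral>x. F x * (w \<bullet> x) \<partial>std_gaussian)"
      proof -
        have "(\<integral>x. w \<bullet> (F x *\<^sub>R x) \<partial>std_gaussian) = w \<bullet> (\<integral>x. F x *\<^sub>R x \<partial>std_gaussian)"
          by (rule integral_inner_right) (rule Fx_int)
        thus ?thesis using \<delta> by (simp add: g_def vw inner_commute)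
      qed
      have Fw_int: "integrable std_gaussian (\<lambda>x. F x * (w \<bullet> x))"
        using integrable_inner_right[of w std_gaussian "\<lambda>x. F x *\<^sub>R x"] Fx_int by simp
      have F_int: "integrable std_gaussian F"
        unfolding F_def using integrable_std_gaussian_affine(1)[OF f] by simp
      have eF_int: "integrable std_gaussian (\<lambda>x. ?e x * F x)"
        unfolding F_def right_diff_distrib
        using st(2) e_int by (intro Bochner_Integration.integrable_diff) auto
      have "smoothing \<delta> f (s + v) - f s = (\<integral>x. ?e x * F x \<partial>std_gaussian)"
        unfolding F_def right_diff_distrib vw st(1)
        using st(2) e_int by (subst Bochner_Integration.integral_diff) auto
      moreover have "smoothing \<delta> f s - f s = (\<integral>x. F x \<partial>std_gaussian)"
        unfolding F_def smoothing_def
        using integrable_std_gaussian_affine(1)[OF f] by (subst Bochner_Integration.integral_diff) auto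
      ultimately have "smoothing \<delta> f (s + v) - smoothing \<delta> f s - g \<bullet> v
         = (\<integral>x. ?e x * F x - F x - F x * (w \<bullet> x) \<partial>std_gaussian)"
        unfolding gv using eF_int F_int Fw_int by (simp add: Bochner_Integration.integral_diff)
      also have "\<dots> = (\<integral>x. F x * (?e x - 1 - w \<bullet> x) \<partial>std_gaussian)"
        by (rule Bochner_Integration.integral_cong) (auto simp: algebra_simps)
      also have "\<bar>\<dots>\<bar> \<le> (\<integral>x. c * \<delta> * (norm w)\<^sup>2 * exp (4 * norm (x::'a) + 1) \<partial>std_gaussian)"
      proof (rule order_trans[OF integral_abs_bound], rule integral_mono)
        show "integrable std_gaussian (\<lambda>x. \<bar>F x * (?e x - 1 - w \<bullet> x)\<bar>)"
          using Bochner_Integration.integrable_diff[OF Bochner_Integration.integrable_diff[OF eF_int F_int] Fw_int]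
          by (intro integrable_abs) (simp add: algebra_simps)
        show "integrable std_gaussian (\<lambda>x::'a. c * \<delta> * (norm w)\<^sup>2 * exp (4 * norm x + 1))"
          by (intro integrable_mult_right D_int)
        fix x
        have "\<bar>F x * (?e x - 1 - w \<bullet> x)\<bar> \<le> (c * \<delta> * exp (norm x)) * ((norm w)\<^sup>2 * exp (3 * norm x + 1))"
          unfolding abs_mult using assms by (intro mult_mono F' exp_bracket_bound w) auto
        also have "\<dots> = c * \<delta> * (norm w)\<^sup>2 * exp (norm x + (3 * norm x + 1))"
          by (simp only: exp_add mult_ac)
        finally show "\<bar>F x * (?e x - 1 - w \<bullet> x)\<bar> \<le> c * \<delta> * (norm w)\<^sup>2 * exp (4 * norm x + 1)"
          by (simp add: add.assoc[symmetric])
      qed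
      also have "\<dots> = c * \<delta> * (norm w)\<^sup>2 * D" unfolding D_def by simp
      also have "\<dots> = c / \<delta> * D * (norm v)\<^sup>2"
        using \<delta> by (simp add: vw power2_eq_square)
      finally show ?thesis .
    qed
    have lip: "\<bar>smoothing \<delta> f (s + v) - smoothing \<delta> f s\<bar> \<le> c * norm v" for v
      using lipschitz_on_abs_le[OF lipschitz_on_smoothing[OF f]] .
    \<comment> \<open>The integral for \<open>g\<close> would give a bound with a dimension factor.
      The sharp one comes from testing the first-order estimate along \<open>g\<close> with shifts
      of length \<open>t\<close>, where the quadratic error vanishes as \<open>t\<close> tends to
      0.\<close>
    have g: "norm g \<le> c"
    proof (cases "g = 0")
      case False
      have "norm g \<le> c + c / \<delta> * D * t" if t: "0 < t" "t \<le> \<delta>" for t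
      proof -
        define v where "v = (t / norm g) *\<^sub>R g"
        have nv: "norm v = t" and gv: "g \<bullet> v = t * norm g"
          using False t by (auto simp: v_def power2_norm_eq_inner[symmetric] power2_eq_square)
        have "t * norm g \<le> c * t + c / \<delta> * D * t\<^sup>2"
          using small[of v] lip[of v] t unfolding nv gv by linarith
        also have "\<dots> = t * (c + c / \<delta> * D * t)" by (simp add: power2_eq_square algebra_simps)
        finally show ?thesis using t by simp
      qed
      note bd = this
      show ?thesis
      proof (rule tendsto_lowerbound)
        show "((\<lambda>t. c + c / \<delta> * D * t) \<longlongrightarrow> c) (at_right 0)"
          by (rule tendsto_eq_intros | simp)+
        show "\<forall>\<^sub>F t in at_right 0. norm g \<le> c + c / \<delta> * D * t"
          using \<delta> bd by (auto simp: eventually_at_right intro!: exI[of _ \<delta>])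
      qed simp
    qed (use \<open>0 \<le> c\<close> in simp)
    have "\<bar>smoothing \<delta> f (s + v) - smoothing \<delta> f s - g \<bullet> v\<bar> \<le> K * (norm v)\<^sup>2" for v
    proof (cases "norm v \<le> \<delta>")
      case True
      have "c / \<delta> * D * (norm v)\<^sup>2 \<le> K * (norm v)\<^sup>2"
        unfolding K_def using assms D0 by (intro mult_right_mono mult_left_mono) auto
      thus ?thesis using small[OF True] by linarith
    next
      case False
      have "\<bar>g \<bullet> v\<bar> \<le> c * norm v"
        using Cauchy_Schwarz_ineq2[of g v] mult_right_mono[OF g, of "norm v"] by simp
      hence "\<bar>smoothing \<delta> f (s + v) - smoothing \<delta> f s - g \<bullet> v\<bar> \<le> 2 * c * norm v"
        using lip[of v] by linarith
      also have "\<dots> \<le> 2 * c * (norm v * (norm v / \<delta>))"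
        using False assms by (intro mult_left_mono) (auto simp: field_simps mult_right_mono)
      also have "\<dots> = c / \<delta> * 2 * (norm v)\<^sup>2" by (simp add: power2_eq_square)
      also have "\<dots> \<le> K * (norm v)\<^sup>2"
        unfolding K_def using assms D0 by (intro mult_right_mono mult_left_mono) auto
      finally show ?thesis .
    qed
    with g show ?thesis by blast
  qed
  with K0 show thesis using that by blast
qed

text \<open>The quadratic term carries the sharp factor \<open>c\<^sup>2\<close>, not \<open>c\<^sup>2\<close> times the dimension, because the
  increment is linear in the Gaussian up to second order.\<close>

lemma exp_moment_small_step:
  fixes c K :: real
  assumes "0 \<le> c" "0 \<le> K"
  obtains C where "0 \<le> C"
    "\<And>h s \<sigma> g. c-lipschitz_on UNIV h \<Longrightarrow> norm g \<le> c \<Longrightarrow>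
       (\<And>v::'a::euclidean_space. \<bar>h (s + v) - h s - g \<bullet> v\<bar> \<le> K * (norm v)\<^sup>2) \<Longrightarrow> 0 < \<sigma> \<Longrightarrow> \<sigma> \<le> 1 \<Longrightarrow>
       (\<integral>x. exp (h (s + \<sigma> *\<^sub>R x)) \<partial>std_gaussian) \<le>
         (1 + c\<^sup>2 * \<sigma>\<^sup>2 / 2 + C * \<sigma> ^ 3) * exp (smoothing \<sigma> h s)"
proof -
  define a where "a = (\<integral>x. norm (x::'a) \<partial>std_gaussian)"
  have norm_int: "integrable std_gaussian (\<lambda>x::'a. norm x)"
    using norm_le_exp by (intro integrable_std_gaussian_growth[where C = 1 and a = 1]) auto
  have a0: "0 \<le> a" unfolding a_def by (rule integral_nonneg_AE) simp
  have pow_le: "norm x ^ k \<le> exp (k * norm x)" for x :: 'a and k :: nat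
    using power_mono[OF norm_le_exp(1)[of x], of k] by (simp add: exp_of_nat_mult)
  \<comment> \<open>Dominates the cubic Taylor remainder of a centred step once the factor
    \<open>\<sigma> ^ 3 * c ^ 3\<close> is taken out; \<sigma> at most 1 removes \<sigma> from the
    exponential.\<close>
  define T where "T x = (norm (x::'a) + a) ^ 3 * exp (c * (norm x + a))" for x
  have T_int: "integrable std_gaussian T"
  proof (rule integrable_std_gaussian_growth[where C = "exp (3 * a + c * a)" and a = "3 + c"])
    fix x :: 'a
    have "norm x + a \<le> exp (norm x + a)" using exp_ge_add_one_self[of "norm x + a"] by linarith
    from power_mono[OF this, of 3] a0 have "(norm x + a) ^ 3 \<le> exp (3 * (norm x + a))"
      using exp_of_nat_mult[of 3 "norm x + a"] by simp
    hence "T x \<le> exp (3 * (norm x + a)) * exp (c * (norm x + a))"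
      unfolding T_def by (rule mult_right_mono) simp
    also have "\<dots> = exp (3 * a + c * a) * exp ((3 + c) * norm x)"
      by (simp add: exp_add[symmetric] algebra_simps)
    finally show "norm (T x) \<le> exp (3 * a + c * a) * exp ((3 + c) * norm x)"
      using a0 by (simp add: T_def)
  qed (unfold T_def, measurable)
  \<comment> \<open>Cross term and quartic term of the square of \<open>\<sigma> * \<bar>g \<bullet>
    x\<bar> + K * \<sigma>\<^sup>2 * (norm x)\<^sup>2\<close>, without the factor
    \<open>\<sigma> ^ 3\<close>.\<close>
  define Q where "Q x = 2 * K * c * norm (x::'a) ^ 3 + K\<^sup>2 * norm x ^ 4" for x
  have Q_int: "integrable std_gaussian Q"
    unfolding Q_def using pow_le[where k=3] pow_le[where k=4]
    by (intro Bochner_Integration.integrable_add integrable_mult_right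
        integrable_std_gaussian_growth[where C = 1 and a = 3]
        integrable_std_gaussian_growth[where C = 1 and a = 4]) auto
  define C where "C = c ^ 3 * integral\<^sup>L std_gaussian T + integral\<^sup>L std_gaussian Q / 2"
  have "0 \<le> integral\<^sup>L std_gaussian T" "0 \<le> integral\<^sup>L std_gaussian Q"
    using assms a0 by (auto intro!: integral_nonneg_AE simp: T_def Q_def)
  hence C0: "0 \<le> C" using assms by (simp add: C_def)
  have "(\<integral>x. exp (h (s + \<sigma> *\<^sub>R x)) \<partial>std_gaussian) \<le>
         (1 + c\<^sup>2 * \<sigma>\<^sup>2 / 2 + C * \<sigma> ^ 3) * exp (smoothing \<sigma> h s)"
    if h: "c-lipschitz_on UNIV h" and g: "norm g \<le> c"
      and d: "\<And>v. \<bar>h (s + v) - h s - g \<bullet> v\<bar> \<le> K * (norm v)\<^sup>2"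
      and \<sigma>: "0 < \<sigma>" "\<sigma> \<le> 1" for h \<sigma> g and s :: 'a
  proof -
    have [measurable]: "h \<in> borel_measurable borel"
      by (rule lipschitz_on_borel_measurable[OF h])
    have hint: "integrable std_gaussian (\<lambda>x. h (s + \<sigma> *\<^sub>R x))"
      by (rule integrable_std_gaussian_affine(1)[OF h])
    define u where "u x = h (s + \<sigma> *\<^sub>R x) - h s" for x
    define m where "m = (\<integral>x. u x \<partial>std_gaussian)"
    \<comment> \<open>Centring makes the linear Taylor term integrate to 0; the mean is accounted
      for by \<open>smoothing \<sigma> h s\<close>. The second moment does not grow under centring,
      so the sharp constant is kept.\<close>
    define y where "y x = u x - m" for x
    have [measurable]: "u \<in> borel_measurable borel" "y \<in> borel_measurable borel"
      unfolding y_def u_def by measurable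
    have u_int: "integrable std_gaussian u" unfolding u_def using hint by simp
    have u: "\<bar>u x\<bar> \<le> c * \<sigma> * norm x" for x
      using lipschitz_on_abs_le[OF h, of s "\<sigma> *\<^sub>R x"] \<sigma> by (simp add: u_def)
    have "\<bar>m\<bar> \<le> (\<integral>x. c * \<sigma> * norm (x::'a) \<partial>std_gaussian)"
      unfolding m_def using u_int norm_int u
      by (intro order_trans[OF integral_abs_bound integral_mono]) auto
    hence m: "\<bar>m\<bar> \<le> c * \<sigma> * a" by (simp add: a_def)
    have y: "\<bar>y x\<bar> \<le> c * \<sigma> * (norm x + a)" for x
      using u[of x] m by (simp add: y_def algebra_simps abs_le_iff)
    have y1: "\<bar>y x\<bar> \<le> c * (norm x + a)" for x
    proof -
      have "c * \<sigma> * (norm x + a) \<le> c * 1 * (norm x + a)"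
        using assms \<sigma> a0 by (intro mult_right_mono mult_left_mono) auto
      thus ?thesis using y[of x] by simp
    qed
    have y_int: "integrable std_gaussian y" "(\<integral>x. y x \<partial>std_gaussian) = 0"
      unfolding y_def using u_int by (auto simp: m_def)
    have u2: "(u x)\<^sup>2 \<le> \<sigma>\<^sup>2 * (g \<bullet> x)\<^sup>2 + \<sigma> ^ 3 * Q x" for x
    proof -
      have "\<bar>u x\<bar> \<le> \<sigma> * \<bar>g \<bullet> x\<bar> + K * \<sigma>\<^sup>2 * (norm x)\<^sup>2"
      proof -
        have "\<bar>u x\<bar> \<le> \<bar>g \<bullet> (\<sigma> *\<^sub>R x)\<bar> + K * (norm (\<sigma> *\<^sub>R x))\<^sup>2"
          using d[of "\<sigma> *\<^sub>R x"] unfolding u_def by linarith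
        thus ?thesis using \<sigma> by (simp add: abs_mult power_mult_distrib mult.assoc)
      qed
      from power_mono[OF this, of 2]
      have "(u x)\<^sup>2 \<le> (\<sigma> * \<bar>g \<bullet> x\<bar> + K * \<sigma>\<^sup>2 * (norm x)\<^sup>2)\<^sup>2" by simp
      also have "\<dots> = \<sigma>\<^sup>2 * (g \<bullet> x)\<^sup>2 + \<sigma> ^ 3 * (2 * K * \<bar>g \<bullet> x\<bar> * (norm x)\<^sup>2 + K\<^sup>2 * \<sigma> * norm x ^ 4)"
        by (simp add: power2_eq_square power3_eq_cube power4_eq_xxxx algebra_simps)
      also have "\<dots> \<le> \<sigma>\<^sup>2 * (g \<bullet> x)\<^sup>2 + \<sigma> ^ 3 * Q x"
      proof (intro add_left_mono mult_left_mono)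
        have "\<bar>g \<bullet> x\<bar> \<le> c * norm x"
          using Cauchy_Schwarz_ineq2[of g x] mult_right_mono[OF g, of "norm x"] by simp
        hence "2 * K * \<bar>g \<bullet> x\<bar> * (norm x)\<^sup>2 \<le> 2 * K * (c * norm x) * (norm x)\<^sup>2"
          using assms by (intro mult_right_mono mult_left_mono) auto
        moreover have "K\<^sup>2 * \<sigma> * norm x ^ 4 \<le> K\<^sup>2 * 1 * norm x ^ 4"
          using \<sigma> by (intro mult_right_mono mult_left_mono) auto
        ultimately show "2 * K * \<bar>g \<bullet> x\<bar> * (norm x)\<^sup>2 + K\<^sup>2 * \<sigma> * norm x ^ 4 \<le> Q x"
          by (simp add: Q_def power2_eq_square power3_eq_cube mult_ac)
      qed (use \<sigma> in simp)
      finally show ?thesis .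
    qed
    have b_int: "integrable std_gaussian (\<lambda>x. \<sigma>\<^sup>2 * (g \<bullet> x)\<^sup>2 + \<sigma> ^ 3 * Q x)"
      by (intro Bochner_Integration.integrable_add integrable_mult_right
          integrable_std_gaussian_inner_sq Q_int)
    have u2_int: "integrable std_gaussian (\<lambda>x. (u x)\<^sup>2)"
      using u2 by (intro Bochner_Integration.integrable_bound[OF b_int]) (auto intro!: AE_I2 intro: order_trans[OF _ abs_ge_self])
    have "(\<integral>x. (u x)\<^sup>2 \<partial>std_gaussian) \<le> (\<integral>x. \<sigma>\<^sup>2 * (g \<bullet> x)\<^sup>2 + \<sigma> ^ 3 * Q x \<partial>std_gaussian)"
      by (rule integral_mono[OF u2_int b_int u2])
    also have "\<dots> = \<sigma>\<^sup>2 * (\<integral>x. (g \<bullet> x)\<^sup>2 \<partial>std_gaussian) + \<sigma> ^ 3 * integral\<^sup>L std_gaussian Q"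
      using integrable_std_gaussian_inner_sq[of g] Q_int by simp
    also have "\<dots> \<le> \<sigma>\<^sup>2 * c\<^sup>2 + \<sigma> ^ 3 * integral\<^sup>L std_gaussian Q"
      using integral_std_gaussian_inner_sq_le[of g] power_mono[OF g, of 2]
      by (intro add_right_mono mult_left_mono) auto
    finally have U2: "(\<integral>x. (u x)\<^sup>2 \<partial>std_gaussian) \<le> \<sigma>\<^sup>2 * c\<^sup>2 + \<sigma> ^ 3 * integral\<^sup>L std_gaussian Q" .
    have y2: "(y x)\<^sup>2 = (u x)\<^sup>2 - 2 * m * u x + m\<^sup>2" for x
      by (simp add: y_def power2_diff)
    have y2_int: "integrable std_gaussian (\<lambda>x. (y x)\<^sup>2)"
      unfolding y2 using u2_int u_int by simp
    have "(\<integral>x. (y x)\<^sup>2 \<partial>std_gaussian) = (\<integral>x. (u x)\<^sup>2 \<partial>std_gaussian) - 2 * m * m + m\<^sup>2"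
      unfolding y2 using u2_int u_int by (simp add: m_def)
    hence Y2: "(\<integral>x. (y x)\<^sup>2 \<partial>std_gaussian) \<le> \<sigma>\<^sup>2 * c\<^sup>2 + \<sigma> ^ 3 * integral\<^sup>L std_gaussian Q"
      using U2 zero_le_square[of m] unfolding power2_eq_square by linarith
    have y3: "\<bar>y x\<bar> ^ 3 * exp \<bar>y x\<bar> \<le> \<sigma> ^ 3 * (c ^ 3 * T x)" for x
    proof -
      have "\<bar>y x\<bar> ^ 3 * exp \<bar>y x\<bar> \<le> (c * \<sigma> * (norm x + a)) ^ 3 * exp (c * (norm x + a))"
        using y[of x] y1[of x] assms \<sigma> a0 by (intro mult_mono power_mono) auto
      thus ?thesis by (simp add: T_def power_mult_distrib mult_ac)
    qed
    have ey: "exp (y x) \<le> 1 + y x + (y x)\<^sup>2 / 2 + \<sigma> ^ 3 * (c ^ 3 * T x)" for x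
      using exp_third_order[of "y x"] y3[of x] by linarith
    have eq: "h (s + \<sigma> *\<^sub>R x) = y x + smoothing \<sigma> h s" for x
      using hint by (simp add: y_def u_def m_def smoothing_def)
    have ey_int: "integrable std_gaussian (\<lambda>x. exp (y x))"
      using integrable_std_gaussian_affine(2)[OF h, of s \<sigma>] by (simp add: eq exp_add)
    have "(\<integral>x. exp (h (s + \<sigma> *\<^sub>R x)) \<partial>std_gaussian) = (\<integral>x. exp (y x) \<partial>std_gaussian) * exp (smoothing \<sigma> h s)"
      by (simp add: eq exp_add)
    also have "\<dots> \<le> (\<integral>x. 1 + y x + (y x)\<^sup>2 / 2 + \<sigma> ^ 3 * (c ^ 3 * T x) \<partial>std_gaussian) * exp (smoothing \<sigma> h s)"
      using ey ey_int y_int y2_int T_int by (intro mult_right_mono integral_mono) auto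
    also have "(\<integral>x. 1 + y x + (y x)\<^sup>2 / 2 + \<sigma> ^ 3 * (c ^ 3 * T x) \<partial>std_gaussian)
        = 1 + (\<integral>x. (y x)\<^sup>2 \<partial>std_gaussian) / 2 + \<sigma> ^ 3 * (c ^ 3 * integral\<^sup>L std_gaussian T)"
      using y_int y2_int T_int by simp
    also have "\<dots> \<le> 1 + c\<^sup>2 * \<sigma>\<^sup>2 / 2 + C * \<sigma> ^ 3"
      using Y2 by (simp add: C_def algebra_simps)
    finally show ?thesis by simp
  qed
  with C0 show thesis using that by blast
qed

section \<open>Sharp concentration of Lipschitz functions\<close>

lemma smoothing_smoothing:
  fixes f :: "'a::euclidean_space \<Rightarrow> real"
  assumes f: "c-lipschitz_on UNIV f" and r: "r\<^sup>2 = a\<^sup>2 + b\<^sup>2" "0 < r"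
  shows "smoothing a (smoothing b f) = smoothing r f"
  unfolding smoothing_def
  using integral_std_gaussian_rotate(1)[OF r, of f] lipschitz_on_borel_measurable[OF f]
    integrable_std_gaussian_affine(1)[OF f] by (intro ext) simp

text \<open>Integrating out the last step by \<open>step\<close> leaves the claim with one step
  fewer, but for \<open>smoothing \<sigma> f\<close> in place of \<open>f\<close>. Hence the
  induction over arbitrary \<open>f\<close>, and the demand that \<open>q\<close> be the same for
  all Lipschitz functions.\<close>

lemma exp_moment_walk:
  fixes c \<sigma> q :: real and f :: "'a::euclidean_space \<Rightarrow> real"
  assumes \<sigma>: "0 < \<sigma>" and q: "0 \<le> q"
    and step: "\<And>f (s :: 'a). c-lipschitz_on UNIV f \<Longrightarrow>
      (\<integral>x. exp (smoothing \<delta> f (s + \<sigma> *\<^sub>R x)) \<partial>std_gaussian) \<le> q * exp (smoothing \<sigma> (smoothing \<delta> f) s)"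
    and f: "c-lipschitz_on UNIV f"
  shows "(\<integral>x. exp (smoothing \<delta> f (s + (sqrt k * \<sigma>) *\<^sub>R x)) \<partial>std_gaussian) \<le>
    q ^ k * exp (smoothing (sqrt k * \<sigma>) (smoothing \<delta> f) s)"
  using f
proof (induction k arbitrary: f s)
  case 0
  thus ?case by (simp add: smoothing_def)
next
  case (Suc k)
  define h a r where "h = smoothing \<delta> f" and "a = sqrt k * \<sigma>" and "r = sqrt (Suc k) * \<sigma>"
  have h: "c-lipschitz_on UNIV h" unfolding h_def by (rule lipschitz_on_smoothing[OF Suc.prems])
  have [measurable]: "h \<in> borel_measurable borel" by (rule lipschitz_on_borel_measurable[OF h])
  have r: "r\<^sup>2 = a\<^sup>2 + \<sigma>\<^sup>2" "0 < r" using \<sigma> by (auto simp: r_def a_def power_mult_distrib algebra_simps)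
  have h': "smoothing \<sigma> h = smoothing \<delta> (smoothing \<sigma> f)"
    unfolding h_def by (rule smoothing_commute[OF Suc.prems])
  note rot = integral_std_gaussian_rotate[OF r, of "\<lambda>x. exp (h x)" s]
  have "(\<integral>x. exp (h (s + r *\<^sub>R x)) \<partial>std_gaussian) =
    (\<integral>x. (\<integral>y. exp (h (s + a *\<^sub>R x + \<sigma> *\<^sub>R y)) \<partial>std_gaussian) \<partial>std_gaussian)"
    by (rule rot(1)) (use integrable_std_gaussian_affine(2)[OF h] in auto)
  also have "\<dots> \<le> (\<integral>x. q * exp (smoothing \<sigma> h (s + a *\<^sub>R x)) \<partial>std_gaussian)"
  proof (rule integral_mono)
    show "integrable std_gaussian (\<lambda>x. (\<integral>y. exp (h (s + a *\<^sub>R x + \<sigma> *\<^sub>R y)) \<partial>std_gaussian))"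
      by (rule rot(2)) (use integrable_std_gaussian_affine(2)[OF h] in auto)
    show "integrable std_gaussian (\<lambda>x. q * exp (smoothing \<sigma> h (s + a *\<^sub>R x)))"
      by (intro integrable_mult_right integrable_std_gaussian_affine(2)[OF lipschitz_on_smoothing[OF h]])
    show "(\<integral>y. exp (h (s + a *\<^sub>R x + \<sigma> *\<^sub>R y)) \<partial>std_gaussian) \<le> q * exp (smoothing \<sigma> h (s + a *\<^sub>R x))" for x
      unfolding h_def by (rule step[OF Suc.prems])
  qed
  also have "\<dots> = q * (\<integral>x. exp (smoothing \<delta> (smoothing \<sigma> f) (s + a *\<^sub>R x)) \<partial>std_gaussian)"
    by (simp add: h')
  also have "\<dots> \<le> q * (q ^ k * exp (smoothing a (smoothing \<delta> (smoothing \<sigma> f)) s))"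
    unfolding a_def by (intro mult_left_mono Suc.IH lipschitz_on_smoothing[OF Suc.prems] q)
  also have "\<dots> = q ^ Suc k * exp (smoothing r h s)"
    by (simp add: smoothing_smoothing[OF h r] flip: h')
  finally show ?case by (simp add: h_def r_def)
qed

lemma exp_moment_smoothing:
  fixes f :: "'a::euclidean_space \<Rightarrow> real"
  assumes f: "c-lipschitz_on UNIV f" and \<delta>: "0 < \<delta>"
  shows "(\<integral>x. exp (smoothing \<delta> f x) \<partial>std_gaussian) \<le>
    exp (c\<^sup>2 / 2 + (\<integral>x. smoothing \<delta> f x \<partial>std_gaussian))"
proof -
  have c: "0 \<le> c" using f by (rule lipschitz_on_nonneg)
  obtain K where K: "0 \<le> K" "\<And>f s. c-lipschitz_on UNIV f \<Longrightarrow> \<exists>g. norm g \<le> c \<and>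
       (\<forall>v::'a. \<bar>smoothing \<delta> f (s + v) - smoothing \<delta> f s - g \<bullet> v\<bar> \<le> K * (norm v)\<^sup>2)"
    using smoothing_first_order[OF c \<delta>, where 'a='a] by metis
  obtain C where C: "0 \<le> C"
    "\<And>h s \<sigma> g. c-lipschitz_on UNIV h \<Longrightarrow> norm g \<le> c \<Longrightarrow>
       (\<And>v::'a. \<bar>h (s + v) - h s - g \<bullet> v\<bar> \<le> K * (norm v)\<^sup>2) \<Longrightarrow> 0 < \<sigma> \<Longrightarrow> \<sigma> \<le> 1 \<Longrightarrow>
       (\<integral>x. exp (h (s + \<sigma> *\<^sub>R x)) \<partial>std_gaussian) \<le>
         (1 + c\<^sup>2 * \<sigma>\<^sup>2 / 2 + C * \<sigma> ^ 3) * exp (smoothing \<sigma> h s)"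
    using exp_moment_small_step[OF c K(1), where 'a='a] by metis
  let ?I = "\<integral>x. smoothing \<delta> f x \<partial>std_gaussian"
  have bound: "(\<integral>x. exp (smoothing \<delta> f x) \<partial>std_gaussian) \<le> exp (c\<^sup>2 / 2 + C / sqrt m + ?I)"
    if m: "m \<ge> 1" for m :: nat
  proof -
    \<comment> \<open>The variances of \<open>m\<close> such steps sum to 1, while the errors sum to
      \<open>m * C * \<sigma> ^ 3 = C / sqrt m\<close>. \<open>K\<close> and \<open>C\<close> were
      fixed before \<open>m\<close>.\<close>
    define \<sigma> where "\<sigma> = 1 / sqrt m"
    have \<sigma>: "0 < \<sigma>" "\<sigma> \<le> 1" using m by (auto simp: \<sigma>_def)
    define q where "q = 1 + c\<^sup>2 * \<sigma>\<^sup>2 / 2 + C * \<sigma> ^ 3"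
    have q: "0 \<le> q" using C(1) \<sigma> by (simp add: q_def)
    have step: "(\<integral>x. exp (smoothing \<delta> f (s + \<sigma> *\<^sub>R x)) \<partial>std_gaussian) \<le> q * exp (smoothing \<sigma> (smoothing \<delta> f) s)"
      if f: "c-lipschitz_on UNIV f" for f and s :: 'a
    proof -
      obtain g where "norm g \<le> c"
        "\<And>v. \<bar>smoothing \<delta> f (s + v) - smoothing \<delta> f s - g \<bullet> v\<bar> \<le> K * (norm v)\<^sup>2"
        using K(2)[OF f] by metis
      from C(2)[OF lipschitz_on_smoothing[OF f] this \<sigma>] show ?thesis by (simp add: q_def)
    qed
    have m1: "sqrt m * \<sigma> = 1" using m by (simp add: \<sigma>_def)
    have "(\<integral>x. exp (smoothing \<delta> f x) \<partial>std_gaussian) \<le> q ^ m * exp ?I"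
      using exp_moment_walk[OF \<sigma>(1) q step f, of 0 m] unfolding m1
      by (simp add: smoothing_def[of 1])
    also have "q ^ m \<le> exp (c\<^sup>2 * \<sigma>\<^sup>2 / 2 + C * \<sigma> ^ 3) ^ m"
      using q exp_ge_add_one_self[of "c\<^sup>2 * \<sigma>\<^sup>2 / 2 + C * \<sigma> ^ 3"]
      by (intro power_mono) (auto simp: q_def add.assoc)
    also have "\<dots> = exp (c\<^sup>2 / 2 + C / sqrt m)"
      unfolding exp_of_nat_mult[symmetric] using m
      by (simp add: \<sigma>_def field_simps power3_eq_cube)
    finally show ?thesis by (simp add: exp_add)
  qed
  show ?thesis
  proof (rule tendsto_lowerbound)
    show "(\<lambda>m. exp (c\<^sup>2 / 2 + C / sqrt (real m) + ?I)) \<longlonglongrightarrow> exp (c\<^sup>2 / 2 + ?I)"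
    proof -
      have "(\<lambda>m. C / sqrt (real m)) \<longlonglongrightarrow> 0" by real_asymp
      hence "(\<lambda>m. exp (c\<^sup>2 / 2 + C / sqrt (real m) + ?I)) \<longlonglongrightarrow> exp (c\<^sup>2 / 2 + 0 + ?I)"
        by (intro tendsto_intros)
      thus ?thesis by simp
    qed
    show "\<forall>\<^sub>F m in sequentially. (\<integral>x. exp (smoothing \<delta> f x) \<partial>std_gaussian) \<le> exp (c\<^sup>2 / 2 + C / sqrt (real m) + ?I)"
      using bound by (auto simp: eventually_sequentially)
  qed simp
qed

text \<open>A Lipschitz function differs from its smoothing by at most
  \<open>c * \<delta> * a\<close>, uniformly, with \<open>a\<close> the mean norm. The error is paid
  once in the exponential and once in the mean, whence the factor 2 below, and vanishes with
  \<delta>.\<close>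

theorem std_gaussian_concentration:
  fixes f :: "'a::euclidean_space \<Rightarrow> real"
  assumes f: "c-lipschitz_on UNIV f"
  shows "(\<integral>x. exp (f x) \<partial>std_gaussian) \<le> exp (c\<^sup>2 / 2 + (\<integral>x. f x \<partial>std_gaussian))"
proof -
  define a where "a = (\<integral>x. norm (x::'a) \<partial>std_gaussian)"
  have norm_int: "integrable std_gaussian (\<lambda>x::'a. norm x)"
    using norm_le_exp by (intro integrable_std_gaussian_growth[where C = 1 and a = 1]) auto
  have c: "0 \<le> c" using f by (rule lipschitz_on_nonneg)
  have bound: "(\<integral>x. exp (f x) \<partial>std_gaussian) \<le> exp (2 * c * \<delta> * a + c\<^sup>2 / 2 + (\<integral>x. f x \<partial>std_gaussian))"
    if \<delta>: "0 < \<delta>" for \<delta>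
  proof -
    note sm = lipschitz_on_smoothing[OF f, of \<delta>]
    have near: "\<bar>smoothing \<delta> f s - f s\<bar> \<le> c * \<delta> * a" for s
    proof -
      have "\<bar>smoothing \<delta> f s - f s\<bar> = \<bar>\<integral>x. f (s + \<delta> *\<^sub>R x) - f s \<partial>std_gaussian\<bar>"
        using integrable_std_gaussian_affine(1)[OF f] by (simp add: smoothing_def)
      also have "\<dots> \<le> (\<integral>x. c * \<delta> * norm (x::'a) \<partial>std_gaussian)"
      proof (rule order_trans[OF integral_abs_bound], rule integral_mono)
        show "\<bar>f (s + \<delta> *\<^sub>R x) - f s\<bar> \<le> c * \<delta> * norm x" for x
          using lipschitz_on_abs_le[OF f, of s "\<delta> *\<^sub>R x"] \<delta> by simp
      qed (use integrable_std_gaussian_affine(1)[OF f] norm_int in auto)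
      finally show ?thesis by (simp add: a_def)
    qed
    have "(\<integral>x. exp (f x) \<partial>std_gaussian) \<le> (\<integral>x. exp (c * \<delta> * a) * exp (smoothing \<delta> f x) \<partial>std_gaussian)"
    proof (rule integral_mono)
      show "exp (f x) \<le> exp (c * \<delta> * a) * exp (smoothing \<delta> f x)" for x
        using near[of x] by (simp add: exp_add[symmetric])
    qed (use integrable_std_gaussian_lipschitz(2)[OF f] integrable_std_gaussian_lipschitz(2)[OF sm] in auto)
    also have "\<dots> \<le> exp (c * \<delta> * a) * exp (c\<^sup>2 / 2 + (\<integral>x. smoothing \<delta> f x \<partial>std_gaussian))"
      using exp_moment_smoothing[OF f \<delta>] by simp
    also have "(\<integral>x. smoothing \<delta> f x \<partial>std_gaussian) \<le> (\<integral>x. f x + c * \<delta> * a \<partial>std_gaussian)"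
    proof (rule integral_mono)
      show "smoothing \<delta> f x \<le> f x + c * \<delta> * a" for x using near[of x] by linarith
    qed (use integrable_std_gaussian_lipschitz(1)[OF f] integrable_std_gaussian_lipschitz(1)[OF sm] in auto)
    also have "\<dots> = (\<integral>x. f x \<partial>std_gaussian) + c * \<delta> * a"
      using integrable_std_gaussian_lipschitz(1)[OF f] by simp
    finally show ?thesis by (simp add: exp_add[symmetric] add_ac mult_ac)
  qed
  show ?thesis
  proof (rule tendsto_lowerbound)
    have "((\<lambda>\<delta>. exp (2 * c * \<delta> * a + c\<^sup>2 / 2 + (\<integral>x. f x \<partial>std_gaussian))) \<longlongrightarrow>
        exp (2 * c * 0 * a + c\<^sup>2 / 2 + (\<integral>x. f x \<partial>std_gaussian))) (at_right 0)"
      by (intro tendsto_intros)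
    thus "((\<lambda>\<delta>. exp (2 * c * \<delta> * a + c\<^sup>2 / 2 + (\<integral>x. f x \<partial>std_gaussian))) \<longlongrightarrow>
        exp (c\<^sup>2 / 2 + (\<integral>x. f x \<partial>std_gaussian))) (at_right 0)" by simp
    show "\<forall>\<^sub>F \<delta> in at_right 0. (\<integral>x. exp (f x) \<partial>std_gaussian) \<le>
        exp (2 * c * \<delta> * a + c\<^sup>2 / 2 + (\<integral>x. f x \<partial>std_gaussian))"
      using bound by (rule eventually_mono[OF eventually_at_right_less])
  qed simp
qed

section \<open>Greedy encoding with a Gaussian matrix\<close>

text \<open>The residual suffices as state: earlier coefficients influence later stages only through
  it, so encoding is a recursion on residuals (\<open>greedy_residual_Suc\<close>).\<close>

definition greedy_step ::
    "greedy_rule \<Rightarrow> real^'n \<Rightarrow> ((real^'N) set \<Rightarrow> real^'N) \<Rightarrow> (real^'N) set \<Rightarrow>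
     real^'N^'n \<Rightarrow> real^'n \<Rightarrow> real^'n" where
  "greedy_step rule u t S G r = r - G *v t (greedy_choices rule u G S r)"

lemma greedy_residual_0: "greedy_residual rule u \<tau> B A x 0 = x"
  by (simp add: greedy_residual_def)

lemma greedy_residual_Suc:
  "greedy_residual rule u \<tau> B A x (Suc l) =
    greedy_step rule u (\<tau> (Suc l)) (B (Suc l)) A (greedy_residual rule u \<tau> B A x l)"
  by (simp add: greedy_residual_def greedy_step_def Let_def matrix_vector_right_distrib diff_diff_add)

text \<open>The two cases of the correlation rule are one: for zero residual all elements tie, so the
  direction \<open>u\<close> takes the role of the residual.\<close>

lemma mem_greedy_choices_Correlation:
  "b \<in> greedy_choices Correlation_Based u A S r \<longleftrightarrow>
    is_arg_max (\<lambda>b. (if r = 0 then u else r) \<bullet> (A *v b)) (\<lambda>b. b \<in> S) b"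
  by (auto simp: is_arg_max_def Let_def)

lemma greedy_choices_subset: "greedy_choices rule u A S r \<subseteq> S"
  by (cases rule) (auto simp: is_arg_min_def mem_greedy_choices_Correlation is_arg_max_def
      simp del: greedy_choices.simps(2))

lemma greedy_choices_nonempty:
  assumes "finite S" "S \<noteq> {}"
  shows "greedy_choices rule u A S r \<noteq> {}"
proof (cases rule)
  case Distance_Based
  obtain b where "is_arg_min (\<lambda>b. norm (r - A *v b)) (\<lambda>b. b \<in> S) b"
    using ex_is_arg_min_if_finite[OF assms] by metis
  thus ?thesis using Distance_Based by auto
next
  case Correlation_Based
  obtain b where "is_arg_max (\<lambda>b. (if r = 0 then u else r) \<bullet> (A *v b)) (\<lambda>b. b \<in> S) b"
    using ex_is_arg_min_if_finite[OF assms, of "\<lambda>b. - ((if r = 0 then u else r) \<bullet> (A *v b))"]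
    by (auto simp: is_arg_min_def is_arg_max_def)
  thus ?thesis using Correlation_Based mem_greedy_choices_Correlation by blast
qed

lemma greedy_choices_cong:
  assumes "\<And>b. b \<in> S \<Longrightarrow> A *v b = A' *v b"
  shows "greedy_choices rule u A S r = greedy_choices rule u A' S r"
proof (cases rule)
  case Distance_Based
  thus ?thesis using assms by (auto simp: is_arg_min_def)
next
  case Correlation_Based
  have "b \<in> greedy_choices Correlation_Based u A S r \<longleftrightarrow> b \<in> greedy_choices Correlation_Based u A' S r" for b
    unfolding mem_greedy_choices_Correlation is_arg_max_def using assms by metis
  thus ?thesis using Correlation_Based by auto
qed

lemma tie_breaking_greedy_choices:
  assumes "tie_breaking L B \<tau>" "k \<in> {1..L}" "finite (B k)" "B k \<noteq> {}"
  shows "\<tau> k (greedy_choices rule u A (B k) r) \<in> B k"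
  using assms greedy_choices_subset[of rule u A "B k" r] greedy_choices_nonempty[of "B k" rule u A r]
  unfolding tie_breaking_def by blast

text \<open>Each stage reads the matrix only through its action on its own coefficient set, from
  which tie breaking also selects. This permits replacing the matrix on the orthogonal complement of
  the sets used so far.\<close>

lemma greedy_residual_cong:
  assumes tb: "tie_breaking L B \<tau>" and B: "\<And>k. k \<in> {1..L} \<Longrightarrow> finite (B k) \<and> B k \<noteq> {}"
    and "l \<le> L" "\<And>k b. k \<in> {1..l} \<Longrightarrow> b \<in> B k \<Longrightarrow> A *v b = A' *v b"
  shows "greedy_residual rule u \<tau> B A y l = greedy_residual rule u \<tau> B A' y l"
  using assms(3,4)
proof (induction l)
  case (Suc l)
  have IH: "greedy_residual rule u \<tau> B A y l = greedy_residual rule u \<tau> B A' y l"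
  proof (rule Suc.IH)
    show "A *v b = A' *v b" if "k \<in> {1..l}" "b \<in> B k" for k b
      by (rule Suc.prems(2)[of k]) (use that in auto)
  qed (use Suc.prems(1) in simp)
  have S: "Suc l \<in> {1..L}" using Suc.prems by auto
  have "\<tau> (Suc l) (greedy_choices rule u A' (B (Suc l)) r) \<in> B (Suc l)" for r
    using B[OF S] by (intro tie_breaking_greedy_choices[OF tb S]) auto
  moreover have "greedy_choices rule u A (B (Suc l)) r = greedy_choices rule u A' (B (Suc l)) r" for r
    using Suc.prems(2)[of "Suc l"] by (intro greedy_choices_cong) auto
  ultimately show ?case
    using Suc.prems(2)[of "Suc l"] by (simp add: greedy_residual_Suc greedy_step_def IH)
qed (simp add: greedy_residual_0)

section \<open>Measurability of the encoder\<close>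

lemma linear_matrix_vector_mult: "linear (\<lambda>G::real^'N^'n. G *v b)"
  by (rule linearI) (simp_all add: matrix_vector_mult_add_rdistrib vec_eq_iff matrix_vector_mult_def sum_distrib_left mult.assoc distrib_right sum.distrib)

lemma measurable_matrix_vector_mult[measurable]:
  "f \<in> borel_measurable M \<Longrightarrow> (\<lambda>x. (f x :: real^'N^'n) *v b) \<in> borel_measurable M"
  using measurable_compose[OF _ borel_measurable_linear[OF linear_matrix_vector_mult]] .

text \<open>The whole set of tied elements is treated as a value in the finite \<open>Pow S\<close>.
  On a finite discrete space every tie-breaking function is measurable, so none needs to be assumed
  regular.\<close>

lemma measurable_greedy_choices:
  assumes S: "finite S"
  shows "(\<lambda>(G, r). greedy_choices rule u G S r) \<in> borel \<Otimes>\<^sub>M borel \<rightarrow>\<^sub>M count_space (Pow S)"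
proof -
  have P: "Measurable.pred (borel \<Otimes>\<^sub>M borel) (\<lambda>z. b \<in> greedy_choices rule u (fst z) S (snd z))" for b
  proof (cases rule)
    case Distance_Based
    have eq: "b \<in> greedy_choices rule u G S r \<longleftrightarrow>
        b \<in> S \<and> (\<forall>b'\<in>S. \<not> norm (r - G *v b') < norm (r - G *v b))" for G r
      unfolding Distance_Based by (auto simp: is_arg_min_def)
    show ?thesis unfolding eq using S by measurable
  next
    case Correlation_Based
    have eq: "b \<in> greedy_choices rule u G S r \<longleftrightarrow> b \<in> S \<and>
        (\<forall>b'\<in>S. \<not> (if r = 0 then u else r) \<bullet> (G *v b') > (if r = 0 then u else r) \<bullet> (G *v b))" for G r
      unfolding Correlation_Based mem_greedy_choices_Correlation by (auto simp: is_arg_max_def)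
    show ?thesis unfolding eq using S by measurable
  qed
  have "(\<lambda>z. greedy_choices rule u (fst z) S (snd z)) -` {C} \<inter> space (borel \<Otimes>\<^sub>M borel) \<in> sets (borel \<Otimes>\<^sub>M borel)"
    if "C \<in> Pow S" for C
  proof -
    have "(\<lambda>z. greedy_choices rule u (fst z) S (snd z)) -` {C} \<inter> space (borel \<Otimes>\<^sub>M borel) =
      {z \<in> space (borel \<Otimes>\<^sub>M borel). \<forall>b\<in>S. b \<in> greedy_choices rule u (fst z) S (snd z) \<longleftrightarrow> b \<in> C}"
    proof -
      have "greedy_choices rule u G S r = C \<longleftrightarrow> (\<forall>b\<in>S. b \<in> greedy_choices rule u G S r \<longleftrightarrow> b \<in> C)" for G r
        using that greedy_choices_subset[of rule u G S r] by blast
      thus ?thesis by auto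
    qed
    also have "\<dots> \<in> sets (borel \<Otimes>\<^sub>M borel)"
      using P S by measurable
    finally show ?thesis .
  qed
  thus ?thesis
    unfolding case_prod_unfold using S greedy_choices_subset[of rule u _ S]
    by (subst measurable_count_space_eq2) (blast, blast)
qed

lemma measurable_greedy_step:
  assumes S: "finite S"
  shows "(\<lambda>(G, r). greedy_step rule u t S G r) \<in> borel_measurable (borel \<Otimes>\<^sub>M borel)"
proof -
  have "(\<lambda>z. snd z - fst z *v t (greedy_choices rule u (fst z) S (snd z))) \<in> borel_measurable (borel \<Otimes>\<^sub>M borel)"
  proof (rule measurable_compose_countable'[where f = "\<lambda>C z. snd z - fst z *v t C" and I = "Pow S"])
    show "(\<lambda>z. greedy_choices rule u (fst z) S (snd z)) \<in> borel \<Otimes>\<^sub>M borel \<rightarrow>\<^sub>M count_space (Pow S)"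
      using measurable_greedy_choices[OF S, of rule u] by (simp add: case_prod_unfold)
  qed (use S in \<open>auto intro!: countable_finite\<close>)
  thus ?thesis by (simp add: greedy_step_def case_prod_unfold)
qed

lemma measurable_greedy_residual:
  assumes "\<And>k. k \<in> {1..l} \<Longrightarrow> finite (B k)"
  shows "(\<lambda>(A, y). greedy_residual rule u \<tau> B A y l) \<in> borel_measurable (borel \<Otimes>\<^sub>M borel)"
  using assms
proof (induction l)
  case 0
  show ?case by (simp add: greedy_residual_0)
next
  case (Suc l)
  have IH: "(\<lambda>(A, y). greedy_residual rule u \<tau> B A y l) \<in> borel_measurable (borel \<Otimes>\<^sub>M borel)"
    using Suc by auto
  have "(\<lambda>z. (fst z, greedy_residual rule u \<tau> B (fst z) (snd z) l)) \<in> borel \<Otimes>\<^sub>M borel \<rightarrow>\<^sub>M borel \<Otimes>\<^sub>M borel"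
    using IH by (simp add: case_prod_unfold)
  from measurable_compose[OF this measurable_greedy_step[of "B (Suc l)" rule u "\<tau> (Suc l)"]] Suc.prems
  show ?case by (simp add: greedy_residual_Suc case_prod_unfold)
qed

section \<open>Orthogonal coefficient sets and a fresh matrix in each stage\<close>

lemma orthogonal_projection_exists:
  fixes S :: "'a::euclidean_space set"
  obtains p where "linear p" "\<And>b. b \<in> S \<Longrightarrow> p b = b"
    "\<And>x. (\<And>b. b \<in> S \<Longrightarrow> b \<bullet> x = 0) \<Longrightarrow> p x = 0"
    "\<And>x y. p x \<bullet> y = x \<bullet> p y" "\<And>x. p (p x) = p x"
proof -
  obtain E where E: "E \<subseteq> span S" "pairwise orthogonal E" "\<And>x. x \<in> E \<Longrightarrow> norm x = 1"
    "independent E" "span E = span S"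
    using orthonormal_basis_subspace[OF subspace_span, of S] by metis
  have fin: "finite E" using E(4) by (rule independent_imp_finite)
  define p where "p x = (\<Sum>e\<in>E. (x \<bullet> e) *\<^sub>R e)" for x
  have lin: "linear p" unfolding p_def
    by (rule linearI) (simp_all add: inner_add_left scaleR_add_left sum.distrib scaleR_sum_right)
  have pe: "p e = e" if "e \<in> E" for e
  proof -
    have "p e = (\<Sum>e'\<in>E. if e' = e then e else 0)"
      unfolding p_def using E(2,3) that
      by (intro sum.cong refl) (auto simp: pairwise_def orthogonal_def power2_norm_eq_inner[symmetric] power2_eq_square dot_square_norm)
    thus ?thesis using fin that by simp
  qed
  have ps: "p x = x" if "x \<in> span S" for x
    using that unfolding E(5)[symmetric]
    by (induction rule: span_induct_alt) (simp_all add: linear_0[OF lin] linear_add[OF lin] linear_cmul[OF lin] pe)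
  have "p x \<in> span S" for x
    unfolding p_def using E(1) by (intro span_sum span_mul) auto
  hence "p (p x) = p x" for x by (rule ps)
  moreover have "p x \<bullet> y = x \<bullet> p y" for x y
    by (simp add: p_def inner_sum_left inner_sum_right inner_commute mult.commute)
  moreover have "p x = 0" if "\<And>b. b \<in> S \<Longrightarrow> b \<bullet> x = 0" for x
  proof -
    have "e \<bullet> x = 0" if "e \<in> span S" for e
      using that \<open>\<And>b. b \<in> S \<Longrightarrow> b \<bullet> x = 0\<close>
      by (induction rule: span_induct_alt) (auto simp: inner_add_left)
    thus ?thesis unfolding p_def using E(1) by (intro sum.neutral) (auto simp: inner_commute)
  qed
  ultimately show thesis using that[OF lin] ps span_base by metis
qed

text \<open>For an orthogonal projection \<open>p\<close> the matrix \<open>G p + H (1 - p)\<close> with independent standard Gaussian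
  \<open>G\<close> and \<open>H\<close> is again standard Gaussian: together with \<open>H p + G (1 - p)\<close> it is an orthogonal
  image of \<open>(G, H)\<close>. This is how independence of the stages is expressed.\<close>

definition mix_rows :: "(real^'N \<Rightarrow> real^'N) \<Rightarrow> real^'N^'n \<Rightarrow> real^'N^'n \<Rightarrow> real^'N^'n" where
  "mix_rows p G H = (\<chi> i. p (G $ i) + (H $ i - p (H $ i)))"

lemma mix_rows_mult:
  assumes "\<And>x y. p x \<bullet> y = x \<bullet> p y"
  shows "mix_rows p G H *v b = G *v p b + H *v (b - p b)"
  by (simp add: vec_eq_iff mix_rows_def matrix_vector_mul_component assms inner_add_left
      inner_diff_left inner_diff_right)

lemma mix_rows_std_gaussian:
  assumes lin: "linear p" and p: "\<And>x y. p x \<bullet> y = x \<bullet> p y" "\<And>x. p (p x) = p x"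
  shows "(\<lambda>(G, H). mix_rows p G (H :: real^'N^'n)) \<in> borel_measurable (borel \<Otimes>\<^sub>M borel)"
    and "distr (std_gaussian \<Otimes>\<^sub>M std_gaussian) borel (\<lambda>(G, H). mix_rows p G (H :: real^'N^'n)) = std_gaussian"
proof -
  define T :: "(real^'N^'n) \<times> (real^'N^'n) \<Rightarrow> (real^'N^'n) \<times> (real^'N^'n)"
    where "T z = (mix_rows p (fst z) (snd z), mix_rows p (snd z) (fst z))" for z
  note p_simps = linear_add[OF lin] linear_diff[OF lin] linear_cmul[OF lin]
  have "linear T"
    by (rule linearI) (auto simp: T_def mix_rows_def vec_eq_iff p_simps algebra_simps)
  from borel_measurable_linear[OF this] have T_meas[measurable]: "T \<in> borel_measurable borel" .
  have eq: "(\<lambda>(G, H). mix_rows p G H) = fst \<circ> T" by (auto simp: T_def)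
  have fst_meas: "fst \<in> borel_measurable (borel :: ((real^'N^'n) \<times> (real^'N^'n)) measure)"
    by (intro borel_measurable_continuous_onI continuous_intros)
  show "(\<lambda>(G, H). mix_rows p G (H :: real^'N^'n)) \<in> borel_measurable (borel \<Otimes>\<^sub>M borel)"
    unfolding eq borel_prod by (rule measurable_comp[OF T_meas fst_meas])
  \<comment> \<open>The images of \<open>p\<close> and \<open>1 - p\<close> are orthogonal, so all
    mixed products vanish and the four remaining squares regroup.\<close>
  have row: "(p g + (h - p h)) \<bullet> (p g + (h - p h)) + (p h + (g - p g)) \<bullet> (p h + (g - p g)) = g \<bullet> g + h \<bullet> h" for g h
    by (simp add: inner_add_left inner_add_right inner_diff_left inner_diff_right p inner_commute)
      (metis p(1) inner_commute)
  have inner_rows: "G \<bullet> H = (\<Sum>i\<in>UNIV. G $ i \<bullet> H $ i)" for G H :: "real^'N^'n"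
    by (rule inner_vec_def)
  have "T z \<bullet> T z = z \<bullet> z" for z
    unfolding T_def inner_prod_def fst_conv snd_conv inner_rows
    using row by (simp add: mix_rows_def sum.distrib[symmetric])
  with \<open>linear T\<close> have T: "orthogonal_transformation T"
    by (simp add: orthogonal_transformation norm_eq_sqrt_inner)
  show "distr (std_gaussian \<Otimes>\<^sub>M std_gaussian) borel (\<lambda>(G, H). mix_rows p G (H :: real^'N^'n)) = std_gaussian"
    unfolding eq std_gaussian_pair
    using distr_distr[of fst borel borel T std_gaussian] fst_meas
    by (simp add: distr_std_gaussian_orthogonal[OF T] distr_std_gaussian_fst)
qed

text \<open>Let \<open>p\<close> project onto the span of the coefficient sets used so far. On them
  \<open>mix_rows p G H\<close> acts as \<open>G\<close>, and on the next one, which is orthogonal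
  to them, as \<open>H\<close>. The past thus depends on \<open>G\<close> alone and the new stage
  meets the independent \<open>H\<close>.\<close>

lemma distr_greedy_residual_Suc:
  fixes B :: "nat \<Rightarrow> (real^'N) set" and y :: "real^'n"
  assumes code: "additive_orthogonal_code L B c" and tb: "tie_breaking L B \<tau>" and l: "Suc l \<le> L"
  shows "distr std_gaussian borel (\<lambda>A. greedy_residual rule u \<tau> B A y (Suc l)) =
    distr (std_gaussian \<Otimes>\<^sub>M std_gaussian) borel
      (\<lambda>(G, H). greedy_step rule u (\<tau> (Suc l)) (B (Suc l)) H (greedy_residual rule u \<tau> B G y l))"
proof -
  have B: "finite (B k) \<and> B k \<noteq> {}" if "k \<in> {1..L}" for k
    using code that by (auto simp: additive_orthogonal_code_def)
  obtain p :: "real^'N \<Rightarrow> real^'N" where p: "linear p" "\<And>b. b \<in> (\<Union>k\<in>{1..l}. B k) \<Longrightarrow> p b = b"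
    "\<And>x. (\<And>b. b \<in> (\<Union>k\<in>{1..l}. B k) \<Longrightarrow> b \<bullet> x = 0) \<Longrightarrow> p x = 0"
    "\<And>x y. p x \<bullet> y = x \<bullet> p y" "\<And>x. p (p x) = p x"
    using orthogonal_projection_exists[of "\<Union>k\<in>{1..l}. B k"] by blast
  have p_next: "p b = 0" if "b \<in> B (Suc l)" for b
  proof (rule p(3))
    fix b' assume "b' \<in> (\<Union>k\<in>{1..l}. B k)"
    then obtain k where "k \<in> {1..l}" "b' \<in> B k" by blast
    moreover have "Suc l \<in> {1..L}" "k \<in> {1..L}" "k \<noteq> Suc l" using l \<open>k \<in> {1..l}\<close> by auto
    ultimately show "b' \<bullet> b = 0" using code that unfolding additive_orthogonal_code_def by blast
  qed
  note R = measurable_greedy_residual[of "Suc l" B rule u \<tau>]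
  have [measurable]: "(\<lambda>A. greedy_residual rule u \<tau> B A y (Suc l)) \<in> borel_measurable borel"
    using measurable_compose[OF _ R, of "\<lambda>A. (A, y)" borel] B l by auto
  have eq: "greedy_residual rule u \<tau> B (mix_rows p G H) y (Suc l) =
    greedy_step rule u (\<tau> (Suc l)) (B (Suc l)) H (greedy_residual rule u \<tau> B G y l)" for G H
  proof -
    have 1: "greedy_residual rule u \<tau> B (mix_rows p G H) y l = greedy_residual rule u \<tau> B G y l"
    proof (rule greedy_residual_cong[OF tb B])
      fix k b assume "k \<in> {1..l}" "b \<in> B k"
      hence "p b = b" by (intro p(2)) blast
      thus "mix_rows p G H *v b = G *v b" by (simp add: mix_rows_mult[OF p(4)])
    qed (use l in auto)
    have 2: "mix_rows p G H *v b = H *v b" if "b \<in> B (Suc l)" for b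
      using p_next[OF that] by (simp add: mix_rows_mult[OF p(4)])
    have 3: "greedy_choices rule u (mix_rows p G H) (B (Suc l)) r = greedy_choices rule u H (B (Suc l)) r" for r
      by (rule greedy_choices_cong[OF 2])
    have "\<tau> (Suc l) (greedy_choices rule u H (B (Suc l)) r) \<in> B (Suc l)" for r
      using B[of "Suc l"] l by (intro tie_breaking_greedy_choices[OF tb]) auto
    thus ?thesis unfolding greedy_residual_Suc greedy_step_def 1 3 using 2 by simp
  qed
  have "distr std_gaussian borel (\<lambda>A. greedy_residual rule u \<tau> B A y (Suc l)) =
    distr (distr (std_gaussian \<Otimes>\<^sub>M std_gaussian) borel (\<lambda>(G, H). mix_rows p G H)) borel
      (\<lambda>A. greedy_residual rule u \<tau> B A y (Suc l))"
    by (simp add: mix_rows_std_gaussian(2)[OF p(1,4,5)])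
  also have "\<dots> = distr (std_gaussian \<Otimes>\<^sub>M std_gaussian) borel
      ((\<lambda>A. greedy_residual rule u \<tau> B A y (Suc l)) \<circ> (\<lambda>(G, H). mix_rows p G H))"
    using mix_rows_std_gaussian(1)[OF p(1,4,5), where 'n='n]
    by (intro distr_distr) (auto simp: std_gaussian_pair borel_prod)
  also have "\<dots> = distr (std_gaussian \<Otimes>\<^sub>M std_gaussian) borel
      (\<lambda>(G, H). greedy_step rule u (\<tau> (Suc l)) (B (Suc l)) H (greedy_residual rule u \<tau> B G y l))"
    by (intro distr_cong refl) (auto simp: eq)
  finally show ?thesis .
qed

section \<open>The law of a single stage\<close>

text \<open>An orthogonal map chosen at random still preserves the Gaussian law if it does not
  disturb its own choice: every piece on which \<sigma> is constant is invariant under the map used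
  there, and rotational invariance applies piece by piece.\<close>

lemma distr_std_gaussian_piecewise_orthogonal:
  fixes f g :: "'a::euclidean_space \<Rightarrow> real"
  assumes [measurable]: "f \<in> borel_measurable borel" "g \<in> borel_measurable borel"
    and S: "finite S" "\<And>x. \<sigma> x \<in> S"
    and \<sigma>: "\<sigma> \<in> borel \<rightarrow>\<^sub>M count_space S"
    and T: "\<And>b. b \<in> S \<Longrightarrow> orthogonal_transformation (T b)"
    and inv: "\<And>b x. b \<in> S \<Longrightarrow> \<sigma> (T b x) = \<sigma> x"
    and eq: "\<And>x. f x = g (T (\<sigma> x) x)"
  shows "distr std_gaussian borel f = distr std_gaussian borel g"
proof (rule measure_eqI)
  fix X assume "X \<in> sets (distr std_gaussian borel f)"
  hence [measurable]: "X \<in> sets borel" by simp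
  have lev[measurable]: "{x. \<sigma> x = b} \<in> sets borel" if "b \<in> S" for b
    using measurable_sets[OF \<sigma>, of "{b}"] that by (simp add: vimage_def)
  have part: "emeasure std_gaussian (h -` X) = (\<Sum>b\<in>S. emeasure std_gaussian ({x. \<sigma> x = b} \<inter> h -` X))"
    if [measurable]: "h \<in> borel_measurable borel" for h :: "'a \<Rightarrow> real"
  proof -
    have hX: "h -` X \<in> sets borel" using measurable_sets[OF that, of X] by simp
    have "h -` X = (\<Union>b\<in>S. {x. \<sigma> x = b} \<inter> h -` X)" using S(2) by auto
    hence "emeasure std_gaussian (h -` X) = emeasure std_gaussian (\<Union>b\<in>S. {x. \<sigma> x = b} \<inter> h -` X)"
      by simp
    also have "\<dots> = (\<Sum>b\<in>S. emeasure std_gaussian ({x. \<sigma> x = b} \<inter> h -` X))"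
      by (rule sum_emeasure[symmetric]) (use S hX lev in \<open>auto simp: disjoint_family_on_def\<close>)
    finally show ?thesis .
  qed
  have "emeasure (distr std_gaussian borel f) X = emeasure std_gaussian (f -` X)"
    by (subst emeasure_distr) auto
  also have "\<dots> = (\<Sum>b\<in>S. emeasure std_gaussian ({x. \<sigma> x = b} \<inter> f -` X))" by (rule part) simp
  also have "\<dots> = (\<Sum>b\<in>S. emeasure std_gaussian ({x. \<sigma> x = b} \<inter> g -` X))"
  proof (rule sum.cong[OF refl])
    fix b assume b: "b \<in> S"
    have Tb: "T b \<in> borel_measurable std_gaussian"
      using borel_measurable_linear[OF orthogonal_transformation_linear[OF T[OF b]]] by simp
    have gX: "{x. \<sigma> x = b} \<inter> g -` X \<in> sets borel"
      using measurable_sets[of g borel borel X] lev[OF b] by auto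
    have "emeasure std_gaussian ({x. \<sigma> x = b} \<inter> g -` X) = emeasure (distr std_gaussian borel (T b)) ({x. \<sigma> x = b} \<inter> g -` X)"
      by (simp add: distr_std_gaussian_orthogonal[OF T[OF b]])
    also have "\<dots> = emeasure std_gaussian (T b -` ({x. \<sigma> x = b} \<inter> g -` X))"
      by (subst emeasure_distr[OF Tb gX]) simp
    also have "T b -` ({x. \<sigma> x = b} \<inter> g -` X) = {x. \<sigma> x = b} \<inter> f -` X"
      using inv[OF b] eq by auto
    finally show "emeasure std_gaussian ({x. \<sigma> x = b} \<inter> f -` X) = emeasure std_gaussian ({x. \<sigma> x = b} \<inter> g -` X)"
      by simp
  qed
  also have "\<dots> = emeasure std_gaussian (g -` X)" by (rule part[symmetric]) simp
  also have "\<dots> = emeasure (distr std_gaussian borel g) X" by (subst emeasure_distr) auto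
  finally show "emeasure (distr std_gaussian borel f) X = emeasure (distr std_gaussian borel g) X" .
qed simp

text \<open>For linear \<open>U\<close> this is left multiplication by its matrix. It rotates all
  images \<open>G *v b\<close> at once, which moves the residual to a fixed axis.\<close>

definition map_columns :: "(real^'n \<Rightarrow> real^'n) \<Rightarrow> real^'N^'n \<Rightarrow> real^'N^'n" where
  "map_columns U G = (\<chi> i j. U (\<chi> k. G $ k $ j) $ i)"

lemma map_columns_mult:
  assumes "linear U"
  shows "map_columns U G *v b = U (G *v b)"
proof -
  have "G *v b = (\<Sum>j\<in>UNIV. b $ j *\<^sub>R (\<chi> k. G $ k $ j))"
    by (simp add: vec_eq_iff matrix_vector_mult_def mult.commute)
  hence "U (G *v b) = (\<Sum>j\<in>UNIV. b $ j *\<^sub>R U (\<chi> k. G $ k $ j))"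
    by (simp add: linear_sum[OF assms] linear_cmul[OF assms])
  thus ?thesis by (simp add: vec_eq_iff matrix_vector_mult_def map_columns_def mult.commute)
qed

lemma orthogonal_transformation_map_columns:
  assumes U: "orthogonal_transformation U"
  shows "orthogonal_transformation (map_columns U :: real^'N^'n \<Rightarrow> real^'N^'n)"
proof -
  have lin: "linear U" and inn: "U v \<bullet> U w = v \<bullet> w" for v w
    using U by (auto simp: orthogonal_transformation_def)
  have "map_columns U G \<bullet> map_columns U H = G \<bullet> H" for G H :: "real^'N^'n"
  proof -
    have col: "G \<bullet> H = (\<Sum>j\<in>UNIV. (\<chi> k. G $ k $ j) \<bullet> (\<chi> k. H $ k $ j))" for G H :: "real^'N^'n"
      unfolding inner_vec_def by (simp add: inner_vec_def) (rule sum.swap)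
    have "(\<chi> k. map_columns U G $ k $ j) = U (\<chi> k. G $ k $ j)" for G :: "real^'N^'n" and j
      by (simp add: vec_eq_iff map_columns_def)
    thus ?thesis by (subst (1 2) col) (simp add: inn)
  qed
  moreover have "linear (map_columns U :: real^'N^'n \<Rightarrow> real^'N^'n)"
  proof (rule linearI)
    fix G H :: "real^'N^'n" and a :: real
    have add: "(\<chi> k. G $ k $ j + H $ k $ j) = (\<chi> k. G $ k $ j) + (\<chi> k. H $ k $ j)" for j
      by (simp add: vec_eq_iff)
    show "map_columns U (G + H) = map_columns U G + map_columns U H"
      by (simp add: map_columns_def vec_eq_iff add linear_add[OF lin])
    have cmul: "(\<chi> k. a * G $ k $ j) = a *\<^sub>R (\<chi> k. G $ k $ j)" for j
      by (simp add: vec_eq_iff)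
    show "map_columns U (a *\<^sub>R G) = a *\<^sub>R map_columns U G"
      by (simp add: map_columns_def vec_eq_iff cmul linear_cmul[OF lin])
  qed
  ultimately show ?thesis by (simp add: orthogonal_transformation_def)
qed

text \<open>Row \<open>i\<close> is spared because the correlation choice is read off it.\<close>

definition map_rows_except :: "'n \<Rightarrow> (real^'N \<Rightarrow> real^'N) \<Rightarrow> real^'N^'n \<Rightarrow> real^'N^'n" where
  "map_rows_except i V G = (\<chi> k. if k = i then G $ k else V (G $ k))"

lemma orthogonal_transformation_map_rows_except:
  assumes V: "orthogonal_transformation V"
  shows "orthogonal_transformation (map_rows_except i V :: real^'N^'n \<Rightarrow> real^'N^'n)"
proof -
  have lin: "linear V" and inn: "V v \<bullet> V w = v \<bullet> w" for v w
    using V by (auto simp: orthogonal_transformation_def)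
  have rows: "G \<bullet> H = (\<Sum>i\<in>UNIV. G $ i \<bullet> H $ i)" for G H :: "real^'N^'n"
    by (rule inner_vec_def)
  have "map_rows_except i V G \<bullet> map_rows_except i V H = G \<bullet> H" for G H :: "real^'N^'n"
    unfolding rows by (intro sum.cong refl) (simp add: map_rows_except_def inn)
  moreover have "linear (map_rows_except i V :: real^'N^'n \<Rightarrow> real^'N^'n)"
    by (rule linearI) (auto simp: map_rows_except_def vec_eq_iff linear_add[OF lin] linear_cmul[OF lin])
  ultimately show ?thesis by (simp add: orthogonal_transformation_def)
qed

section \<open>Lipschitz representations of a stage\<close>

lemma norm_cong_abs:
  fixes x y :: "real^'n"
  assumes "\<And>i. \<bar>x $ i\<bar> = \<bar>y $ i\<bar>"
  shows "norm x = norm y"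
  using assms by (simp add: norm_vec_def)

text \<open>\<open>norm G\<close> is the Frobenius norm, the one that the concentration inequality
  refers to. The Lipschitz constant of a stage is therefore the norm of its coefficients, with no
  operator norm or dimension involved.\<close>

lemma norm_mult_le:
  fixes G :: "real^'N^'n"
  shows "norm (G *v b) \<le> norm b * norm G"
proof -
  have "norm (G *v b) \<le> L2_set (\<lambda>i. norm b * norm (G $ i)) UNIV"
    unfolding norm_vec_def[of "G *v b"]
    by (rule L2_set_mono) (auto simp: matrix_vector_mul_component Cauchy_Schwarz_ineq2 mult.commute[of "norm b"])
  also have "\<dots> = norm b * norm G"
    by (simp add: norm_vec_def[of G] L2_set_right_distrib)
  finally show ?thesis .
qed

lemma abs_Min_diff_le:
  fixes f g :: "'b \<Rightarrow> real"
  assumes "finite S" "S \<noteq> {}" "\<And>b. b \<in> S \<Longrightarrow> \<bar>f b - g b\<bar> \<le> e"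
  shows "\<bar>Min (f ` S) - Min (g ` S)\<bar> \<le> e"
proof -
  have "Min (f ` S) \<le> Min (g ` S) + e" if "\<And>b. b \<in> S \<Longrightarrow> \<bar>f b - g b\<bar> \<le> e" for f g :: "'b \<Rightarrow> real"
  proof -
    have "Min (g ` S) \<in> g ` S" using assms(1,2) by (intro Min_in) auto
    then obtain b where b: "b \<in> S" "Min (g ` S) = g b" by auto
    have "Min (f ` S) \<le> f b" using assms(1) b by (intro Min_le) auto
    thus ?thesis using that[OF b(1)] b(2) by linarith
  qed
  from this[of f g] this[of g f] assms(3) show ?thesis by (auto simp: abs_le_iff abs_minus_commute)
qed

lemma abs_Max_diff_le:
  fixes f g :: "'b \<Rightarrow> real"
  assumes "finite S" "S \<noteq> {}" "\<And>b. b \<in> S \<Longrightarrow> \<bar>f b - g b\<bar> \<le> e"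
  shows "\<bar>Max (f ` S) - Max (g ` S)\<bar> \<le> e"
proof -
  have "Max (f ` S) \<le> Max (g ` S) + e" if "\<And>b. b \<in> S \<Longrightarrow> \<bar>f b - g b\<bar> \<le> e" for f g :: "'b \<Rightarrow> real"
  proof -
    have "Max (f ` S) \<in> f ` S" using assms(1,2) by (intro Max_in) auto
    then obtain b where b: "b \<in> S" "Max (f ` S) = f b" by auto
    have "g b \<le> Max (g ` S)" using assms(1) b by (intro Max_ge) auto
    thus ?thesis using that[OF b(1)] b(2) by linarith
  qed
  from this[of f g] this[of g f] assms(3) show ?thesis by (auto simp: abs_le_iff abs_minus_commute)
qed

text \<open>Tied elements all give the same residual norm, so here the norm itself, not just its
  law, is \<open>F (norm r)\<close> at a rotated matrix.\<close>

lemma distance_step_law: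
  fixes S :: "(real^'N) set" and u :: "real^'n"
  assumes S: "finite S" "S \<noteq> {}" and c: "0 \<le> c" "\<And>b. b \<in> S \<Longrightarrow> norm b = c"
    and t: "\<And>C. C \<subseteq> S \<Longrightarrow> C \<noteq> {} \<Longrightarrow> t C \<in> C"
  shows "\<exists>F :: real \<Rightarrow> real^'N^'n \<Rightarrow> real.
    (\<forall>G. 1-lipschitz_on UNIV (\<lambda>s. F s G)) \<and> (\<forall>s. c-lipschitz_on UNIV (F s)) \<and>
    (\<forall>r. distr std_gaussian borel (\<lambda>G. norm (greedy_step Distance_Based u t S G r)) =
         distr std_gaussian borel (F (norm r)))"
proof -
  define e :: "real^'n" where "e = axis undefined 1"
  have e: "norm e = 1" by (simp add: e_def norm_axis_1)
  define F :: "real \<Rightarrow> real^'N^'n \<Rightarrow> real" where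
    "F s G = Min ((\<lambda>b. norm (s *\<^sub>R e - G *v b)) ` S)" for s G
  have F_s: "1-lipschitz_on UNIV (\<lambda>s. F s G)" for G
  proof (rule lipschitz_onI)
    fix s s' :: real
    have "\<bar>F s G - F s' G\<bar> \<le> \<bar>s - s'\<bar>"
      unfolding F_def
    proof (rule abs_Min_diff_le[OF S])
      fix b
      have "\<bar>norm (s *\<^sub>R e - G *v b) - norm (s' *\<^sub>R e - G *v b)\<bar> \<le> norm ((s - s') *\<^sub>R e)"
        using norm_triangle_ineq3[of "s *\<^sub>R e - G *v b" "s' *\<^sub>R e - G *v b"] by (simp add: scaleR_left_diff_distrib)
      thus "\<bar>norm (s *\<^sub>R e - G *v b) - norm (s' *\<^sub>R e - G *v b)\<bar> \<le> \<bar>s - s'\<bar>" by (simp add: e)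
    qed
    thus "dist (F s G) (F s' G) \<le> 1 * dist s s'" by (simp add: dist_real_def)
  qed simp
  have F_G: "c-lipschitz_on UNIV (F s)" for s
  proof (rule lipschitz_onI)
    fix G H :: "real^'N^'n"
    have "\<bar>F s G - F s H\<bar> \<le> c * norm (G - H)"
      unfolding F_def
    proof (rule abs_Min_diff_le[OF S])
      fix b assume b: "b \<in> S"
      have "\<bar>norm (s *\<^sub>R e - G *v b) - norm (s *\<^sub>R e - H *v b)\<bar> \<le> norm ((G - H) *v b)"
        using norm_triangle_ineq3[of "s *\<^sub>R e - G *v b" "s *\<^sub>R e - H *v b"]
        by (simp add: matrix_vector_mult_diff_rdistrib norm_minus_commute)
      also have "\<dots> \<le> c * norm (G - H)" using norm_mult_le[of "G - H" b] c(2)[OF b] by simp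
      finally show "\<bar>norm (s *\<^sub>R e - G *v b) - norm (s *\<^sub>R e - H *v b)\<bar> \<le> c * norm (G - H)" .
    qed
    thus "dist (F s G) (F s H) \<le> c * dist G H" by (simp add: dist_real_def dist_norm)
  qed (rule c(1))
  have "distr std_gaussian borel (\<lambda>G. norm (greedy_step Distance_Based u t S G r)) =
         distr std_gaussian borel (F (norm r))" for r
  proof -
    obtain U where U: "orthogonal_transformation U" "U r = norm r *\<^sub>R e"
      using orthogonal_transformation_exists[of r "norm r *\<^sub>R e"] e by auto
    have lin: "linear U" and nrm: "norm (U v) = norm v" for v
      using U(1) by (auto simp: orthogonal_transformation)
    have "norm (greedy_step Distance_Based u t S G r) = F (norm r) (map_columns U G)" for G
    proof -
      let ?C = "greedy_choices Distance_Based u G S r"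
      have "t ?C \<in> ?C" by (intro t greedy_choices_subset greedy_choices_nonempty S)
      hence "norm (r - G *v t ?C) = Min ((\<lambda>b. norm (r - G *v b)) ` S)"
        using S by (intro Min_eqI[symmetric]) (auto simp: is_arg_min_def not_less)
      moreover have "norm (r - G *v b) = norm (norm r *\<^sub>R e - map_columns U G *v b)" for b
        using nrm[of "r - G *v b"] by (simp add: linear_diff[OF lin] U(2) map_columns_mult[OF lin])
      ultimately show ?thesis by (simp add: greedy_step_def F_def del: greedy_choices.simps)
    qed
    hence "distr std_gaussian borel (\<lambda>G. norm (greedy_step Distance_Based u t S G r)) =
      distr std_gaussian borel (F (norm r) \<circ> map_columns U)" by (simp add: comp_def)
    also have "\<dots> = distr (distr std_gaussian borel (map_columns U)) borel (F (norm r))"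
      using lipschitz_on_borel_measurable[OF F_G]
        borel_measurable_linear[OF orthogonal_transformation_linear[OF orthogonal_transformation_map_columns[OF U(1)]]]
      by (intro distr_distr[symmetric]) auto
    also have "\<dots> = distr std_gaussian borel (F (norm r))"
      by (simp add: distr_std_gaussian_orthogonal[OF orthogonal_transformation_map_columns[OF U(1)]])
    finally show ?thesis .
  qed
  with F_s F_G show ?thesis by blast
qed

text \<open>After rotating the residual to the axis \<open>i0\<close>, the choice \<open>b\<close> depends on row \<open>i0\<close> of the matrix
  only. Rotating the other rows by a map that takes \<open>b\<close> to \<open>c\<close> times the axis \<open>j0\<close> replaces their
  inner products with \<open>b\<close> by \<open>c\<close> times their entries in column \<open>j0\<close>. Unlike the residual norm
  itself, the resulting \<open>F\<close> is Lipschitz.\<close>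

lemma correlation_step_law:
  fixes S :: "(real^'N) set" and u :: "real^'n"
  assumes S: "finite S" "S \<noteq> {}" and c: "0 \<le> c" "\<And>b. b \<in> S \<Longrightarrow> norm b = c"
    and t: "\<And>C. C \<subseteq> S \<Longrightarrow> C \<noteq> {} \<Longrightarrow> t C \<in> C" and u: "u \<noteq> 0"
  shows "\<exists>F :: real \<Rightarrow> real^'N^'n \<Rightarrow> real.
    (\<forall>G. 1-lipschitz_on UNIV (\<lambda>s. F s G)) \<and> (\<forall>s. c-lipschitz_on UNIV (F s)) \<and>
    (\<forall>r. distr std_gaussian borel (\<lambda>G. norm (greedy_step Correlation_Based u t S G r)) =
         distr std_gaussian borel (F (norm r)))"
proof -
  define i0 :: 'n and j0 :: 'N where "i0 = undefined" and "j0 = undefined"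
  define e :: "real^'n" where "e = axis i0 1"
  have e: "norm e = 1" "e \<noteq> 0" by (simp_all add: e_def norm_axis_1 axis_eq_0_iff)
  \<comment> \<open>On the axis the residual is \<open>s\<close> minus the largest correlation: this
    maximum is Lipschitz in row \<open>i0\<close> although the maximiser jumps.\<close>
  define v :: "real \<Rightarrow> real^'N^'n \<Rightarrow> real^'n" where
    "v s G = (\<chi> i. if i = i0 then s - Max ((\<lambda>b. G $ i0 \<bullet> b) ` S) else c * G $ i $ j0)" for s G
  define F where "F s G = norm (v s G)" for s G
  have F_s: "1-lipschitz_on UNIV (\<lambda>s. F s G)" for G
  proof (rule lipschitz_onI)
    fix s s' :: real
    have "\<bar>F s G - F s' G\<bar> \<le> norm (v s G - v s' G)" unfolding F_def by (rule norm_triangle_ineq3)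
    also have "v s G - v s' G = (s - s') *\<^sub>R e" by (simp add: v_def e_def vec_eq_iff axis_def)
    finally show "dist (F s G) (F s' G) \<le> 1 * dist s s'" by (simp add: dist_real_def e)
  qed simp
  have F_G: "c-lipschitz_on UNIV (F s)" for s
  proof (rule lipschitz_onI)
    fix G H :: "real^'N^'n"
    have "\<bar>F s G - F s H\<bar> \<le> norm (v s G - v s H)" unfolding F_def by (rule norm_triangle_ineq3)
    also have "\<dots> \<le> L2_set (\<lambda>i. c * norm ((G - H) $ i)) UNIV"
      unfolding norm_vec_def[of "v s G - v s H"]
    proof (rule L2_set_mono)
      fix i
      show "norm ((v s G - v s H) $ i) \<le> c * norm ((G - H) $ i)"
      proof (cases "i = i0")
        case True
        have "\<bar>Max ((\<lambda>b. H $ i0 \<bullet> b) ` S) - Max ((\<lambda>b. G $ i0 \<bullet> b) ` S)\<bar> \<le> c * norm ((G - H) $ i0)"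
        proof (rule abs_Max_diff_le[OF S])
          fix b assume b: "b \<in> S"
          have "\<bar>H $ i0 \<bullet> b - G $ i0 \<bullet> b\<bar> = \<bar>(H $ i0 - G $ i0) \<bullet> b\<bar>" by (simp add: inner_diff_left)
          also have "\<dots> \<le> norm (H $ i0 - G $ i0) * norm b" by (rule Cauchy_Schwarz_ineq2)
          finally show "\<bar>H $ i0 \<bullet> b - G $ i0 \<bullet> b\<bar> \<le> c * norm ((G - H) $ i0)"
            by (simp add: c(2)[OF b] mult.commute norm_minus_commute)
        qed
        thus ?thesis using True by (simp add: v_def)
      next
        case False
        have "\<bar>c * G $ i $ j0 - c * H $ i $ j0\<bar> = c * norm ((G - H) $ i $ j0)"
          using c(1) by (simp add: abs_mult flip: right_diff_distrib)
        also have "\<dots> \<le> c * norm ((G - H) $ i)"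
          using c(1) component_le_norm_cart[of "(G - H) $ i" j0] by (intro mult_left_mono) auto
        finally show ?thesis using False by (simp add: v_def)
      qed
    qed simp
    also have "\<dots> = c * norm (G - H)"
      using c(1) by (simp add: norm_vec_def[of "G - H"] L2_set_right_distrib)
    finally show "dist (F s G) (F s H) \<le> c * dist G H" by (simp add: dist_real_def dist_norm)
  qed (rule c(1))
  \<comment> \<open>Always selected with the unit vector \<open>e\<close>, since a positive factor
    of the residual does not affect the correlation choice; the selection is thus free of
    \<open>s\<close>.\<close>
  define \<sigma> where "\<sigma> G = t (greedy_choices Correlation_Based u G S e)" for G
  have e_mult: "e \<bullet> (G *v b) = G $ i0 \<bullet> b" for G :: "real^'N^'n" and b
    by (simp add: e_def inner_axis' matrix_vector_mul_component)
  have \<sigma>_choice: "\<sigma> G \<in> greedy_choices Correlation_Based u G S e" for G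
    unfolding \<sigma>_def by (intro t greedy_choices_subset greedy_choices_nonempty S)
  have \<sigma>_S: "\<sigma> G \<in> S" for G using \<sigma>_choice greedy_choices_subset by blast
  have \<sigma>_max: "G $ i0 \<bullet> \<sigma> G = Max ((\<lambda>b. G $ i0 \<bullet> b) ` S)" for G
    using \<sigma>_choice[of G] S e(2) unfolding mem_greedy_choices_Correlation
    by (intro Max_eqI[symmetric]) (auto simp: is_arg_max_def not_less e_mult)
  have \<sigma>_meas: "\<sigma> \<in> borel \<rightarrow>\<^sub>M count_space S"
  proof -
    have "(\<lambda>G. greedy_choices Correlation_Based u G S e) \<in> borel \<rightarrow>\<^sub>M count_space (Pow S)"
      using measurable_compose[OF _ measurable_greedy_choices[OF S(1)], of "\<lambda>G. (G, e)" borel Correlation_Based u]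
      by simp
    hence "{G. greedy_choices Correlation_Based u G S e = C} \<in> sets borel" if "C \<subseteq> S" for C
      using that measurable_sets[of _ borel "count_space (Pow S)" "{C}"]
      by (auto simp: vimage_def simp del: greedy_choices.simps)
    moreover have "\<sigma> -` {b} \<inter> space borel = (\<Union>C\<in>{C\<in>Pow S. t C = b}. {G. greedy_choices Correlation_Based u G S e = C})" for b
      unfolding \<sigma>_def space_borel using greedy_choices_subset[of Correlation_Based u _ S e] by blast
    ultimately have "\<sigma> -` {b} \<inter> space borel \<in> sets borel" for b
      using S(1) by auto
    thus ?thesis using S(1) \<sigma>_S by (subst measurable_count_space_eq2) auto
  qed
  define N where "N s G = norm (s *\<^sub>R e - G *v \<sigma> G)" for s G
  \<comment> \<open>Reduces measurability to that of a stage with residual \<open>e\<close>; the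
    added multiple of \<open>e\<close> replaces this residual by
    \<open>s *\<^sub>R e\<close>.\<close>
  have N_eq: "N s G = norm (greedy_step Correlation_Based u t S G e + (s - 1) *\<^sub>R e)" for s G
    by (simp add: N_def greedy_step_def \<sigma>_def algebra_simps del: greedy_choices.simps)
  have step_e: "(\<lambda>G. greedy_step Correlation_Based u t S G e) \<in> borel_measurable borel"
    using measurable_compose[OF _ measurable_greedy_step[OF S(1)], of "\<lambda>G. (G, e)" borel Correlation_Based u t] by simp
  have N_meas[measurable]: "N s \<in> borel_measurable borel" for s
    unfolding N_eq[abs_def] using step_e by measurable
  have "\<exists>V. orthogonal_transformation V \<and> V b = c *\<^sub>R (axis j0 1 :: real^'N)" if "b \<in> S" for b
    by (rule orthogonal_transformation_exists[of b "c *\<^sub>R axis j0 1"])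
      (use c(1) c(2)[OF that] in \<open>auto simp: norm_axis_1\<close>)
  hence "\<exists>V. \<forall>b\<in>S. orthogonal_transformation (V b) \<and> V b b = c *\<^sub>R (axis j0 1 :: real^'N)"
    by (intro bchoice) blast
  then obtain V where V: "\<And>b. b \<in> S \<Longrightarrow> orthogonal_transformation (V b)"
    "\<And>b. b \<in> S \<Longrightarrow> V b b = c *\<^sub>R (axis j0 1 :: real^'N)" by blast
  have N_law: "distr std_gaussian borel (N s) = distr std_gaussian borel (F s)" for s
  proof (rule distr_std_gaussian_piecewise_orthogonal[where S = S and \<sigma> = \<sigma> and T = "\<lambda>b. map_rows_except i0 (V b)"])
    show "F s \<in> borel_measurable borel" by (rule lipschitz_on_borel_measurable[OF F_G])
    show "orthogonal_transformation (map_rows_except i0 (V b))" if "b \<in> S" for b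
      by (rule orthogonal_transformation_map_rows_except[OF V(1)[OF that]])
    show "\<sigma> (map_rows_except i0 (V b) G) = \<sigma> G" for b G
    proof -
      have "greedy_choices Correlation_Based u (map_rows_except i0 (V b) G) S e = greedy_choices Correlation_Based u G S e"
        using e(2) by (intro set_eqI) (simp add: mem_greedy_choices_Correlation e_mult map_rows_except_def del: greedy_choices.simps)
      thus ?thesis by (simp add: \<sigma>_def)
    qed
    show "N s G = F s (map_rows_except i0 (V (\<sigma> G)) G)" for G
      unfolding N_def F_def
    \<comment> \<open>Off the axis the coordinates agree only up to sign.\<close>
    proof (rule norm_cong_abs)
      fix i
      show "\<bar>(s *\<^sub>R e - G *v \<sigma> G) $ i\<bar> = \<bar>v s (map_rows_except i0 (V (\<sigma> G)) G) $ i\<bar>"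
      proof (cases "i = i0")
        case True
        thus ?thesis
          by (simp add: v_def map_rows_except_def matrix_vector_mul_component e_def \<sigma>_max[symmetric])
      next
        case False
        have "G $ i \<bullet> \<sigma> G = V (\<sigma> G) (G $ i) \<bullet> V (\<sigma> G) (\<sigma> G)"
          using V(1)[OF \<sigma>_S[of G]] by (simp add: orthogonal_transformation_def)
        also have "\<dots> = c * V (\<sigma> G) (G $ i) $ j0"
          by (simp add: V(2)[OF \<sigma>_S] inner_axis)
        finally show ?thesis using False
          by (simp add: v_def map_rows_except_def matrix_vector_mul_component e_def axis_def)
      qed
    qed
  qed (use S \<sigma>_S \<sigma>_meas in auto)
  have "distr std_gaussian borel (\<lambda>G. norm (greedy_step Correlation_Based u t S G r)) =
         distr std_gaussian borel (F (norm r))" for r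
  proof -
    \<comment> \<open>The vector that governs the selection is rotated to the axis. For zero
      residual this is \<open>u\<close>, and \<open>U r = norm r *\<^sub>R e\<close> still holds, so
      the law at 0 is that of \<open>F 0\<close>.\<close>
    define d where "d = (if r = 0 then u else r)"
    have d: "d \<noteq> 0" using u by (simp add: d_def)
    obtain U where U: "orthogonal_transformation U" "U d = norm d *\<^sub>R e"
      using orthogonal_transformation_exists[of d "norm d *\<^sub>R e"] e by auto
    have lin: "linear U" and nrm: "norm (U v) = norm v" and inn: "U v \<bullet> U w = v \<bullet> w" for v w
      using U(1) orthogonal_transformation_norm[OF U(1)] by (auto simp: orthogonal_transformation_def)
    have Ur: "U r = norm r *\<^sub>R e"
      using U(2) by (cases "r = 0") (auto simp: d_def linear_0[OF lin])
    have "norm (greedy_step Correlation_Based u t S G r) = N (norm r) (map_columns U G)" for G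
    proof -
      have "d \<bullet> (G *v b) = norm d * (e \<bullet> (map_columns U G *v b))" for b
        using inn[of d "G *v b"] by (simp add: U(2) map_columns_mult[OF lin])
      hence "greedy_choices Correlation_Based u G S r = greedy_choices Correlation_Based u (map_columns U G) S e"
        using e(2) d unfolding d_def[symmetric]
        by (intro set_eqI) (simp add: mem_greedy_choices_Correlation is_arg_max_def flip: d_def del: greedy_choices.simps)
      moreover have "norm (r - G *v b) = norm (norm r *\<^sub>R e - map_columns U G *v b)" for b
        using nrm[of "r - G *v b"] by (simp add: linear_diff[OF lin] Ur map_columns_mult[OF lin])
      ultimately show ?thesis by (simp add: greedy_step_def N_def \<sigma>_def del: greedy_choices.simps)
    qed
    hence "distr std_gaussian borel (\<lambda>G. norm (greedy_step Correlation_Based u t S G r)) =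
      distr std_gaussian borel (N (norm r) \<circ> map_columns U)" by (simp add: comp_def)
    also have "\<dots> = distr (distr std_gaussian borel (map_columns U)) borel (N (norm r))"
      using borel_measurable_linear[OF orthogonal_transformation_linear[OF orthogonal_transformation_map_columns[OF U(1)]]]
      by (intro distr_distr[symmetric]) auto
    also have "\<dots> = distr std_gaussian borel (F (norm r))"
      by (simp add: distr_std_gaussian_orthogonal[OF orthogonal_transformation_map_columns[OF U(1)]] N_law)
    finally show ?thesis .
  qed
  with F_s F_G show ?thesis by blast
qed

section \<open>All stages\<close>

lemma greedy_step_law:
  fixes B :: "nat \<Rightarrow> (real^'N) set" and u :: "real^'n"
  assumes "additive_orthogonal_code L B c" and "tie_breaking L B \<tau>" and "u \<noteq> 0" and "k \<in> {1..L}"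
  obtains F :: "real \<Rightarrow> real^'N^'n \<Rightarrow> real" where
    "\<And>G. 1-lipschitz_on UNIV (\<lambda>s. F s G)" "\<And>s. (c k)-lipschitz_on UNIV (F s)"
    "\<And>r. distr std_gaussian borel (\<lambda>G. norm (greedy_step rule u (\<tau> k) (B k) G r)) =
         distr std_gaussian borel (F (norm r))"
proof -
  have "finite (B k)" "B k \<noteq> {}" "0 \<le> c k" "\<And>b. b \<in> B k \<Longrightarrow> norm b = c k"
    "\<And>C. C \<subseteq> B k \<Longrightarrow> C \<noteq> {} \<Longrightarrow> \<tau> k C \<in> C"
    using assms by (auto simp: additive_orthogonal_code_def tie_breaking_def less_imp_le)
  hence "\<exists>F :: real \<Rightarrow> real^'N^'n \<Rightarrow> real.
    (\<forall>G. 1-lipschitz_on UNIV (\<lambda>s. F s G)) \<and> (\<forall>s. (c k)-lipschitz_on UNIV (F s)) \<and>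
    (\<forall>r. distr std_gaussian borel (\<lambda>G. norm (greedy_step rule u (\<tau> k) (B k) G r)) =
         distr std_gaussian borel (F (norm r)))"
    using distance_step_law[of "B k" "c k" "\<tau> k" u] correlation_step_law[of "B k" "c k" "\<tau> k" u] assms(3)
    by (cases rule) auto
  thus thesis using that by blast
qed

lemma abs_le_exp_add_exp: "\<bar>x\<bar> \<le> exp x + exp (- x)" for x :: real
  using exp_ge_add_one_self[of x] exp_ge_add_one_self[of "- x"] exp_gt_zero[of x] exp_gt_zero[of "- x"]
  by linarith

text \<open>Exponential bounds are carried along as \<open>nn_integral\<close>, which presupposes no
  integrability; finiteness for both signs of \<open>s\<close> recovers it.\<close>

lemma integrable_of_exp_moments:
  fixes f :: "'a \<Rightarrow> real"
  assumes [measurable]: "f \<in> borel_measurable M"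
    and e: "\<And>s. (\<integral>\<^sup>+x. ennreal (exp (s * f x)) \<partial>M) \<le> ennreal (C s)"
  shows "integrable M f" "\<And>s. integrable M (\<lambda>x. exp (s * f x))"
proof -
  show i: "integrable M (\<lambda>x. exp (s * f x))" for s
    using le_less_trans[OF e[of s]] by (intro integrableI_nonneg) auto
  show "integrable M f"
  proof (rule Bochner_Integration.integrable_bound)
    show "integrable M (\<lambda>x. exp (1 * f x) + exp (-1 * f x))"
      by (intro Bochner_Integration.integrable_add i)
    show "AE x in M. norm (f x) \<le> norm (exp (1 * f x) + exp (-1 * f x))"
      using abs_le_exp_add_exp by (intro AE_I2) (simp add: add_nonneg_nonneg)
  qed simp
qed

text \<open>The statement for all 1-Lipschitz \<open>h\<close> makes the induction run backwards through the stages: for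
  \<open>Suc l\<close> the hypothesis is used with the mean of \<open>h\<close> after one more step.\<close>

lemma greedy_residual_moments:
  fixes B :: "nat \<Rightarrow> (real^'N) set" and u :: "real^'n"
  assumes code: "additive_orthogonal_code L B c" and tb: "tie_breaking L B \<tau>" and u: "u \<noteq> 0"
    and l: "l \<le> L" and h: "1-lipschitz_on UNIV (h :: real \<Rightarrow> real)"
  shows "\<exists>m. 1-lipschitz_on UNIV m \<and> (\<forall>y.
    integrable std_gaussian (\<lambda>A. h (norm (greedy_residual rule u \<tau> B A y l))) \<and>
    (\<integral>A. h (norm (greedy_residual rule u \<tau> B A y l)) \<partial>std_gaussian) = m (norm y) \<and>
    (\<forall>s. (\<integral>\<^sup>+A. ennreal (exp (s * h (norm (greedy_residual rule u \<tau> B A y l)))) \<partial>std_gaussian) \<le>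
      ennreal (exp (s\<^sup>2 * (\<Sum>k=1..l. (c k)\<^sup>2) / 2 + s * m (norm y)))))"
  using l h
proof (induction l arbitrary: h)
  case 0
  show ?case
    by (rule exI[of _ h]) (use 0 in \<open>simp add: greedy_residual_0\<close>)
next
  case (Suc l)
  let ?R = "\<lambda>A y l. greedy_residual rule u \<tau> B A y l"
  let ?S = "\<lambda>H r. greedy_step rule u (\<tau> (Suc l)) (B (Suc l)) H r"
  define D where "D = (\<Sum>k=1..l. (c k)\<^sup>2)"
  define d where "d = c (Suc l)"
  interpret pair_sigma_finite "std_gaussian :: (real^'N^'n) measure" "std_gaussian :: (real^'N^'n) measure" ..
  have k: "Suc l \<in> {1..L}" using Suc.prems by auto
  obtain F :: "real \<Rightarrow> real^'N^'n \<Rightarrow> real" where F_s: "\<And>G. 1-lipschitz_on UNIV (\<lambda>s. F s G)"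
    and F_G: "\<And>s. d-lipschitz_on UNIV (F s)"
    and law: "\<And>r. distr std_gaussian borel (\<lambda>G. norm (?S G r)) = distr std_gaussian borel (F (norm r))"
    unfolding d_def using greedy_step_law[OF code tb u k, where rule = rule] by metis
  have h: "1-lipschitz_on UNIV h" by (rule Suc.prems(2))
  have [measurable]: "h \<in> borel_measurable borel" by (rule lipschitz_on_borel_measurable[OF h])
  have fin: "finite (B k)" if "k \<in> {1..Suc l}" for k
    using code that Suc.prems by (auto simp: additive_orthogonal_code_def)
  have hF: "d-lipschitz_on UNIV (\<lambda>G. h (F s G))" for s
    using lipschitz_on_compose2[OF F_G[of s] lipschitz_on_subset[OF h subset_UNIV]] by simp
  note hF_int = integrable_std_gaussian_lipschitz(1)[OF hF]
  define h' where "h' s = (\<integral>G. h (F s G) \<partial>std_gaussian)" for s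
  \<comment> \<open>Both starting norms are coupled through the same matrix \<open>G\<close>; here
    the Lipschitz property of \<open>F\<close> in its first argument enters.\<close>
  have h': "1-lipschitz_on UNIV h'"
  proof (rule lipschitz_onI)
    fix s t :: real
    have "\<bar>h' s - h' t\<bar> = \<bar>\<integral>G. h (F s G) - h (F t G) \<partial>std_gaussian\<bar>"
      unfolding h'_def using hF_int by (subst Bochner_Integration.integral_diff) auto
    also have "\<dots> \<le> (\<integral>G. dist s t \<partial>(std_gaussian :: (real^'N^'n) measure))"
    proof (rule order_trans[OF integral_abs_bound], rule integral_mono)
      show "\<bar>h (F s G) - h (F t G)\<bar> \<le> dist s t" for G
        using lipschitz_onD[OF h, of "F s G" "F t G"] lipschitz_onD[OF F_s, of s t G] by (simp add: dist_real_def)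
    qed (use hF_int in auto)
    finally show "dist (h' s) (h' t) \<le> 1 * dist s t" by (simp add: dist_real_def)
  qed simp
  have [measurable]: "h' \<in> borel_measurable borel" by (rule lipschitz_on_borel_measurable[OF h'])
  obtain m where m: "1-lipschitz_on UNIV m"
    "\<And>y. integrable std_gaussian (\<lambda>A. h' (norm (?R A y l)))"
    "\<And>y. (\<integral>A. h' (norm (?R A y l)) \<partial>std_gaussian) = m (norm y)"
    "\<And>y s. (\<integral>\<^sup>+A. ennreal (exp (s * h' (norm (?R A y l)))) \<partial>std_gaussian) \<le>
      ennreal (exp (s\<^sup>2 * D / 2 + s * m (norm y)))"
    using Suc.IH[OF _ h'] Suc.prems(1) unfolding D_def by auto
  have step_meas: "(\<lambda>H. norm (?S H r)) \<in> borel_measurable borel" for r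
    using measurable_compose[OF _ measurable_greedy_step[OF fin[of "Suc l"]], of "\<lambda>H. (H, r)" borel rule u "\<tau> (Suc l)"]
    by simp
  have F_meas: "F s \<in> borel_measurable borel" for s by (rule lipschitz_on_borel_measurable[OF F_G])
  \<comment> \<open>Only the law of the new norm matters, so \<open>F (norm r)\<close> may replace
    it, and concentration applies to \<open>h\<close> composed with a \<open>d\<close>-Lipschitz
    function.\<close>
  have inner_exp: "(\<integral>\<^sup>+H. ennreal (exp (s * h (norm (?S H r)))) \<partial>std_gaussian) \<le>
      ennreal (exp (s\<^sup>2 * d\<^sup>2 / 2)) * ennreal (exp (s * h' (norm r)))" for s r
  proof -
    have "(\<integral>\<^sup>+H. ennreal (exp (s * h (norm (?S H r)))) \<partial>std_gaussian) =
      (\<integral>\<^sup>+x. ennreal (exp (s * h x)) \<partial>distr std_gaussian borel (\<lambda>H. norm (?S H r)))"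
      using step_meas by (subst nn_integral_distr) auto
    also have "\<dots> = (\<integral>\<^sup>+H. ennreal (exp (s * h (F (norm r) H))) \<partial>std_gaussian)"
      unfolding law using F_meas by (subst nn_integral_distr) auto
    also have "\<dots> = ennreal (\<integral>H. exp (s * h (F (norm r) H)) \<partial>std_gaussian)"
      using integrable_std_gaussian_lipschitz(2)[OF lipschitz_on_cmult_real[OF hF]]
      by (intro nn_integral_eq_integral) auto
    also have "\<dots> \<le> ennreal (exp ((\<bar>s\<bar> * d)\<^sup>2 / 2 + (\<integral>H. s * h (F (norm r) H) \<partial>std_gaussian)))"
      by (intro ennreal_leI std_gaussian_concentration lipschitz_on_cmult_real[OF hF])
    also have "\<dots> = ennreal (exp (s\<^sup>2 * d\<^sup>2 / 2)) * ennreal (exp (s * h' (norm r)))"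
      by (simp add: h'_def exp_add ennreal_mult power_mult_distrib)
    finally show ?thesis .
  qed
  have inner_int: "(\<integral>H. h (norm (?S H r)) \<partial>std_gaussian) = h' (norm r)" for r
  proof -
    have "(\<integral>H. h (norm (?S H r)) \<partial>std_gaussian) =
      (\<integral>x. h x \<partial>distr std_gaussian borel (\<lambda>H. norm (?S H r)))"
      using step_meas by (subst integral_distr) auto
    also have "\<dots> = h' (norm r)"
      unfolding law h'_def using F_meas by (subst integral_distr) auto
    finally show ?thesis .
  qed
  have "1-lipschitz_on UNIV m \<and> (\<forall>y. integrable std_gaussian (\<lambda>A. h (norm (?R A y (Suc l)))) \<and>
    (\<integral>A. h (norm (?R A y (Suc l))) \<partial>std_gaussian) = m (norm y) \<and>
    (\<forall>s. (\<integral>\<^sup>+A. ennreal (exp (s * h (norm (?R A y (Suc l))))) \<partial>std_gaussian) \<le>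
      ennreal (exp (s\<^sup>2 * (D + d\<^sup>2) / 2 + s * m (norm y)))))"
  proof (intro conjI allI m(1))
    fix y
    have R_meas: "(\<lambda>A. ?R A y k) \<in> borel_measurable borel" if "k \<le> Suc l" for k
      using measurable_compose[OF _ measurable_greedy_residual[of k B rule u \<tau>], of "\<lambda>A. (A, y)" borel] fin that
      by auto
    have pair_meas: "(\<lambda>(G, H). ?S H (?R G y l)) \<in> borel_measurable (std_gaussian \<Otimes>\<^sub>M std_gaussian)"
    proof -
      have [measurable]: "(\<lambda>A. ?R A y l) \<in> borel_measurable borel" by (rule R_meas) simp
      have "(\<lambda>z. (snd z, ?R (fst z) y l)) \<in> std_gaussian \<Otimes>\<^sub>M std_gaussian \<rightarrow>\<^sub>M borel \<Otimes>\<^sub>M borel"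
        by measurable
      from measurable_compose[OF this measurable_greedy_step[OF fin[of "Suc l"]]]
      show ?thesis by (simp add: case_prod_unfold)
    qed
    note dist = distr_greedy_residual_Suc[OF code tb Suc.prems(1), of rule u y]
    have R_Suc: "(\<lambda>A. ?R A y (Suc l)) \<in> borel_measurable std_gaussian" using R_meas[of "Suc l"] by simp
    show ex: "(\<integral>\<^sup>+A. ennreal (exp (s * h (norm (?R A y (Suc l))))) \<partial>std_gaussian) \<le>
      ennreal (exp (s\<^sup>2 * (D + d\<^sup>2) / 2 + s * m (norm y)))" for s
    proof -
      have "(\<integral>\<^sup>+A. ennreal (exp (s * h (norm (?R A y (Suc l))))) \<partial>std_gaussian) =
        (\<integral>\<^sup>+r. ennreal (exp (s * h (norm r))) \<partial>distr std_gaussian borel (\<lambda>A. ?R A y (Suc l)))"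
        using R_Suc by (subst nn_integral_distr) auto
      also have "\<dots> = (\<integral>\<^sup>+z. ennreal (exp (s * h (norm (?S (snd z) (?R (fst z) y l))))) \<partial>(std_gaussian \<Otimes>\<^sub>M std_gaussian))"
        unfolding dist using pair_meas by (subst nn_integral_distr) (auto simp: case_prod_unfold)
      also have "\<dots> = (\<integral>\<^sup>+G. (\<integral>\<^sup>+H. ennreal (exp (s * h (norm (?S H (?R G y l))))) \<partial>std_gaussian) \<partial>std_gaussian)"
        using pair_meas by (subst std_gaussian.nn_integral_fst[symmetric]) (auto simp: case_prod_unfold)
      \<comment> \<open>The conditional mean \<open>h'\<close> stays in the exponent for the
        induction hypothesis, while \<open>d\<^sup>2\<close> is added to the proxy.\<close>
      also have "\<dots> \<le> (\<integral>\<^sup>+G. ennreal (exp (s\<^sup>2 * d\<^sup>2 / 2)) * ennreal (exp (s * h' (norm (?R G y l)))) \<partial>std_gaussian)"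
        by (intro nn_integral_mono inner_exp)
      also have "\<dots> = ennreal (exp (s\<^sup>2 * d\<^sup>2 / 2)) * (\<integral>\<^sup>+G. ennreal (exp (s * h' (norm (?R G y l)))) \<partial>std_gaussian)"
        using R_meas[of l] by (intro nn_integral_cmult) simp
      also have "\<dots> \<le> ennreal (exp (s\<^sup>2 * d\<^sup>2 / 2)) * ennreal (exp (s\<^sup>2 * D / 2 + s * m (norm y)))"
        by (intro mult_left_mono m(4)) simp
      also have "\<dots> = ennreal (exp (s\<^sup>2 * (D + d\<^sup>2) / 2 + s * m (norm y)))"
        by (simp add: ennreal_mult'[symmetric] exp_add[symmetric] algebra_simps add_divide_distrib)
      finally show ?thesis .
    qed
    show int: "integrable std_gaussian (\<lambda>A. h (norm (?R A y (Suc l))))"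
      using R_Suc by (intro integrable_of_exp_moments(1)[OF _ ex]) simp
    have "integrable (distr std_gaussian borel (\<lambda>A. ?R A y (Suc l))) (\<lambda>r. h (norm r))"
      using int R_Suc by (subst integrable_distr_eq) auto
    hence int2: "integrable (std_gaussian \<Otimes>\<^sub>M std_gaussian) (\<lambda>z. h (norm (?S (snd z) (?R (fst z) y l))))"
      unfolding dist using pair_meas by (subst (asm) integrable_distr_eq) (auto simp: case_prod_unfold)
    have "(\<integral>A. h (norm (?R A y (Suc l))) \<partial>std_gaussian) =
        (\<integral>r. h (norm r) \<partial>distr std_gaussian borel (\<lambda>A. ?R A y (Suc l)))"
      using R_Suc by (subst integral_distr) auto
    also have "\<dots> = (\<integral>z. h (norm (?S (snd z) (?R (fst z) y l))) \<partial>(std_gaussian \<Otimes>\<^sub>M std_gaussian))"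
      unfolding dist using pair_meas by (subst integral_distr) (auto simp: case_prod_unfold)
    also have "\<dots> = (\<integral>G. (\<integral>H. h (norm (?S H (?R G y l))) \<partial>std_gaussian) \<partial>std_gaussian)"
      using integral_fst'[OF int2] by simp
    also have "\<dots> = m (norm y)" by (simp add: inner_int m(3))
    finally show "(\<integral>A. h (norm (?R A y (Suc l))) \<partial>std_gaussian) = m (norm y)" .
  qed
  thus ?case by (intro exI[of _ m]) (simp add: D_def d_def)
qed

section \<open>Transfer to the given probability space\<close>

lemma distr_std_gaussian_matrix:
  fixes A :: "'w \<Rightarrow> real^'N^'n"
  assumes "prob_space M" "prob_space.std_gaussian_matrix M A"
  shows "A \<in> borel_measurable M" "distr M borel A = std_gaussian"
proof -
  interpret prob_space M by fact
  have ind: "indep_vars (\<lambda>_. borel) (\<lambda>(i, j) \<omega>. A \<omega> $ i $ j) UNIV"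
    and dens: "distributed M lborel (\<lambda>\<omega>. A \<omega> $ i $ j) std_normal_density" for i j
    using assms(2) by (auto simp: std_gaussian_matrix_def)
  define E :: "'n \<times> 'N \<Rightarrow> real^'N^'n" where "E = (\<lambda>(i, j). axis i (axis j 1))"
  have inner_E: "G \<bullet> E z = G $ fst z $ snd z" for G :: "real^'N^'n" and z
    by (simp add: E_def inner_axis case_prod_unfold)
  have E: "bij_betw E UNIV Basis"
  proof (rule bij_betw_imageI)
    show "inj E" by (auto simp: inj_def E_def axis_eq_axis axis_eq_0_iff)
    show "range E = Basis" by (auto simp: E_def Basis_vec_def)
  qed
  have coord: "(\<lambda>\<omega>. A \<omega> $ i $ j) \<in> borel_measurable M" for i j
    using distributed_measurable[OF dens[of i j]] by simp
  show meas[measurable]: "A \<in> borel_measurable M"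
    unfolding borel_measurable_euclidean_space[of A] bij_betw_imp_surj_on[OF E, symmetric]
    using coord by (simp add: inner_E)
  show "distr M borel A = std_gaussian"
  \<comment> \<open>Open boxes generate the Borel sets and are closed under intersection; on them
    independence of the entries turns the law into a product.\<close>
  proof (rule measure_eqI_generator_eq)
    let ?E = "range (\<lambda>(a, b). box a b :: (real^'N^'n) set)"
    show "Int_stable ?E" by (auto simp: Int_stable_def box_Int_box)
    show "?E \<subseteq> Pow UNIV" "sets (distr M borel A) = sigma_sets UNIV ?E"
      "sets (std_gaussian :: (real^'N^'n) measure) = sigma_sets UNIV ?E"
      by (simp_all add: borel_eq_box)
    let ?A = "\<lambda>n::nat. box (- (real n *\<^sub>R One)) (real n *\<^sub>R One) :: (real^'N^'n) set"
    show "range ?A \<subseteq> ?E" "(\<Union>i. ?A i) = UNIV"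
      unfolding UN_box_eq_UNIV by auto
    interpret D: prob_space "distr M borel A" by (rule prob_space_distr) simp
    show "emeasure (distr M borel A) (?A i) \<noteq> \<infinity>" for i by simp
    fix X assume "X \<in> ?E"
    then obtain l u where X: "X = box l u" by auto
    define I where "I z = {l $ fst z $ snd z <..< u $ fst z $ snd z}" for z
    have vim: "A -` box l u \<inter> space M = (\<Inter>z\<in>UNIV. (\<lambda>\<omega>. A \<omega> $ fst z $ snd z) -` I z \<inter> space M)"
      unfolding box_def bij_betw_imp_surj_on[OF E, symmetric] by (auto simp: inner_E I_def)
    have "emeasure (distr M borel A) X = emeasure M (\<Inter>z\<in>UNIV. (\<lambda>\<omega>. A \<omega> $ fst z $ snd z) -` I z \<inter> space M)"
      unfolding X by (subst emeasure_distr) (auto simp: vim)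
    also have "\<dots> = (\<Prod>z\<in>UNIV. emeasure M ((\<lambda>\<omega>. A \<omega> $ fst z $ snd z) -` I z \<inter> space M))"
      using indep_varsD_finite[OF ind, of I] unfolding emeasure_eq_measure
      by (simp add: case_prod_unfold I_def prod_ennreal)
    also have "\<dots> = (\<Prod>z\<in>UNIV. emeasure (density lborel std_normal_density) (I z))"
    proof (intro prod.cong refl)
      fix z :: "'n \<times> 'N"
      have "emeasure M ((\<lambda>\<omega>. A \<omega> $ fst z $ snd z) -` I z \<inter> space M) = emeasure (distr M lborel (\<lambda>\<omega>. A \<omega> $ fst z $ snd z)) (I z)"
        using coord by (subst emeasure_distr) (auto simp: I_def)
      thus "emeasure M ((\<lambda>\<omega>. A \<omega> $ fst z $ snd z) -` I z \<inter> space M) = emeasure (density lborel std_normal_density) (I z)"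
        by (simp add: distributed_distr_eq_density[OF dens])
    qed
    also have "\<dots> = (\<Prod>b\<in>Basis. emeasure (density lborel std_normal_density) {l \<bullet> b<..<u \<bullet> b})"
      by (subst prod.reindex_bij_betw[OF E, symmetric]) (simp add: inner_E I_def)
    also have "\<dots> = emeasure std_gaussian X"
      using emeasure_std_gaussian_box[of "\<lambda>b. {l \<bullet> b<..<u \<bullet> b}"] by (simp add: X box_def)
    finally show "emeasure (distr M borel A) X = emeasure std_gaussian X" .
  qed
qed

lemma (in prob_space) sub_gaussian_tail:
  assumes X: "sub_gaussian \<nu> X" and \<nu>: "0 < \<nu>" and t: "0 \<le> t"
  shows "prob {\<omega> \<in> space M. \<bar>X \<omega>\<bar> \<ge> t} \<le> 2 * exp (- (t\<^sup>2 / (2 * \<nu>)))"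
proof (cases "t = 0")
  case True
  thus ?thesis by (simp add: prob_space)
next
  case False
  have [measurable]: "X \<in> borel_measurable M"
    and int: "integrable M (\<lambda>\<omega>. exp (s * X \<omega>))"
    and ln: "ln (expectation (\<lambda>\<omega>. exp (s * X \<omega>))) \<le> s\<^sup>2 * \<nu> / 2" for s
    using X by (auto simp: sub_gaussian_def)
  have le: "expectation (\<lambda>\<omega>. exp (s * X \<omega>)) \<le> exp (s\<^sup>2 * \<nu> / 2)" for s
  proof (cases "0 < expectation (\<lambda>\<omega>. exp (s * X \<omega>))")
    case True
    thus ?thesis using ln[of s] by (metis exp_le_cancel_iff exp_ln)
  qed (use order_trans[OF _ exp_ge_zero] in \<open>simp add: not_less\<close>)
  \<comment> \<open>The minimiser of the Chernoff exponent
    \<open>s\<^sup>2 * \<nu> / 2 - s * t\<close>.\<close>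
  define s where "s = t / \<nu>"
  have s: "0 < s" using t \<nu> False by (simp add: s_def)
  have one: "prob {\<omega> \<in> space M. \<epsilon> * X \<omega> \<ge> t} \<le> exp (- (t\<^sup>2 / (2 * \<nu>)))" if \<epsilon>: "\<epsilon> = 1 \<or> \<epsilon> = -1" for \<epsilon>
  proof -
    have "set_integrable M (space M) (\<lambda>\<omega>. exp (s * (\<epsilon> * X \<omega>)))"
      unfolding set_integrable_def using int[of "s * \<epsilon>"]
      by (subst Bochner_Integration.integrable_cong[OF refl, of _ _ "\<lambda>\<omega>. exp ((s * \<epsilon>) * X \<omega>)"])
        (auto simp: mult.assoc)
    hence "prob {\<omega> \<in> space M. \<epsilon> * X \<omega> \<ge> t} \<le> exp (- s * t) * (\<integral>\<omega>\<in>space M. exp (s * (\<epsilon> * X \<omega>)) \<partial>M)"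
      by (rule Chernoff_ineq_ge[OF s]) simp
    also have "(\<integral>\<omega>\<in>space M. exp (s * (\<epsilon> * X \<omega>)) \<partial>M) = expectation (\<lambda>\<omega>. exp ((s * \<epsilon>) * X \<omega>))"
      using int[of "s * \<epsilon>"] by (simp add: set_integral_space mult.assoc)
    also have "\<dots> \<le> exp ((s * \<epsilon>)\<^sup>2 * \<nu> / 2)" by (rule le)
    also have "exp (- s * t) * exp ((s * \<epsilon>)\<^sup>2 * \<nu> / 2) = exp (- (t\<^sup>2 / (2 * \<nu>)))"
      using \<nu> \<epsilon> by (auto simp: s_def exp_add[symmetric] power2_eq_square field_simps)
    finally show ?thesis by simp
  qed
  have "prob {\<omega> \<in> space M. \<bar>X \<omega>\<bar> \<ge> t} \<le> prob ({\<omega> \<in> space M. 1 * X \<omega> \<ge> t} \<union> {\<omega> \<in> space M. (-1) * X \<omega> \<ge> t})"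
    by (intro finite_measure_mono) auto
  also have "\<dots> \<le> prob {\<omega> \<in> space M. 1 * X \<omega> \<ge> t} + prob {\<omega> \<in> space M. (-1) * X \<omega> \<ge> t}"
    by (rule measure_Un_le) auto
  also have "\<dots> \<le> 2 * exp (- (t\<^sup>2 / (2 * \<nu>)))" using one[of 1] one[of "-1"] by simp
  finally show ?thesis .
qed

theorem theorem1:
  fixes M :: "'w measure"
    and A :: "'w \<Rightarrow> real^'N^'n" and x :: "'w \<Rightarrow> real^'n"
    and L :: nat and B :: "nat \<Rightarrow> (real^'N) set" and c :: "nat \<Rightarrow> real"
    and rule :: greedy_rule and u :: "real^'n"
    and \<tau> :: "nat \<Rightarrow> (real^'N) set \<Rightarrow> real^'N"
  assumes "prob_space M"
    and "additive_orthogonal_code L B c"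
    and "u \<noteq> 0" and "tie_breaking L B \<tau>"
    and "prob_space.std_gaussian_matrix M A"
    and "x \<in> borel_measurable M"
    and "prob_space.indep_set M (sets (vimage_algebra (space M) A borel))
           (sets (vimage_algebra (space M) x borel))"
  shows "\<forall>l\<in>{1..L}. \<exists>\<mu> :: real \<Rightarrow> real.
    \<mu> \<in> {0..} \<rightarrow> {0..} \<and> 1-lipschitz_on {0..} \<mu> \<and>
    (\<forall>y. has_bochner_integral M (\<lambda>\<omega>. norm (greedy_residual rule u \<tau> B (A \<omega>) y l)) (\<mu> (norm y))) \<and>
    (AE \<omega> in M.
       nn_cond_exp M (vimage_algebra (space M) x borel)
         (\<lambda>\<omega>. ennreal (norm (greedy_residual rule u \<tau> B (A \<omega>) (x \<omega>) l))) \<omega>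
       = ennreal (\<mu> (norm (x \<omega>)))) \<and>
    prob_space.sub_gaussian M (\<Sum>k=1..l. (c k)\<^sup>2)
      (\<lambda>\<omega>. norm (greedy_residual rule u \<tau> B (A \<omega>) (x \<omega>) l) - \<mu> (norm (x \<omega>))) \<and>
    (\<forall>t\<ge>0. measure M {\<omega> \<in> space M.
         \<bar>norm (greedy_residual rule u \<tau> B (A \<omega>) (x \<omega>) l) - \<mu> (norm (x \<omega>))\<bar> \<ge> t}
       \<le> 2 * exp (- (t\<^sup>2 / (2 * (\<Sum>k=1..l. (c k)\<^sup>2)))))"
proof
  fix l assume l: "l \<in> {1..L}"
  interpret prob_space M by fact
  note [measurable] = distr_std_gaussian_matrix(1)[OF assms(1,5)] assms(6)
  define W where "W = (\<lambda>G y. norm (greedy_residual rule u \<tau> B G y l))"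
  define D where "D = (\<Sum>k=1..l. (c k)\<^sup>2)"
  have fin: "finite (B k)" if "k \<in> {1..l}" for k
    using assms(2) that l by (auto simp: additive_orthogonal_code_def)
  have "c 1 > 0" using assms(2) l by (auto simp: additive_orthogonal_code_def)
  moreover have "(c 1)\<^sup>2 \<le> D"
    unfolding D_def using l by (intro member_le_sum) auto
  ultimately have D: "0 < D" by (smt (verit) zero_less_power)
  have W_meas[measurable]: "(\<lambda>z. W (fst z) (snd z)) \<in> borel_measurable (borel \<Otimes>\<^sub>M borel)"
  proof -
    have "(\<lambda>(G, y). greedy_residual rule u \<tau> B G y l) \<in> borel_measurable (borel \<Otimes>\<^sub>M borel)"
      by (rule measurable_greedy_residual) (rule fin)
    thus ?thesis by (simp add: W_def case_prod_unfold)
  qed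
  have WA_meas[measurable]: "(\<lambda>G. W G y) \<in> borel_measurable borel" for y
    using measurable_compose[OF _ W_meas, of "\<lambda>G. (G, y)" borel] by simp
  have "l \<le> L" using l by simp
  have id_lip: "1-lipschitz_on UNIV (\<lambda>t::real. t)" by (simp add: lipschitz_on_def)
  from greedy_residual_moments[OF assms(2,4,3) \<open>l \<le> L\<close> id_lip, where rule = rule]
  obtain \<mu> where \<mu>: "1-lipschitz_on UNIV \<mu>"
    and W_int: "\<And>y. integrable std_gaussian (\<lambda>G. W G y)"
    and W_mean: "\<And>y. (\<integral>G. W G y \<partial>std_gaussian) = \<mu> (norm y)"
    and W_exp: "\<And>y s. (\<integral>\<^sup>+G. ennreal (exp (s * W G y)) \<partial>std_gaussian) \<le>
      ennreal (exp (s\<^sup>2 * D / 2 + s * \<mu> (norm y)))"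
    unfolding W_def D_def by blast
  have [measurable]: "\<mu> \<in> borel_measurable borel" by (rule lipschitz_on_borel_measurable[OF \<mu>])
  have \<mu>_norm: "0 \<le> \<mu> (norm y)" for y :: "real^'n"
    unfolding W_mean[symmetric] by (rule integral_nonneg_AE) (simp add: W_def)
  define Z where "Z = (\<lambda>\<omega>. W (A \<omega>) (x \<omega>))"
  define Y where "Y = (\<lambda>\<omega>. Z \<omega> - \<mu> (norm (x \<omega>)))"
  have [measurable]: "Z \<in> borel_measurable M"
    using measurable_compose[OF _ W_meas, of "\<lambda>\<omega>. (A \<omega>, x \<omega>)" M] by (simp add: Z_def)
  have [measurable]: "Y \<in> borel_measurable M" unfolding Y_def by measurable

  define X where "X = distr M borel x"
  have X: "sets X = sets borel" "space X = UNIV" by (simp_all add: X_def)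
  interpret X: prob_space X unfolding X_def by (rule prob_space_distr) simp
  interpret P: pair_sigma_finite "std_gaussian :: (real^'N^'n) measure" X ..
  note [measurable_cong] = X(1)
  \<comment> \<open>Independence of the generated sigma-algebras, evaluated on rectangles, says that
    the pair has the product law.\<close>
  have joint: "distr M (borel \<Otimes>\<^sub>M borel) (\<lambda>\<omega>. (A \<omega>, x \<omega>)) = std_gaussian \<Otimes>\<^sub>M X"
  proof (rule pair_measure_eqI[symmetric])
    show "sets ((std_gaussian :: (real^'N^'n) measure) \<Otimes>\<^sub>M X) =
        sets (distr M (borel \<Otimes>\<^sub>M borel) (\<lambda>\<omega>. (A \<omega>, x \<omega>)))"
      unfolding sets_distr by (rule sets_pair_measure_cong) (simp_all add: X)
    fix S T assume "S \<in> sets (std_gaussian :: (real^'N^'n) measure)" "T \<in> sets X"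
    hence [measurable]: "S \<in> sets borel" "T \<in> sets borel" by (simp_all add: X)
    have "A -` S \<inter> space M \<in> sets (vimage_algebra (space M) A borel)"
      "x -` T \<inter> space M \<in> sets (vimage_algebra (space M) x borel)"
      by (auto intro!: in_vimage_algebra)
    hence "prob ((A -` S \<inter> space M) \<inter> (x -` T \<inter> space M)) = prob (A -` S \<inter> space M) * prob (x -` T \<inter> space M)"
      using assms(7) unfolding indep_sets2_eq by blast
    moreover have "(\<lambda>\<omega>. (A \<omega>, x \<omega>)) -` (S \<times> T) \<inter> space M = (A -` S \<inter> space M) \<inter> (x -` T \<inter> space M)"
      by auto
    ultimately show "emeasure std_gaussian S * emeasure X T =
        emeasure (distr M (borel \<Otimes>\<^sub>M borel) (\<lambda>\<omega>. (A \<omega>, x \<omega>))) (S \<times> T)"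
      unfolding X_def distr_std_gaussian_matrix(2)[OF assms(1,5), symmetric]
      by (simp add: emeasure_distr emeasure_eq_measure ennreal_mult)
  qed unfold_locales
  \<comment> \<open>With the integral over \<open>G\<close> inside, the source is frozen at
    \<open>y\<close>, and the bounds for fixed sources apply whatever the law of
    \<open>x\<close>.\<close>
  have nn_joint: "(\<integral>\<^sup>+\<omega>. f (A \<omega>, x \<omega>) \<partial>M) = (\<integral>\<^sup>+y. (\<integral>\<^sup>+G. f (G, y) \<partial>std_gaussian) \<partial>X)"
    if [measurable]: "f \<in> borel_measurable (borel \<Otimes>\<^sub>M borel)" for f :: "_ \<Rightarrow> ennreal"
  proof -
    have "(\<integral>\<^sup>+\<omega>. f (A \<omega>, x \<omega>) \<partial>M) = (\<integral>\<^sup>+z. f z \<partial>(std_gaussian \<Otimes>\<^sub>M X))"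
      unfolding joint[symmetric] by (subst nn_integral_distr) auto
    also have "\<dots> = (\<integral>\<^sup>+y. (\<integral>\<^sup>+G. f (G, y) \<partial>std_gaussian) \<partial>X)"
      by (rule P.nn_integral_snd[symmetric]) simp
    finally show ?thesis .
  qed

  have mean: "has_bochner_integral M (\<lambda>\<omega>. W (A \<omega>) y) (\<mu> (norm y))" for y
    using W_int[of y] W_mean[of y]
    unfolding distr_std_gaussian_matrix(2)[OF assms(1,5), symmetric]
    by (simp add: has_bochner_integral_iff integrable_distr_eq integral_distr)

  have Y_exp: "(\<integral>\<^sup>+\<omega>. ennreal (exp (s * Y \<omega>)) \<partial>M) \<le> ennreal (exp (s\<^sup>2 * D / 2))" for s
  proof -
    let ?g = "\<lambda>z. ennreal (exp (- s * \<mu> (norm (snd z)))) * ennreal (exp (s * W (fst z) (snd z)))"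
    have "ennreal (exp (s * Y \<omega>)) = ?g (A \<omega>, x \<omega>)" for \<omega>
      by (simp add: Y_def Z_def ennreal_mult'[symmetric] exp_add[symmetric] algebra_simps)
    moreover have "?g \<in> borel_measurable (borel \<Otimes>\<^sub>M borel)" by measurable
    ultimately have "(\<integral>\<^sup>+\<omega>. ennreal (exp (s * Y \<omega>)) \<partial>M) =
      (\<integral>\<^sup>+y. (\<integral>\<^sup>+G. ennreal (exp (- s * \<mu> (norm y))) * ennreal (exp (s * W G y)) \<partial>std_gaussian) \<partial>X)"
      using nn_joint[of ?g] by (simp only: fst_conv snd_conv)
    also have "\<dots> = (\<integral>\<^sup>+y. ennreal (exp (- s * \<mu> (norm y))) * (\<integral>\<^sup>+G. ennreal (exp (s * W G y)) \<partial>std_gaussian) \<partial>X)"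
      by (intro nn_integral_cong nn_integral_cmult) simp
    also have "\<dots> \<le> (\<integral>\<^sup>+y. ennreal (exp (- s * \<mu> (norm y))) * ennreal (exp (s\<^sup>2 * D / 2 + s * \<mu> (norm y))) \<partial>X)"
      by (intro nn_integral_mono mult_left_mono W_exp) simp
    \<comment> \<open>Centring cancels the only dependence on \<open>y\<close>, so the conditional
      bound is also the unconditional one.\<close>
    also have "\<dots> = (\<integral>\<^sup>+y. ennreal (exp (s\<^sup>2 * D / 2)) \<partial>X)"
      by (intro nn_integral_cong) (simp add: ennreal_mult'[symmetric] exp_add[symmetric])
    also have "\<dots> = ennreal (exp (s\<^sup>2 * D / 2))" by (simp add: X.emeasure_space_1)
    finally show ?thesis .
  qed
  have Y_int: "integrable M Y" "integrable M (\<lambda>\<omega>. exp (s * Y \<omega>))" for s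
    using integrable_of_exp_moments[where f = Y and M = M and C = "\<lambda>s. exp (s\<^sup>2 * D / 2)"] Y_exp
    by auto
  \<comment> \<open>Neither \<open>Z\<close> nor the norm of \<open>x\<close> need be integrable, so
    the expectation cannot be split. The difference is integrable by its exponential moments and has
    inner mean 0 for every \<open>y\<close>.\<close>
  have Y_mean: "expectation Y = 0"
  proof -
    let ?f = "\<lambda>G y. W G y - \<mu> (norm y)"
    have "integrable (std_gaussian \<Otimes>\<^sub>M X) (case_prod ?f)"
      unfolding joint[symmetric] using Y_int(1)
      by (subst integrable_distr_eq) (auto simp: Y_def Z_def case_prod_unfold)
    from P.integral_snd[OF this]
    have "(\<integral>y. (\<integral>G. ?f G y \<partial>std_gaussian) \<partial>X) = (\<integral>z. case_prod ?f z \<partial>(std_gaussian \<Otimes>\<^sub>M X))" .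
    also have "\<dots> = expectation Y"
      unfolding joint[symmetric] by (subst integral_distr) (auto simp: Y_def Z_def case_prod_unfold)
    finally show ?thesis using W_int W_mean by simp
  qed
  have subg: "sub_gaussian D Y"
    unfolding sub_gaussian_def
  proof (intro conjI allI)
    fix s
    have "ennreal (expectation (\<lambda>\<omega>. exp (s * Y \<omega>))) \<le> ennreal (exp (s\<^sup>2 * D / 2))"
      using Y_exp[of s] by (subst nn_integral_eq_integral[symmetric]) (auto intro: Y_int(2))
    hence le: "expectation (\<lambda>\<omega>. exp (s * Y \<omega>)) \<le> exp (s\<^sup>2 * D / 2)" by simp
    show "ln (expectation (\<lambda>\<omega>. exp (s * Y \<omega>))) \<le> s\<^sup>2 * D / 2"
    proof (cases "0 < expectation (\<lambda>\<omega>. exp (s * Y \<omega>))")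
      case True
      thus ?thesis using le by (metis exp_le_cancel_iff exp_ln)
    next
      \<comment> \<open>Covered by the convention that \<open>ln 0\<close> is 0.\<close>
      case False
      moreover have "0 \<le> expectation (\<lambda>\<omega>. exp (s * Y \<omega>))" by (rule integral_nonneg_AE) simp
      ultimately have "expectation (\<lambda>\<omega>. exp (s * Y \<omega>)) = 0" by simp
      thus ?thesis using D by simp
    qed
  qed (use D Y_int Y_mean in auto)

  let ?F = "vimage_algebra (space M) x borel"
  interpret F: finite_measure_subalgebra M ?F
  proof
    show "subalgebra M ?F"
      using assms(6) by (auto simp: subalgebra_def sets_vimage_algebra2 intro!: measurable_sets)
  qed
  have [measurable]: "x \<in> borel_measurable ?F"
    by (rule measurable_vimage_algebra1) simp
  \<comment> \<open>The conditional expectation for nonnegative functions is used since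
    \<open>Z\<close> may have infinite mean.\<close>
  have cond: "AE \<omega> in M. nn_cond_exp M ?F (\<lambda>\<omega>. ennreal (Z \<omega>)) \<omega> = ennreal (\<mu> (norm (x \<omega>)))"
  proof -
    have "AE \<omega> in M. ennreal (\<mu> (norm (x \<omega>))) = nn_cond_exp M ?F (\<lambda>\<omega>. ennreal (Z \<omega>)) \<omega>"
    proof (rule F.nn_cond_exp_charact)
      fix S assume "S \<in> sets ?F"
      then obtain T where T[measurable]: "T \<in> sets borel" and S: "S = x -` T \<inter> space M"
        by (auto simp: sets_vimage_algebra2)
      have "(\<integral>\<^sup>+\<omega>\<in>S. ennreal (Z \<omega>) \<partial>M) = (\<integral>\<^sup>+\<omega>. ennreal (W (A \<omega>) (x \<omega>)) * indicator T (x \<omega>) \<partial>M)"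
        by (intro nn_integral_cong) (auto simp: Z_def S indicator_def)
      also have "\<dots> = (\<integral>\<^sup>+y. (\<integral>\<^sup>+G. ennreal (W G y) * indicator T y \<partial>std_gaussian) \<partial>X)"
        using nn_joint[of "\<lambda>z. ennreal (W (fst z) (snd z)) * indicator T (snd z)"] by simp
      also have "\<dots> = (\<integral>\<^sup>+y. ennreal (\<mu> (norm y)) * indicator T y \<partial>X)"
      proof (intro nn_integral_cong)
        fix y
        have "(\<integral>\<^sup>+G. ennreal (W G y) \<partial>std_gaussian) = ennreal (\<mu> (norm y))"
          using nn_integral_eq_integral[OF W_int[of y]] W_mean[of y] by (simp add: W_def)
        thus "(\<integral>\<^sup>+G. ennreal (W G y) * indicator T y \<partial>std_gaussian) = ennreal (\<mu> (norm y)) * indicator T y"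
          by (subst nn_integral_multc) auto
      qed
      also have "\<dots> = (\<integral>\<^sup>+\<omega>. ennreal (\<mu> (norm (x \<omega>))) * indicator T (x \<omega>) \<partial>M)"
        unfolding X_def by (subst nn_integral_distr) auto
      also have "\<dots> = (\<integral>\<^sup>+\<omega>\<in>S. ennreal (\<mu> (norm (x \<omega>))) \<partial>M)"
        by (intro nn_integral_cong) (auto simp: S indicator_def)
      finally show "(\<integral>\<^sup>+\<omega>\<in>S. ennreal (Z \<omega>) \<partial>M) = (\<integral>\<^sup>+\<omega>\<in>S. ennreal (\<mu> (norm (x \<omega>))) \<partial>M)" .
    qed measurable
    thus ?thesis by eventually_elim simp
  qed

  have \<mu>_nonneg: "\<mu> \<in> {0..} \<rightarrow> {0..}"
  proof (intro Pi_I)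
    fix s :: real assume "s \<in> {0..}"
    \<comment> \<open>Nonnegativity of \<mu> is known at norms of vectors, and these exhaust the
      half-line.\<close>
    hence "s = norm (s *\<^sub>R axis undefined 1 :: real^'n)" by (simp add: norm_axis_1)
    thus "\<mu> s \<in> {0..}" using \<mu>_norm[of "s *\<^sub>R axis undefined 1"] by simp
  qed
  show "\<exists>\<mu> :: real \<Rightarrow> real.
    \<mu> \<in> {0..} \<rightarrow> {0..} \<and> 1-lipschitz_on {0..} \<mu> \<and>
    (\<forall>y. has_bochner_integral M (\<lambda>\<omega>. norm (greedy_residual rule u \<tau> B (A \<omega>) y l)) (\<mu> (norm y))) \<and>
    (AE \<omega> in M.
       nn_cond_exp M (vimage_algebra (space M) x borel)
         (\<lambda>\<omega>. ennreal (norm (greedy_residual rule u \<tau> B (A \<omega>) (x \<omega>) l))) \<omega>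
       = ennreal (\<mu> (norm (x \<omega>)))) \<and>
    prob_space.sub_gaussian M (\<Sum>k=1..l. (c k)\<^sup>2)
      (\<lambda>\<omega>. norm (greedy_residual rule u \<tau> B (A \<omega>) (x \<omega>) l) - \<mu> (norm (x \<omega>))) \<and>
    (\<forall>t\<ge>0. measure M {\<omega> \<in> space M.
         \<bar>norm (greedy_residual rule u \<tau> B (A \<omega>) (x \<omega>) l) - \<mu> (norm (x \<omega>))\<bar> \<ge> t}
       \<le> 2 * exp (- (t\<^sup>2 / (2 * (\<Sum>k=1..l. (c k)\<^sup>2)))))"
    using \<mu>_nonneg lipschitz_on_subset[OF \<mu> subset_UNIV] mean cond subg sub_gaussian_tail[OF subg D]
    unfolding Y_def Z_def W_def D_def by blast
qed

end
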